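(* Let $(\mathcal{T}_M,h,\Phi,\mathcal{U},\mathcal{Q})$ be an integrable harmonic Higgs bundle on the holomorphic tangent bundle of a complex manifold $M$ of dimension $m$, with $D'(\mathcal{U})=0$, where $D'+\overline\partial$ is the Chern connection of the positive-definite Hermitian metric $h$. Assume that $D'$ is holomorphic, i.e. $D'\overline\partial+\overline\partial D'=0$. Set $X\circ Y:=-\Phi_XY$. Then: (1) $X\circ Y=0$ for all $X,Y\in\mathcal{T}_M$. (2) If $\mathcal{U}=0$, then locally, in a suitable $D'$-flat holomorphic frame of $\mathcal{T}_M$, the matrix of $\mathcal{Q}$ is a constant diagonal matrix $\Lambda=\mathrm{diag}(\lambda_1,\dots,\lambda_m)$ and the structure connection is $$\tilde\nabla=D'+\frac{-\Lambda+\frac w2 I_m}{z}\,dz.$$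
   Context: Let $E$ be a holomorphic vector bundle (here $E=\mathcal{T}_M$) on a complex manifold $M$ with positive-definite Hermitian metric $h$. Let $H$ be the underlying $C^\infty$ bundle and $D=D'+\overline\partial$ the Chern connection of $h$. $P^\dagger$ denotes the $h$-adjoint of $P$, and $D'(P)=[D',P]$. A Higgs field is an $\mathcal{O}_M$-linear morphism $\Phi:E\to\Omega^1_M\otimes E$ with $\Phi\wedge\Phi=0$. $(E,h,\Phi)$ is a harmonic Higgs bundle if $D'+\overline\partial+\Phi+\Phi^\dagger$ is an integrable (flat) connection on $H$; in particular $D'\overline\partial+\overline\partial D'=-(\Phi\Phi^\dagger+\Phi^\dagger\Phi)$. An integrable harmonic Higgs bundle $(E,h,\Phi,\mathcal{U},\mathcal{Q})$ is a harmonic Higgs bundle with two $C^\infty$ endomorphisms $\mathcal{U},\mathcal{Q}$ of $H$ such that $$\overline\partial(\mathcal{U})=0,\quad \mathcal{Q}^\dagger=\mathcal{Q},\quad [\Phi,\mathcal{U}]=0,\quad D'(\mathcal{U})-[\Phi,\mathcal{Q}]+\Phi=0,\quad D'(\mathcal{Q})+[\Phi,\mathcal{U}^\dagger]=0.$$ The structure connection, for a fixed integer $w$ (the weight; $w=0$ is allowed), is the following connection on the pull-back of $E$ to $\mathbb{C}^*\times M$, with $z$ the coordinate on $\mathbb{C}^*$: $$\tilde\nabla=D'+\frac1z\Phi+\left(\frac{\mathcal{U}}{z}-\mathcal{Q}-z\,\mathcal{U}^\dagger+\frac w2\,\mathrm{Id}\right)\frac{dz}{z}.$$ *)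

theory Defs
  imports "HOL-Analysis.Analysis"
begin

section \<open>Calculus on open sets of complex n-space\<close>

text \<open>Iterated directional derivatives; only meaningful for open sets.\<close>

primrec Ck_on :: "nat \<Rightarrow> ('a::real_normed_vector \<Rightarrow> 'b::real_normed_vector) \<Rightarrow> 'a set \<Rightarrow> bool" where
  "Ck_on 0 = (\<lambda>f S. continuous_on S f)"
| "Ck_on (Suc n) = (\<lambda>f S. \<exists>f'. (\<forall>x\<in>S. (f has_derivative f' x) (at x)) \<and>
     (\<forall>v. Ck_on n (\<lambda>x. f' x v) S))"

definition smooth_on :: "'a::real_normed_vector set \<Rightarrow> ('a \<Rightarrow> 'b::real_normed_vector) \<Rightarrow> bool" where
  "smooth_on S f \<longleftrightarrow> (\<forall>n. Ck_on n f S)"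

definition holo_fun :: "(complex^'m) set \<Rightarrow> (complex^'m \<Rightarrow> complex) \<Rightarrow> bool" where
  "holo_fun S f \<longleftrightarrow> (\<forall>x\<in>S. \<exists>L. (f has_derivative L) (at x) \<and> (\<forall>a v. L (a *s v) = a * L v))"

definition holo_vec :: "(complex^'m) set \<Rightarrow> (complex^'m \<Rightarrow> complex^'n) \<Rightarrow> bool" where
  "holo_vec S f \<longleftrightarrow> (\<forall>k. holo_fun S (\<lambda>x. f x $ k))"

definition holo_mat :: "(complex^'m) set \<Rightarrow> (complex^'m \<Rightarrow> complex^'n^'l) \<Rightarrow> bool" where
  "holo_mat S f \<longleftrightarrow> (\<forall>k l. holo_fun S (\<lambda>x. f x $ k $ l))"

text \<open>Wirtinger derivatives with respect to the \<open>j\<close>-th coordinate, for scalar and (componentwise)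
  for vector valued functions that need only be real differentiable.\<close>

definition wirt :: "'m \<Rightarrow> (complex^'m \<Rightarrow> complex) \<Rightarrow> complex^'m \<Rightarrow> complex" where
  "wirt j f x = (frechet_derivative f (at x) (axis j 1) - \<i> * frechet_derivative f (at x) (axis j \<i>)) / 2"

definition wirt_bar :: "'m \<Rightarrow> (complex^'m \<Rightarrow> complex) \<Rightarrow> complex^'m \<Rightarrow> complex" where
  "wirt_bar j f x = (frechet_derivative f (at x) (axis j 1) + \<i> * frechet_derivative f (at x) (axis j \<i>)) / 2"

definition wirt_vec :: "'m \<Rightarrow> (complex^'m \<Rightarrow> complex^'n) \<Rightarrow> complex^'m \<Rightarrow> complex^'n" where
  "wirt_vec j s x = (\<chi> k. wirt j (\<lambda>y. s y $ k) x)"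

definition wirt_bar_vec :: "'m \<Rightarrow> (complex^'m \<Rightarrow> complex^'n) \<Rightarrow> complex^'m \<Rightarrow> complex^'n" where
  "wirt_bar_vec j s x = (\<chi> k. wirt_bar j (\<lambda>y. s y $ k) x)"

definition wirt_z_vec :: "(complex \<Rightarrow> complex^'n) \<Rightarrow> complex \<Rightarrow> complex^'n" where
  "wirt_z_vec s \<zeta> = (\<chi> k. (frechet_derivative (\<lambda>y. s y $ k) (at \<zeta>) 1
      - \<i> * frechet_derivative (\<lambda>y. s y $ k) (at \<zeta>) \<i>) / 2)"

section \<open>Complex manifolds and tensor fields on the holomorphic tangent bundle\<close>

text \<open>A chart is a pair of an open domain and a coordinate map; the values of the coordinate map
  outside the domain are irrelevant. The manifold \<open>M\<close> is the union of the chart domains.\<close>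

type_synonym ('p, 'm) chart = "'p set \<times> ('p \<Rightarrow> complex^'m)"

definition chart_img :: "('p, 'm) chart \<Rightarrow> 'p set \<Rightarrow> (complex^'m) set" where
  "chart_img c V = snd c ` (fst c \<inter> V)"

definition is_chart :: "('p::topological_space, 'm::finite) chart \<Rightarrow> bool" where
  "is_chart c \<longleftrightarrow> open (fst c) \<and> open (snd c ` fst c) \<and>
     homeomorphism (fst c) (snd c ` fst c) (snd c) (inv_into (fst c) (snd c))"

definition transition :: "('p, 'm) chart \<Rightarrow> ('p, 'm) chart \<Rightarrow> complex^'m \<Rightarrow> complex^'m" where
  "transition c d = snd d \<circ> inv_into (fst c) (snd c)"

definition complex_manifold ::
  "'p::{t2_space, second_countable_topology} set \<Rightarrow> ('p, 'm::finite) chart set \<Rightarrow> bool" where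
  "complex_manifold M \<A> \<longleftrightarrow> (\<forall>c\<in>\<A>. is_chart c) \<and> (\<Union>c\<in>\<A>. fst c) = M \<and>
     (\<forall>c\<in>\<A>. \<forall>d\<in>\<A>. holo_vec (chart_img c (fst d)) (transition c d))"

text \<open>The transition functions of the holomorphic tangent bundle: the complex Jacobian matrices
  of the coordinate changes.\<close>

definition jac :: "('p, 'm::finite) chart \<Rightarrow> ('p, 'm) chart \<Rightarrow> complex^'m \<Rightarrow> complex^'m^'m" where
  "jac c d z = jacobian (transition c d) (at z)"

text \<open>A tensor field is given by its components in every chart, as functions of the coordinates
  of that chart with respect to the coordinate frame, subject to the transformation law on overlaps.
  The components are only relevant on the image of the chart.\<close>

type_synonym 'm lsection = "complex^'m \<Rightarrow> complex^'m"

definition vector_field ::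
  "('p, 'm::finite) chart set \<Rightarrow> 'p set \<Rightarrow> (('p, 'm) chart \<Rightarrow> 'm lsection) \<Rightarrow> bool" where
  "vector_field \<A> V X \<longleftrightarrow> (\<forall>c\<in>\<A>. \<forall>d\<in>\<A>. \<forall>z\<in>chart_img c (fst d \<inter> V).
     X d (transition c d z) = jac c d z *v X c z)"

definition smooth_vector_field ::
  "('p, 'm::finite) chart set \<Rightarrow> 'p set \<Rightarrow> (('p, 'm) chart \<Rightarrow> 'm lsection) \<Rightarrow> bool" where
  "smooth_vector_field \<A> V X \<longleftrightarrow> vector_field \<A> V X \<and> (\<forall>c\<in>\<A>. smooth_on (chart_img c V) (X c))"

definition holo_vector_field ::
  "('p, 'm::finite) chart set \<Rightarrow> 'p set \<Rightarrow> (('p, 'm) chart \<Rightarrow> 'm lsection) \<Rightarrow> bool" where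
  "holo_vector_field \<A> V X \<longleftrightarrow> vector_field \<A> V X \<and> (\<forall>c\<in>\<A>. holo_vec (chart_img c V) (X c))"

text \<open>A (1,0)-form with values in the tangent bundle; the index is the direction.\<close>

definition vector_valued_form ::
  "('p, 'm::finite) chart set \<Rightarrow> 'p set \<Rightarrow> (('p, 'm) chart \<Rightarrow> 'm \<Rightarrow> 'm lsection) \<Rightarrow> bool" where
  "vector_valued_form \<A> V A \<longleftrightarrow> (\<forall>c\<in>\<A>. \<forall>d\<in>\<A>. \<forall>z\<in>chart_img c (fst d \<inter> V). \<forall>i.
     jac c d z *v A c i z = (\<Sum>k\<in>UNIV. jac c d z $ k $ i *s A d k (transition c d z)))"

definition smooth_endo ::
  "('p, 'm::finite) chart set \<Rightarrow> (('p, 'm) chart \<Rightarrow> complex^'m \<Rightarrow> complex^'m^'m) \<Rightarrow> bool" where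
  "smooth_endo \<A> P \<longleftrightarrow> (\<forall>c\<in>\<A>. smooth_on (chart_img c UNIV) (P c)) \<and>
     (\<forall>c\<in>\<A>. \<forall>d\<in>\<A>. \<forall>z\<in>chart_img c (fst d).
        jac c d z ** P c z = P d (transition c d z) ** jac c d z)"

section \<open>Hermitian metrics and the Chern connection\<close>

text \<open>Complex linear in the first argument, conjugate linear in the second.\<close>

definition herm_inner :: "(complex^'m \<Rightarrow> complex^'m \<Rightarrow> complex) \<Rightarrow> bool" where
  "herm_inner g \<longleftrightarrow> (\<forall>u u' v. g (u + u') v = g u v + g u' v) \<and> (\<forall>a u v. g (a *s u) v = a * g u v) \<and>
     (\<forall>u v. g v u = cnj (g u v)) \<and> (\<forall>u. u \<noteq> 0 \<longrightarrow> Re (g u u) > 0)"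

type_synonym ('p, 'm) metric =
  "('p, 'm) chart \<Rightarrow> complex^'m \<Rightarrow> complex^'m \<Rightarrow> complex^'m \<Rightarrow> complex"

definition hermitian_metric ::
  "('p, 'm::finite) chart set \<Rightarrow> ('p, 'm) metric \<Rightarrow> bool" where
  "hermitian_metric \<A> h \<longleftrightarrow>
     (\<forall>c\<in>\<A>. (\<forall>z\<in>chart_img c UNIV. herm_inner (h c z)) \<and>
              (\<forall>u v. smooth_on (chart_img c UNIV) (\<lambda>z. h c z u v))) \<and>
     (\<forall>c\<in>\<A>. \<forall>d\<in>\<A>. \<forall>z\<in>chart_img c (fst d). \<forall>u v.
        h d (transition c d z) (jac c d z *v u) (jac c d z *v v) = h c z u v)"

definition herm_adj ::
  "(complex^'m \<Rightarrow> complex^'m \<Rightarrow> complex) \<Rightarrow> complex^'m^'m \<Rightarrow> complex^'m^'m" where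
  "herm_adj g P = (THE B. \<forall>u v. g (P *v u) v = g u (B *v v))"

text \<open>\<open>D'\<close> in the direction of the \<open>i\<close>-th coordinate field, given its connection matrices \<open>\<theta>\<close> in the
  coordinate frame of a chart. The coordinate frame is holomorphic, so the \<open>\<partial>\<close>-bar operator of the
  tangent bundle acts there as \<open>wirt_bar_vec\<close>.\<close>

definition Dprime :: "('m::finite \<Rightarrow> complex^'m \<Rightarrow> complex^'m^'m) \<Rightarrow> 'm \<Rightarrow> 'm lsection \<Rightarrow> 'm lsection" where
  "Dprime \<theta> i s = (\<lambda>z. wirt_vec i s z + \<theta> i z *v s z)"

type_synonym ('p, 'm) endo_form = "('p, 'm) chart \<Rightarrow> 'm \<Rightarrow> complex^'m \<Rightarrow> complex^'m^'m"

text \<open>The middle condition says that the local operators glue to a globally defined operator from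
  vector fields to (1,0)-forms with values in the tangent bundle; the last one is compatibility with
  the metric (its (0,1) part is the complex conjugate of the (1,0) part stated here).\<close>

definition chern_connection ::
  "'p::topological_space set \<Rightarrow> ('p, 'm::finite) chart set \<Rightarrow> ('p, 'm) metric \<Rightarrow>
   ('p, 'm) endo_form \<Rightarrow> bool" where
  "chern_connection M \<A> h \<theta> \<longleftrightarrow>
     (\<forall>c\<in>\<A>. \<forall>i. smooth_on (chart_img c UNIV) (\<theta> c i)) \<and>
     (\<forall>V X. open V \<and> V \<subseteq> M \<and> smooth_vector_field \<A> V X \<longrightarrow>
        vector_valued_form \<A> V (\<lambda>c i. Dprime (\<theta> c) i (X c))) \<and>
     (\<forall>c\<in>\<A>. \<forall>i W s t. open W \<and> W \<subseteq> chart_img c UNIV \<and> smooth_on W s \<and> smooth_on W t \<longrightarrow>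
        (\<forall>z\<in>W. wirt i (\<lambda>x. h c x (s x) (t x)) z =
           h c z (Dprime (\<theta> c) i s z) (t z) + h c z (s z) (wirt_bar_vec i t z)))"

section \<open>Integrable harmonic Higgs bundles\<close>

text \<open>Identities between operators on the sheaf of smooth sections over a chart with image \<open>S\<close>.\<close>

definition vanishes_on :: "(complex^'m::finite) set \<Rightarrow> ('m lsection \<Rightarrow> 'm lsection) \<Rightarrow> bool" where
  "vanishes_on S P \<longleftrightarrow> (\<forall>W s. open W \<and> W \<subseteq> S \<and> smooth_on W s \<longrightarrow> (\<forall>z\<in>W. P s z = 0))"

definition comm :: "('m::finite lsection \<Rightarrow> 'm lsection) \<Rightarrow> ('m lsection \<Rightarrow> 'm lsection) \<Rightarrow> 'm lsection \<Rightarrow> 'm lsection" where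
  "comm P R s = (\<lambda>z. P (R s) z - R (P s) z)"

definition act :: "(complex^'m::finite \<Rightarrow> complex^'m^'m) \<Rightarrow> 'm lsection \<Rightarrow> 'm lsection" where
  "act A s = (\<lambda>z. A z *v s z)"

text \<open>Coordinate fields commute, so the curvature of a connection with components \<open>P i\<close> and \<open>R i\<close> in
  the holomorphic and antiholomorphic coordinate directions is given by commutators.\<close>

definition flat_on ::
  "(complex^'m::finite) set \<Rightarrow> ('m \<Rightarrow> 'm lsection \<Rightarrow> 'm lsection) \<Rightarrow> ('m \<Rightarrow> 'm lsection \<Rightarrow> 'm lsection) \<Rightarrow> bool" where
  "flat_on S P R \<longleftrightarrow> (\<forall>i j. vanishes_on S (comm (P i) (P j)) \<and> vanishes_on S (comm (P i) (R j)) \<and>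
     vanishes_on S (comm (R i) (R j)))"

text \<open>Multiplication by \<open>mat a\<close> is scalar multiplication of a complex matrix by \<open>a\<close>. The last
  condition is \<open>\<Phi> \<and> \<Phi> = 0\<close>.\<close>

definition higgs_field :: "('p, 'm::finite) chart set \<Rightarrow> ('p, 'm) endo_form \<Rightarrow> bool" where
  "higgs_field \<A> \<Phi> \<longleftrightarrow>
     (\<forall>c\<in>\<A>. \<forall>i. holo_mat (chart_img c UNIV) (\<Phi> c i)) \<and>
     (\<forall>c\<in>\<A>. \<forall>d\<in>\<A>. \<forall>z\<in>chart_img c (fst d). \<forall>i.
        jac c d z ** \<Phi> c i z =
        (\<Sum>k\<in>UNIV. mat (jac c d z $ k $ i) ** (\<Phi> d k (transition c d z) ** jac c d z))) \<and>
     (\<forall>c\<in>\<A>. \<forall>z\<in>chart_img c UNIV. \<forall>i j. \<Phi> c i z ** \<Phi> c j z = \<Phi> c j z ** \<Phi> c i z)"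

definition harmonic_higgs_bundle ::
  "'p::topological_space set \<Rightarrow> ('p, 'm::finite) chart set \<Rightarrow> ('p, 'm) metric \<Rightarrow>
   ('p, 'm) endo_form \<Rightarrow> ('p, 'm) endo_form \<Rightarrow> bool" where
  "harmonic_higgs_bundle M \<A> h \<theta> \<Phi> \<longleftrightarrow>
     hermitian_metric \<A> h \<and> chern_connection M \<A> h \<theta> \<and> higgs_field \<A> \<Phi> \<and>
     (\<forall>c\<in>\<A>. flat_on (chart_img c UNIV)
        (\<lambda>i s z. Dprime (\<theta> c) i s z + \<Phi> c i z *v s z)
        (\<lambda>i s z. wirt_bar_vec i s z + herm_adj (h c z) (\<Phi> c i z) *v s z))"

definition integrable_harmonic_higgs_bundle ::
  "'p::topological_space set \<Rightarrow> ('p, 'm::finite) chart set \<Rightarrow> ('p, 'm) metric \<Rightarrow>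
   ('p, 'm) endo_form \<Rightarrow> ('p, 'm) endo_form \<Rightarrow>
   (('p, 'm) chart \<Rightarrow> complex^'m \<Rightarrow> complex^'m^'m) \<Rightarrow>
   (('p, 'm) chart \<Rightarrow> complex^'m \<Rightarrow> complex^'m^'m) \<Rightarrow> bool" where
  "integrable_harmonic_higgs_bundle M \<A> h \<theta> \<Phi> U Q \<longleftrightarrow>
     harmonic_higgs_bundle M \<A> h \<theta> \<Phi> \<and> smooth_endo \<A> U \<and> smooth_endo \<A> Q \<and>
     (\<forall>c\<in>\<A>. \<forall>i. vanishes_on (chart_img c UNIV) (comm (wirt_bar_vec i) (act (U c)))) \<and>
     (\<forall>c\<in>\<A>. \<forall>z\<in>chart_img c UNIV. herm_adj (h c z) (Q c z) = Q c z) \<and>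
     (\<forall>c\<in>\<A>. \<forall>z\<in>chart_img c UNIV. \<forall>i. \<Phi> c i z ** U c z - U c z ** \<Phi> c i z = 0) \<and>
     (\<forall>c\<in>\<A>. \<forall>i. vanishes_on (chart_img c UNIV) (\<lambda>s z.
        comm (Dprime (\<theta> c) i) (act (U c)) s z
        - (\<Phi> c i z ** Q c z - Q c z ** \<Phi> c i z) *v s z + \<Phi> c i z *v s z)) \<and>
     (\<forall>c\<in>\<A>. \<forall>i. vanishes_on (chart_img c UNIV) (\<lambda>s z.
        comm (Dprime (\<theta> c) i) (act (Q c)) s z
        + (\<Phi> c i z ** herm_adj (h c z) (U c z) - herm_adj (h c z) (U c z) ** \<Phi> c i z) *v s z))"

definition Dprime_parallel ::
  "('p, 'm::finite) chart set \<Rightarrow> ('p, 'm) endo_form \<Rightarrow>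
   (('p, 'm) chart \<Rightarrow> complex^'m \<Rightarrow> complex^'m^'m) \<Rightarrow> bool" where
  "Dprime_parallel \<A> \<theta> P \<longleftrightarrow>
     (\<forall>c\<in>\<A>. \<forall>i. vanishes_on (chart_img c UNIV) (comm (Dprime (\<theta> c) i) (act (P c))))"

text \<open>The (1,1)-form \<open>D'\<partial>bar + \<partial>bar D'\<close> has the commutators of the component operators as its
  coefficients, since \<open>dz\<^sub>i\<close> and the conjugate of \<open>dz\<^sub>j\<close> anticommute.\<close>

definition Dprime_holomorphic :: "('p, 'm::finite) chart set \<Rightarrow> ('p, 'm) endo_form \<Rightarrow> bool" where
  "Dprime_holomorphic \<A> \<theta> \<longleftrightarrow>
     (\<forall>c\<in>\<A>. \<forall>i j. vanishes_on (chart_img c UNIV) (comm (Dprime (\<theta> c) i) (wirt_bar_vec j)))"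

definition higgs_product ::
  "('p, 'm::finite) endo_form \<Rightarrow> (('p, 'm) chart \<Rightarrow> 'm lsection) \<Rightarrow> (('p, 'm) chart \<Rightarrow> 'm lsection) \<Rightarrow>
   ('p, 'm) chart \<Rightarrow> 'm lsection" where
  "higgs_product \<Phi> X Y c z = - (\<Sum>i\<in>UNIV. X c z $ i *s (\<Phi> c i z *v Y c z))"

section \<open>Frames and the structure connection\<close>

definition diag_mat :: "('m \<Rightarrow> complex) \<Rightarrow> complex^'m^'m" where
  "diag_mat l = (\<chi> i j. if i = j then l i else 0)"

type_synonym ('p, 'm) frame = "'m \<Rightarrow> ('p, 'm) chart \<Rightarrow> 'm lsection"

definition frame_comb ::
  "('p, 'm::finite) frame \<Rightarrow> ('p, 'm) chart \<Rightarrow> complex^'m \<Rightarrow> complex^'m \<Rightarrow> complex^'m" where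
  "frame_comb e c z f = (\<Sum>k\<in>UNIV. f $ k *s e k c z)"

definition holo_frame :: "('p, 'm::finite) chart set \<Rightarrow> 'p set \<Rightarrow> ('p, 'm) frame \<Rightarrow> bool" where
  "holo_frame \<A> V e \<longleftrightarrow> (\<forall>k. holo_vector_field \<A> V (e k)) \<and>
     (\<forall>c\<in>\<A>. \<forall>z\<in>chart_img c V. bij (frame_comb e c z))"

definition Dprime_flat_frame ::
  "('p, 'm::finite) chart set \<Rightarrow> ('p, 'm) endo_form \<Rightarrow> 'p set \<Rightarrow> ('p, 'm) frame \<Rightarrow> bool" where
  "Dprime_flat_frame \<A> \<theta> V e \<longleftrightarrow>
     (\<forall>k. \<forall>c\<in>\<A>. \<forall>z\<in>chart_img c V. \<forall>i. Dprime (\<theta> c) i (e k c) z = 0)"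

definition endo_matrix_in_frame ::
  "('p, 'm::finite) chart set \<Rightarrow> 'p set \<Rightarrow> ('p, 'm) frame \<Rightarrow>
   (('p, 'm) chart \<Rightarrow> complex^'m \<Rightarrow> complex^'m^'m) \<Rightarrow> complex^'m^'m \<Rightarrow> bool" where
  "endo_matrix_in_frame \<A> V e P \<Lambda> \<longleftrightarrow>
     (\<forall>c\<in>\<A>. \<forall>z\<in>chart_img c V. \<forall>l. P c z *v e l c z = (\<Sum>k\<in>UNIV. \<Lambda> $ k $ l *s e k c z))"

text \<open>Sections of the pull-back of the tangent bundle to \<open>\<complex>\<^sup>* \<times> M\<close> are, in a chart, functions of
  \<open>(\<zeta>, z)\<close> with \<open>\<zeta>\<close> the coordinate on \<open>\<complex>\<^sup>*\<close>. A form-valued result is the pair of its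
  \<open>d\<zeta>\<close>-coefficient and its coefficients in the coordinate directions of \<open>M\<close>.\<close>

type_synonym 'm pb_lsection = "complex \<times> (complex^'m) \<Rightarrow> complex^'m"

type_synonym 'm pb_form = "(complex^'m) \<times> ('m \<Rightarrow> complex^'m)"

definition pb_Dprime ::
  "('m::finite \<Rightarrow> complex^'m \<Rightarrow> complex^'m^'m) \<Rightarrow> 'm pb_lsection \<Rightarrow>
   complex \<Rightarrow> complex^'m \<Rightarrow> 'm pb_form" where
  "pb_Dprime \<theta> \<sigma> \<zeta> z =
     (wirt_z_vec (\<lambda>x. \<sigma> (x, z)) \<zeta>, \<lambda>i. Dprime \<theta> i (\<lambda>y. \<sigma> (\<zeta>, y)) z)"

definition structure_connection ::
  "int \<Rightarrow> ('p, 'm::finite) metric \<Rightarrow> ('p, 'm) endo_form \<Rightarrow> ('p, 'm) endo_form \<Rightarrow>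
   (('p, 'm) chart \<Rightarrow> complex^'m \<Rightarrow> complex^'m^'m) \<Rightarrow>
   (('p, 'm) chart \<Rightarrow> complex^'m \<Rightarrow> complex^'m^'m) \<Rightarrow>
   ('p, 'm) chart \<Rightarrow> 'm pb_lsection \<Rightarrow> complex \<Rightarrow> complex^'m \<Rightarrow> 'm pb_form" where
  "structure_connection w h \<theta> \<Phi> U Q c \<sigma> \<zeta> z =
     (let u = \<sigma> (\<zeta>, z) in
      (fst (pb_Dprime (\<theta> c) \<sigma> \<zeta> z) +
         (1 / \<zeta>) *s ((1 / \<zeta>) *s (U c z *v u) - Q c z *v u
           - \<zeta> *s (herm_adj (h c z) (U c z) *v u) + (of_int w / 2) *s u),
       \<lambda>i. snd (pb_Dprime (\<theta> c) \<sigma> \<zeta> z) i + (1 / \<zeta>) *s (\<Phi> c i z *v u)))"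

text \<open>The structure connection equals \<open>D' + B d\<zeta> / \<zeta>\<close> over \<open>V\<close>, where the constant matrix \<open>B\<close> acts on
  the coefficients of sections with respect to the frame \<open>e\<close>.\<close>

definition structure_connection_in_frame ::
  "('p::topological_space, 'm::finite) chart set \<Rightarrow> 'p set \<Rightarrow> int \<Rightarrow> ('p, 'm) metric \<Rightarrow>
   ('p, 'm) endo_form \<Rightarrow> ('p, 'm) endo_form \<Rightarrow>
   (('p, 'm) chart \<Rightarrow> complex^'m \<Rightarrow> complex^'m^'m) \<Rightarrow>
   (('p, 'm) chart \<Rightarrow> complex^'m \<Rightarrow> complex^'m^'m) \<Rightarrow>
   ('p, 'm) frame \<Rightarrow> complex^'m^'m \<Rightarrow> bool" where
  "structure_connection_in_frame \<A> V w h \<theta> \<Phi> U Q e B \<longleftrightarrow>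
     (\<forall>c\<in>\<A>. \<forall>W f. open W \<and> W \<subseteq> (UNIV - {0}) \<times> chart_img c V \<and> smooth_on W f \<longrightarrow>
       (let \<sigma> = (\<lambda>(\<zeta>, z). frame_comb e c z (f (\<zeta>, z))) in
        \<forall>(\<zeta>, z)\<in>W. structure_connection w h \<theta> \<Phi> U Q c \<sigma> \<zeta> z =
          (fst (pb_Dprime (\<theta> c) \<sigma> \<zeta> z) + (1 / \<zeta>) *s frame_comb e c z (B *v f (\<zeta>, z)),
           snd (pb_Dprime (\<theta> c) \<sigma> \<zeta> z))))"

end

theory Submission
  imports Defs "HOL-Complex_Analysis.Cauchy_Integral_Formula"
begin

text \<open>
  Holomorphy of \<open>D'\<close> turns the mixed part of the harmonic flatness condition into
  \<open>[\<Phi>\<^sub>i, \<Phi>\<^sub>j\<^sup>\<dagger>] = 0\<close>, and \<open>D'(\<U>) = 0\<close> leaves \<open>[\<Phi>\<^sub>i, \<Q>] = \<Phi>\<^sub>i\<close>. Hence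
  \<open>tr (\<Phi>\<^sub>i \<Phi>\<^sub>i\<^sup>\<dagger>) = tr ([\<Phi>\<^sub>i, \<Q>] \<Phi>\<^sub>i\<^sup>\<dagger>) = tr (\<Q> [\<Phi>\<^sub>i\<^sup>\<dagger>, \<Phi>\<^sub>i]) = 0\<close>, so \<open>\<Phi> = 0\<close>.
  Now \<open>D' + \<partial>bar\<close> is flat, and an \<open>h\<close>-orthonormal eigenbasis of the self-adjoint \<open>\<Q>\<close> at a point
  extends to a \<open>D'\<close>-flat holomorphic frame \<open>e\<close>. The functions \<open>h(e\<^sub>k, e\<^sub>m)\<close> and \<open>h(\<Q> e\<^sub>k, e\<^sub>m)\<close> are
  killed by all \<open>\<partial>\<^sub>i\<close>, and by Hermitian symmetry so are their conjugates; hence they are constant.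
  This keeps the frame orthonormal and \<open>\<Q>\<close> diagonal without any appeal to uniqueness of solutions.
\<close>

section \<open>Linear algebra of one Hermitian inner product: spectral theorem, adjoints, trace
  form\<close>

section \<open>Hermitian inner products\<close>

text \<open>The mixed curvature identity contains, besides the commutator of \<Phi> with
  \<Phi>\<dagger>, the derivatives \<partial>bar \<Phi> and D'(\<Phi>\<dagger>). The first vanishes
  because \<Phi> is holomorphic. The second is its adjoint, but that argument needs \<Phi>\<dagger>
  to be differentiable and the metric compatibility of D' for sections that are not known to be
  smooth.

  The flat frame solves the real linear system de = - (sum of dz_i \<theta>_i e). Its coefficient is
  complex linear in the direction, so a solution satisfies D'e = 0 and \<partial>bar e = 0 at once.
  Its integrability is the vanishing of both curvature parts: the (1,1) part is assumed to vanish,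
  the (2,0) part vanishes by harmonicity once \<Phi> = 0.

  The frame is built in one chart, whereas its properties are demanded in every chart of the atlas.
  Flatness can only be transported by the gluing condition on D', which speaks of smooth vector
  fields. This is why complex differentiability in several variables is upgraded to smoothness by
  Cauchy's formula.\<close>

lemma mult_axis: "A *v axis k 1 = column k A" for A :: "'a::comm_semiring_1^'n^'m"
  by (simp add: matrix_vector_mult_def column_def axis_def vec_eq_iff if_distrib cong: if_cong)

lemma matrix_diff_rdistrib: "(A - B) ** C = A ** C - B ** C" for A B :: "'a::comm_ring_1^'n^'m"
  by (simp add: matrix_matrix_mult_def vec_eq_iff left_diff_distrib sum_subtractf)

context
  fixes g :: "complex^'m::finite \<Rightarrow> complex^'m \<Rightarrow> complex"
  assumes g: "herm_inner g"
begin

lemma herm_add_left: "g (u + u') v = g u v + g u' v"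
  and herm_scale_left: "g (a *s u) v = a * g u v"
  and herm_sym: "g v u = cnj (g u v)"
  and herm_pos: "u \<noteq> 0 \<Longrightarrow> Re (g u u) > 0"
  using g unfolding herm_inner_def by blast+

lemma herm_add_right: "g u (v + v') = g u v + g u v'"
proof -
  have "g u (v + v') = cnj (g v u + g v' u)" by (metis herm_sym herm_add_left)
  then show ?thesis by (metis herm_sym complex_cnj_add)
qed

lemma herm_scale_right: "g u (a *s v) = cnj a * g u v"
proof -
  have "g u (a *s v) = cnj (a * g v u)" by (metis herm_sym herm_scale_left)
  then show ?thesis by (metis herm_sym complex_cnj_mult)
qed

lemma herm_zero_left: "g 0 v = 0"
  using herm_scale_left[of 0 0 v] by simp

lemma herm_zero_right: "g u 0 = 0"
  using herm_scale_right[of u 0 0] by simp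

lemma herm_diff_left: "g (u - u') v = g u v - g u' v"
  using herm_add_left[of "u - u'" u' v] by simp

lemma herm_diff_right: "g u (v - v') = g u v - g u v'"
  using herm_add_right[of u "v - v'" v'] by simp

lemma herm_sum_left: "g (sum f A) v = (\<Sum>i\<in>A. g (f i) v)"
  by (induction A rule: infinite_finite_induct) (auto simp: herm_zero_left herm_add_left)

lemma herm_sum_right: "g u (sum f A) = (\<Sum>i\<in>A. g u (f i))"
  by (induction A rule: infinite_finite_induct) (auto simp: herm_zero_right herm_add_right)

lemma herm_eq_0: "g u u = 0 \<longleftrightarrow> u = 0"
  by (metis herm_pos herm_zero_left less_irrefl zero_complex.simps(1))

text \<open>\<open>herm_inner\<close> is purely algebraic, so regularity of
  \<open>g (f x) (h x)\<close> has to be read off from finitely many Gram entries: continuity in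
  \<open>continuous_on_herm\<close>, differentiability in \<open>g_section\<close>.\<close>

lemma herm_expand: "g u v = (\<Sum>k\<in>UNIV. \<Sum>l\<in>UNIV. u $ k * cnj (v $ l) * g (axis k 1) (axis l 1))"
proof -
  have "g u v = g (\<Sum>k\<in>UNIV. u $ k *s axis k 1) (\<Sum>l\<in>UNIV. v $ l *s axis l 1)"
    by (simp only: basis_expansion)
  also have "\<dots> = (\<Sum>k\<in>UNIV. \<Sum>l\<in>UNIV. u $ k * cnj (v $ l) * g (axis k 1) (axis l 1))"
    unfolding herm_sum_left herm_scale_left unfolding herm_sum_right herm_scale_right
    by (simp add: sum_distrib_left mult.assoc)
  finally show ?thesis .
qed

lemma herm_ext: "(\<And>v. g u v = g u' v) \<Longrightarrow> u = u'"
  using herm_eq_0[of "u - u'"] herm_diff_left[of u u' "u - u'"] by simp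

lemma continuous_on_herm:
  "continuous_on S f \<Longrightarrow> continuous_on S h \<Longrightarrow> continuous_on S (\<lambda>x. g (f x) (h x))"
  by (subst herm_expand) (intro continuous_intros)

text \<open>A maximizer \<open>u\<close> of the Rayleigh quotient on \<open>W\<close> is an
  eigenvector. With \<open>l\<close> the maximum, the quadratic form \<open>N\<close> is nonnegative
  on \<open>W\<close> and vanishes at \<open>u\<close>; moving from \<open>u\<close> along the
  residual \<open>r = l u - P u\<close> would make it negative unless \<open>r = 0\<close>.
  Invariance of \<open>W\<close> under \<open>P\<close> keeps this variation inside
  \<open>W\<close>.\<close>

lemma herm_rayleigh:
  fixes P :: "complex^'m^'m"
  assumes P: "\<And>u v. g (P *v u) v = g u (P *v v)"
    and W: "closed W" "\<And>u v. u \<in> W \<Longrightarrow> v \<in> W \<Longrightarrow> u + v \<in> W" "\<And>a u. u \<in> W \<Longrightarrow> a *s u \<in> W"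
      "\<And>u. u \<in> W \<Longrightarrow> P *v u \<in> W" "w \<in> W" "w \<noteq> 0"
  shows "\<exists>u l. u \<in> W \<and> u \<noteq> 0 \<and> P *v u = of_real l *s u"
proof -
  define q where "q u = Re (g (P *v u) u) / Re (g u u)" for u
  \<comment> \<open>The Euclidean sphere supplies compactness, although \<open>g\<close> is a
    different inner product; \<open>q\<close> is invariant under scaling, so a maximum there is a
    maximum on all nonzero vectors of \<open>W\<close>.\<close>
  have normalize: "of_real (1 / norm v) *s v \<in> sphere 0 1 \<inter> W" if "v \<in> W" "v \<noteq> 0" for v
  proof -
    have "of_real (1 / norm v) *s v = (1 / norm v) *\<^sub>R v"
      unfolding vec_eq_iff by (intro allI) (simp add: scaleR_conv_of_real[where 'a=complex])
    then show ?thesis using that W(3)[OF that(1), of "of_real (1 / norm v)"] by simp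
  qed
  have cP: "continuous_on T (\<lambda>u. P *v u)" for T
    unfolding matrix_vector_mult_def by (intro continuous_intros)
  have "continuous_on (sphere 0 1 \<inter> W) q"
    unfolding q_def
    by (intro continuous_intros continuous_on_herm cP ballI)
      (metis Int_iff herm_pos less_irrefl norm_zero sphere_empty mem_sphere_0 zero_neq_one)
  moreover have "compact (sphere (0::complex^'m) 1 \<inter> W)" using W(1) by (simp add: compact_Int_closed)
  moreover have "sphere 0 1 \<inter> W \<noteq> {}" using normalize[OF W(5,6)] by blast
  ultimately obtain u where u: "u \<in> sphere 0 1 \<inter> W" "\<And>v. v \<in> sphere 0 1 \<inter> W \<Longrightarrow> q v \<le> q u"
    using continuous_attains_sup by meson
  define l where "l = q u"
  define N where "N v = l * Re (g v v) - Re (g (P *v v) v)" for v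
  have u0: "u \<noteq> 0" "u \<in> W" using u(1) by auto
  have Nu: "N u = 0" using herm_pos[OF u0(1)] by (simp add: N_def l_def q_def)
  have N: "N v \<ge> 0" if "v \<in> W" for v
  proof (cases "v = 0")
    case True
    then show ?thesis by (simp add: N_def herm_zero_left)
  next
    case False
    have "q (of_real (1 / norm v) *s v) = q v"
      using False by (simp add: q_def herm_scale_left herm_scale_right 
          vector_scalar_commute field_simps)
    then have "q v \<le> l" using u(2)[OF normalize[OF that False]] by (simp add: l_def)
    then show ?thesis using herm_pos[OF False] by (simp add: N_def q_def divide_le_eq)
  qed
  define r where "r = of_real l *s u - P *v u"
  have "r = of_real l *s u + (-1) *s (P *v u)" by (simp add: r_def vec_eq_iff)
  then have rW: "r \<in> W" using u0 W by metis
  have quad: "N (u - of_real t *s r) = - 2 * t * Re (g r r) + t\<^sup>2 * N r" for t :: real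
  proof -
    have sym: "Re (g r u) = Re (g u r)" "Re (g (P *v r) u) = Re (g (P *v u) r)"
      by (simp_all add: herm_sym[of u r] P[of r u] herm_sym[of "P *v u" r])
    have "N (u - of_real t *s r) = N u - 2 * t * (l * Re (g u r) - Re (g (P *v u) r)) + t\<^sup>2 * N r"
      unfolding N_def
      by (simp add: herm_diff_left herm_diff_right herm_scale_left herm_scale_right matrix_vector_mult_diff_distrib
          vector_scalar_commute sym algebra_simps power2_eq_square)
    moreover have "l * Re (g u r) - Re (g (P *v u) r) = Re (g r r)"
      using arg_cong[OF r_def, of "\<lambda>x. Re (g x r)"] by (simp add: herm_diff_left herm_scale_left)
    ultimately show ?thesis using Nu by simp
  qed
  define x where "x = Re (g r r)"
  have "u - of_real t *s r \<in> W" for t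
  proof -
    have "u - of_real t *s r = u + (- of_real t) *s r" by (simp add: vec_eq_iff)
    then show ?thesis using u0 rW W by metis
  qed
  \<comment> \<open>The parameter is \<open>t = x / (N r + 1)\<close>, close to the minimizer
    \<open>x / N r\<close> of the parabola in \<open>quad\<close>; the added 1 keeps the denominator
    positive when \<open>N r = 0\<close>.\<close>
  then have "0 \<le> - 2 * (x / (N r + 1)) * x + (x / (N r + 1))\<^sup>2 * N r"
    using N quad unfolding x_def by metis
  also have "\<dots> = - (x\<^sup>2 * (N r + 2)) / (N r + 1)\<^sup>2"
  proof -
    define c where "c = N r + 1"
    have "c \<noteq> 0" and Nc: "N r = c - 1" using N[OF rW] by (auto simp: c_def)
    then show ?thesis unfolding Nc by (simp add: divide_simps) (simp add: power2_eq_square algebra_simps)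
  qed
  finally have "x\<^sup>2 * (N r + 2) / (N r + 1)\<^sup>2 \<le> 0" by simp
  then have "x = 0"
    using N[OF rW] by (simp add: divide_le_0_iff mult_le_0_iff)
  then have "r = 0" using herm_pos[of r] by (auto simp: x_def)
  then show ?thesis using u0 unfolding r_def by (metis eq_iff_diff_eq_0)
qed

text \<open>\<open>E\<close> synthesizes a vector from its coefficients and \<open>F\<close>
  computes the coefficients \<open>g u (e k)\<close>. Orthonormality is just
  \<open>F ** E = mat 1\<close>; both matrices are square, so an orthonormal family indexed by the
  whole type is automatically a basis.\<close>

lemma herm_orthonormal_matrix:
  fixes e :: "'m \<Rightarrow> complex^'m"
  assumes ee: "\<And>k l. g (e k) (e l) = (if k = l then 1 else 0)"
  defines "E \<equiv> (\<chi> i k. e k $ i)" and "F \<equiv> (\<chi> k i. g (axis i 1) (e k))"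
  shows "E ** F = mat 1" "F ** E = mat 1" "E *v axis k 1 = e k" "(F *v u) $ k = g u (e k)"
    "E *v x = (\<Sum>k\<in>UNIV. x $ k *s e k)"
proof -
  show Fv: "(F *v u) $ k = g u (e k)" for u k
  proof -
    have "g u (e k) = g (\<Sum>i\<in>UNIV. u $ i *s axis i 1) (e k)" by (simp only: basis_expansion)
    also have "\<dots> = (F *v u) $ k"
      unfolding herm_sum_left herm_scale_left by (simp add: F_def matrix_vector_mult_def mult.commute)
    finally show ?thesis by simp
  qed
  show colE: "E *v axis k 1 = e k" for k
    by (simp add: E_def mult_axis column_def)
  show FE: "F ** E = mat 1"
  proof -
    have "(F ** E) *v axis k 1 = mat 1 *v axis k 1" for k
      by (simp add: matrix_vector_mul_assoc[symmetric] colE) (simp add: vec_eq_iff Fv ee axis_def)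
    then show ?thesis
      by (simp add: vec_eq_iff mult_axis column_def)
  qed
  then show "E ** F = mat 1" using matrix_left_right_inverse by blast
  show "E *v x = (\<Sum>k\<in>UNIV. x $ k *s e k)" for x
    by (simp add: E_def matrix_vector_mult_def vec_eq_iff mult.commute)
qed

text \<open>An orthonormal set of eigenvectors of maximal size must span: its orthogonal complement
  is invariant under the self-adjoint \<open>P\<close>, so a nonzero vector there would yield one
  more eigenvector by \<open>herm_rayleigh\<close>. The columns of \<open>E\<close> are this basis,
  and \<open>F\<close> is an isometry onto the standard Hermitian space.\<close>

lemma herm_spectral:
  fixes P :: "complex^'m^'m"
  assumes P: "\<And>u v. g (P *v u) v = g u (P *v v)"
  obtains E F :: "complex^'m^'m" and l where "E ** F = mat 1" "F ** E = mat 1"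
    "\<And>u v. g u v = (\<Sum>k\<in>UNIV. (F *v u) $ k * cnj ((F *v v) $ k))" "P ** E = E ** diag_mat l"
proof -
  define ON where "ON S \<longleftrightarrow> finite S \<and> (\<forall>s\<in>S. \<forall>t\<in>S. g s t = (if s = t then 1 else 0)) \<and>
     (\<forall>s\<in>S. \<exists>l::real. P *v s = of_real l *s s)" for S
  have indep: "vec.independent S" if "ON S" for S
    unfolding vec.independent_explicit_module
  proof (intro allI impI)
    fix T c v assume T: "finite T" "T \<subseteq> S" "(\<Sum>v\<in>T. c v *s v) = 0" "v \<in> T"
    have "0 = g (\<Sum>v\<in>T. c v *s v) v" by (simp add: T herm_zero_left)
    also have "\<dots> = (\<Sum>u\<in>T. if u = v then c u else 0)"
      unfolding herm_sum_left herm_scale_left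
      using that T by (intro sum.cong) (auto simp: ON_def subset_iff)
    also have "\<dots> = c v" using T by simp
    finally show "c v = 0" by simp
  qed
  have card: "card S \<le> CARD('m)" if "ON S" for S
    using vec.independent_card_le_dim[OF subset_UNIV indep[OF that]] by (simp only: vec_dim_card)
  have "ON {}" by (simp add: ON_def)
  then obtain S where S: "ON S" "\<And>T. ON T \<Longrightarrow> card T \<le> card S"
    using ex_has_greatest_nat[of ON "{}" card "Suc CARD('m)"] card by (metis le_imp_less_Suc)
  have fS: "finite S" using S by (simp add: ON_def)
  define W where "W = {u. \<forall>s\<in>S. g u s = 0}"
  have W0: "w = 0" if w: "w \<in> W" for w
  proof (rule ccontr)
    assume w0: "w \<noteq> 0"
    have "closed (\<Inter>s\<in>S. {u. g u s = 0})"
      by (intro closed_INT ballI closed_Collect_eq continuous_on_herm continuous_intros)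
    moreover have "(\<Inter>s\<in>S. {u. g u s = 0}) = W" by (auto simp: W_def)
    ultimately have cW: "closed W" by simp
    have PW: "P *v u \<in> W" if "u \<in> W" for u
      unfolding W_def
    proof (intro CollectI ballI)
      fix s assume s: "s \<in> S"
      then obtain l :: real where "P *v s = of_real l *s s" using S(1) unfolding ON_def by metis
      then show "g (P *v u) s = 0" using that s by (simp add: P herm_scale_right W_def)
    qed
    obtain u l where u: "u \<in> W" "u \<noteq> 0" "P *v u = of_real l *s u"
      using herm_rayleigh[OF P cW _ _ PW w w0] by (auto simp: W_def herm_add_left herm_scale_left)
    define G where "G = Re (g u u)"
    have G: "g u u = of_real G" "G > 0"
      using herm_sym[of u u] herm_pos[OF u(2)] by (simp_all add: G_def complex_eq_iff)
    define a where "a = of_real (1 / sqrt G) *s u"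
    have "g a a = of_real (1 / sqrt G * (1 / sqrt G) * G)"
      by (simp only: a_def herm_scale_left herm_scale_right G complex_cnj_complex_of_real of_real_mult mult.assoc)
    also have "1 / sqrt G * (1 / sqrt G) * G = 1" using G(2) by (simp add: field_simps)
    finally have aa: "g a a = 1" by simp
    have aS: "g a s = 0" "g s a = 0" if "s \<in> S" for s
      using u(1) that herm_sym[of s a] by (auto simp: a_def W_def herm_scale_left)
    have "P *v a = of_real l *s a" by (simp add: a_def vector_scalar_commute u(3) mult.commute)
    then have "ON (insert a S)"
      using S(1) aa aS unfolding ON_def by auto
    moreover have "a \<notin> S" using aS aa by force
    ultimately show False using S(2)[of "insert a S"] fS by simp
  qed
  have span: "u \<in> vec.span S" for u
  proof -
    have "u - (\<Sum>s\<in>S. g u s *s s) \<in> W"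
    proof -
      have "g (\<Sum>s\<in>S. g u s *s s) t = g u t" if t: "t \<in> S" for t
      proof -
        have "g (\<Sum>s\<in>S. g u s *s s) t = (\<Sum>s\<in>S. if s = t then g u s else 0)"
          unfolding herm_sum_left herm_scale_left using S(1) t by (intro sum.cong) (auto simp: ON_def)
        then show ?thesis using fS t by simp
      qed
      then show ?thesis by (simp add: W_def herm_diff_left)
    qed
    then have "u = (\<Sum>s\<in>S. g u s *s s)" using W0 by (metis eq_iff_diff_eq_0)
    then show ?thesis by (metis (no_types, lifting) vec.span_base vec.span_scale vec.span_sum)
  qed
  have "card S = CARD('m)"
  proof -
    have "vec.span S = vec.span UNIV" using span by auto
    from vec.dim_eq_card[OF this indep[OF S(1)]] show ?thesis by (simp only: vec_dim_card)
  qed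
  then obtain e where e: "bij_betw e (UNIV::'m set) S"
    using finite_same_card_bij[OF _ fS, of "UNIV :: 'm set"] by auto
  have eS: "e k \<in> S" for k using e by (auto simp: bij_betw_def)
  have ee: "g (e k) (e l) = (if k = l then 1 else 0)" for k l
    using S(1) eS[of k] eS[of l] e by (auto simp: ON_def bij_betw_def inj_on_def)
  have "\<forall>k. \<exists>l. P *v e k = l *s e k"
    using S(1) eS unfolding ON_def by blast
  then obtain l where l: "\<And>k. P *v e k = l k *s e k" by metis
  define E F :: "complex^'m^'m" where "E = (\<chi> i k. e k $ i)" and "F = (\<chi> k i. g (axis i 1) (e k))"
  note ON = herm_orthonormal_matrix[of e, OF ee, folded E_def F_def]
  note EF = ON(1) and FE = ON(2) and colE = ON(3) and Fv = ON(4) and Ex = ON(5)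
  have "g u v = (\<Sum>k\<in>UNIV. (F *v u) $ k * cnj ((F *v v) $ k))" for u v
  proof -
    have "u = E *v (F *v u)" by (simp add: matrix_vector_mul_assoc EF)
    then have "g u v = g (\<Sum>k\<in>UNIV. (F *v u) $ k *s e k) v" by (simp only: flip: Ex)
    also have "\<dots> = (\<Sum>k\<in>UNIV. (F *v u) $ k * g (e k) v)"
      unfolding herm_sum_left herm_scale_left ..
    also have "\<dots> = (\<Sum>k\<in>UNIV. (F *v u) $ k * cnj ((F *v v) $ k))"
      unfolding Fv[of v] using herm_sym by (metis (no_types, lifting))
    finally show ?thesis .
  qed
  moreover have "P ** E = E ** diag_mat l"
  proof -
    have "(P ** E) *v axis k 1 = (E ** diag_mat l) *v axis k 1" for k
    proof -
      have "diag_mat l *v axis k 1 = l k *s axis k 1"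
        unfolding mult_axis by (simp add: diag_mat_def column_def vec_eq_iff axis_def)
      then show ?thesis
        by (simp add: matrix_vector_mul_assoc[symmetric] colE l vector_scalar_commute)
    qed
    then show ?thesis by (simp add: vec_eq_iff mult_axis column_def)
  qed
  ultimately show thesis by (rule that[OF EF FE])
qed

lemma herm_adj_unique:
  assumes "\<And>u v. g (P *v u) v = g u (B *v v)"
  shows "herm_adj g P = B"
  unfolding herm_adj_def
proof (rule the_equality)
  fix B' assume B': "\<forall>u v. g (P *v u) v = g u (B' *v v)"
  have "g (B' *v v) u = g (B *v v) u" for u v
    using assms[of u v] B' herm_sym[of "B' *v v" u] herm_sym[of "B *v v" u] by simp
  then show "B' = B" by (metis herm_ext matrix_eq)
qed (use assms in blast)

lemma herm_adj_0: "herm_adj g 0 = 0"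
  by (rule herm_adj_unique) (simp add: herm_zero_left herm_zero_right)

text \<open>In orthonormal coordinates the adjoint is the conjugate transpose, which settles
  existence, and \<open>trace (P ** herm_adj g P)\<close> becomes the sum of the squared moduli of
  all entries. This is where positive definiteness of the metric forces
  \<open>P = 0\<close>.\<close>

lemma herm_adj_and_trace:
  fixes P :: "complex^'m^'m"
  shows herm_adj: "g (P *v u) v = g u (herm_adj g P *v v)"
    and trace_herm_adj_eq_0: "trace (P ** herm_adj g P) = 0 \<Longrightarrow> P = 0"
proof -
  \<comment> \<open>The spectral theorem for the zero matrix is used merely as a source of an
    orthonormal basis.\<close>
  obtain E F :: "complex^'m^'m" where EF: "E ** F = mat 1" "F ** E = mat 1"
    and gF: "\<And>u v. g u v = (\<Sum>k\<in>UNIV. (F *v u) $ k * cnj ((F *v v) $ k))"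
    by (rule herm_spectral[of "0 :: complex^'m^'m"]) (simp add: herm_zero_left herm_zero_right, blast)
  define R where "R = F ** P ** E"
  define R' :: "complex^'m^'m" where "R' = (\<chi> i j. cnj (R $ j $ i))"
  have FE: "F *v (E *v x) = x" "E *v (F *v x) = x" for x
    by (simp_all add: matrix_vector_mul_assoc EF)
  have "g (P *v u) v = g u ((E ** R' ** F) *v v)" for u v
  proof -
    have "g (P *v u) v = (\<Sum>k\<in>UNIV. (R *v (F *v u)) $ k * cnj ((F *v v) $ k))"
      by (simp add: gF R_def matrix_vector_mul_assoc[symmetric] FE)
    also have "\<dots> = (\<Sum>k\<in>UNIV. (F *v u) $ k * cnj ((R' *v (F *v v)) $ k))"
      unfolding matrix_vector_mult_def[of R] matrix_vector_mult_def[of R']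
      by (simp add: R'_def sum_distrib_left sum_distrib_right)
        (subst sum.swap, simp add: mult_ac)
    also have "\<dots> = g u ((E ** R' ** F) *v v)"
      by (simp add: gF matrix_vector_mul_assoc[symmetric] FE)
    finally show ?thesis .
  qed
  from herm_adj_unique[OF this] this
  have adj: "herm_adj g P = E ** R' ** F" and eq: "g (P *v u) v = g u (herm_adj g P *v v)"
    by auto
  show "g (P *v u) v = g u (herm_adj g P *v v)" by (rule eq)
  assume "trace (P ** herm_adj g P) = 0"
  moreover have "trace (P ** herm_adj g P) = trace (R ** R')"
    unfolding adj R_def by (metis matrix_mul_assoc trace_mul_sym)
  ultimately have "(\<Sum>i\<in>UNIV. \<Sum>j\<in>UNIV. R $ i $ j * cnj (R $ i $ j)) = 0"
    by (simp add: trace_def matrix_matrix_mult_def R'_def)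
  then have "of_real (\<Sum>i\<in>UNIV. \<Sum>j\<in>UNIV. (cmod (R $ i $ j))\<^sup>2) = (0::complex)"
    by (simp only: of_real_sum complex_norm_square)
  then have "(\<Sum>i\<in>UNIV. \<Sum>j\<in>UNIV. (cmod (R $ i $ j))\<^sup>2) = 0" by (simp only: of_real_eq_0_iff)
  then have "R = 0" by (simp add: sum_nonneg_eq_0_iff sum_nonneg vec_eq_iff)
  moreover have "P = E ** R ** F"
    unfolding R_def by (metis EF(1) matrix_mul_assoc matrix_mul_lid matrix_mul_rid)
  ultimately show "P = 0" by simp
qed

lemma normal_commutator_eq_0:
  assumes "P ** herm_adj g P = herm_adj g P ** P" "P ** Q - Q ** P = P"
  shows "P = 0"
proof (rule trace_herm_adj_eq_0)
  let ?A = "herm_adj g P"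
  have "trace (P ** ?A) = trace ((P ** Q - Q ** P) ** ?A)" by (simp only: assms(2))
  also have "\<dots> = trace (P ** Q ** ?A) - trace (Q ** P ** ?A)"
    by (simp add: matrix_diff_rdistrib trace_sub)
  also have "trace (P ** Q ** ?A) = trace (Q ** (?A ** P))"
    by (metis matrix_mul_assoc trace_mul_sym)
  also have "Q ** (?A ** P) = Q ** P ** ?A" by (simp add: matrix_mul_assoc flip: assms(1))
  finally show "trace (P ** ?A) = 0" by simp
qed

end

section \<open>The linear Frobenius theorem, by Picard iteration along rays\<close>

section \<open>Integrable total differential systems\<close>

text \<open>This is the derivative in \<open>z\<close>, at fixed \<open>t\<close>, of the integrand
  \<open>A y (z - p) (e y)\<close> with \<open>y = p + t *\<^sub>R (z - p)\<close>; \<open>F\<close>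
  stands for the derivative of \<open>e\<close>, and the factors \<open>t\<close> come from the
  chain rule. It is packed as a bounded linear map so that it can be integrated over
  \<open>t\<close> as a whole.\<close>

definition radial_kernel ::
  "('a::euclidean_space \<Rightarrow> 'a \<Rightarrow>\<^sub>L 'b::euclidean_space \<Rightarrow>\<^sub>L 'b) \<Rightarrow> ('a \<Rightarrow> 'a \<Rightarrow>\<^sub>L 'a \<Rightarrow>\<^sub>L 'b \<Rightarrow>\<^sub>L 'b) \<Rightarrow> 'a \<Rightarrow>
   ('a \<Rightarrow> 'b) \<Rightarrow> ('a \<Rightarrow> 'a \<Rightarrow>\<^sub>L 'b) \<Rightarrow> 'a \<Rightarrow> real \<Rightarrow> 'a \<Rightarrow>\<^sub>L 'b" where
  "radial_kernel A A' p e F z t = (let y = p + t *\<^sub>R (z - p) in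
     Blinfun (\<lambda>v. t *\<^sub>R A' y v (z - p) (e y) + A y v (e y) + t *\<^sub>R A y (z - p) (F y v)))"

lemma radial_kernel_apply:
  "radial_kernel A A' p e F z t v = (let y = p + t *\<^sub>R (z - p) in
     t *\<^sub>R A' y v (z - p) (e y) + A y v (e y) + t *\<^sub>R A y (z - p) (F y v))"
proof -
  have "linear (\<lambda>v. t *\<^sub>R A' y v (z - p) (e y) + A y v (e y) + t *\<^sub>R A y (z - p) (F y v))" for y
    by (rule linearI) (simp_all add: blinfun.bilinear_simps algebra_simps)
  then show ?thesis
    unfolding radial_kernel_def Let_def by (simp add: bounded_linear_Blinfun_apply linear_linear)
qed

lemma radial_in_ball:
  fixes p :: "'a::real_normed_vector"
  assumes "z \<in> ball p r" "0 \<le> t" "t \<le> (1::real)"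
  shows "p + t *\<^sub>R (z - p) \<in> ball p r"
proof -
  have "norm (t *\<^sub>R (z - p)) \<le> norm (z - p)"
    using assms by (simp add: mult_left_le_one_le)
  then show ?thesis using assms by (simp add: dist_norm norm_minus_commute)
qed

lemma continuous_on_radial:
  fixes p :: "'a::real_normed_vector"
  assumes "continuous_on (ball p r) f"
  shows "continuous_on (ball p r \<times> cbox 0 1) (\<lambda>(z, t). f (p + t *\<^sub>R (z - p)))"
  unfolding split_beta
  by (rule continuous_on_compose2[OF assms]) (auto intro!: continuous_intros radial_in_ball simp del: mem_ball)

text \<open>Differentiation under the integral sign: continuity of \<open>A'\<close> and
  \<open>F\<close> makes the kernel jointly continuous in \<open>z\<close> and \<open>t\<close>. The
  continuity of the new derivative \<open>G\<close> is what allows the step to be iterated.\<close>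

lemma radial_step:
  fixes A :: "'a::euclidean_space \<Rightarrow> 'a \<Rightarrow>\<^sub>L 'b::euclidean_space \<Rightarrow>\<^sub>L 'b"
    and A' :: "'a \<Rightarrow> 'a \<Rightarrow>\<^sub>L 'a \<Rightarrow>\<^sub>L 'b \<Rightarrow>\<^sub>L 'b"
    and F :: "'a \<Rightarrow> 'a \<Rightarrow>\<^sub>L 'b"
  assumes A: "\<And>z. z \<in> ball p r \<Longrightarrow> (A has_derivative A' z) (at z)" and A': "continuous_on (ball p r) A'"
    and e: "\<And>z. z \<in> ball p r \<Longrightarrow> (e has_derivative F z) (at z)" and F: "continuous_on (ball p r) F"
  defines "G \<equiv> \<lambda>z. integral (cbox 0 1) (radial_kernel A A' p e F z)"
  shows radial_step_continuous: "continuous_on (ball p r) G"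
    and radial_step_apply: "z \<in> ball p r \<Longrightarrow>
      ((\<lambda>t. radial_kernel A A' p e F z t v) has_integral G z v) (cbox 0 1)"
    and radial_step_integrable: "z \<in> ball p r \<Longrightarrow>
      (\<lambda>t. A (p + t *\<^sub>R (z - p)) (z - p) (e (p + t *\<^sub>R (z - p)))) integrable_on cbox 0 1"
    and radial_step_derivative: "z \<in> ball p r \<Longrightarrow>
      ((\<lambda>z. integral (cbox 0 1) (\<lambda>t. A (p + t *\<^sub>R (z - p)) (z - p) (e (p + t *\<^sub>R (z - p)))))
        has_derivative G z) (at z)"
proof -
  have cA: "continuous_on (ball p r) A" and ce: "continuous_on (ball p r) e"
    using A e has_derivative_continuous by (blast intro: continuous_at_imp_continuous_on)+
  note cr = continuous_on_radial[OF cA] continuous_on_radial[OF ce] continuous_on_radial[OF A']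
    continuous_on_radial[OF F]
  have ck: "continuous_on (ball p r \<times> cbox 0 1) (\<lambda>(z, t). radial_kernel A A' p e F z t)"
    unfolding split_beta
    by (rule continuous_on_blinfun_componentwise)
      (use cr in \<open>auto simp: radial_kernel_apply Let_def split_beta intro!: continuous_intros\<close>)
  show "continuous_on (ball p r) G"
    unfolding G_def by (rule integral_continuous_on_param[OF ck])
  have slice: "continuous_on (cbox 0 1) (g z)" 
    if "continuous_on (ball p r \<times> cbox 0 1) (\<lambda>(z, t). g z t)" "z \<in> ball p r"
    for g :: "'a \<Rightarrow> real \<Rightarrow> 'c::topological_space" and z
  proof -
    have c: "continuous_on (cbox 0 1) (Pair z)" by (intro continuous_intros)
    have "Pair z ` cbox 0 1 \<subseteq> ball p r \<times> cbox 0 1" using that(2) by auto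
    from continuous_on_compose2[OF that(1) c this] show ?thesis by simp
  qed
  have ik: "radial_kernel A A' p e F z integrable_on cbox 0 1" if "z \<in> ball p r" for z
    by (rule integrable_continuous[OF slice[OF ck that]])
  show "((\<lambda>t. radial_kernel A A' p e F z t v) has_integral G z v) (cbox 0 1)" if "z \<in> ball p r" for z v
    using has_integral_linear[OF integrable_integral[OF ik[OF that]] 
        blinfun.bounded_linear_left[of v]] unfolding G_def o_def .
  have ci: "continuous_on (ball p r \<times> cbox 0 1)
      (\<lambda>(z, t). A (p + t *\<^sub>R (z - p)) (z - p) (e (p + t *\<^sub>R (z - p))))"
    using cr by (auto simp: split_beta intro!: continuous_intros)
  show ii: "(\<lambda>t. A (p + t *\<^sub>R (z - p)) (z - p) (e (p + t *\<^sub>R (z - p)))) integrable_on cbox 0 1"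
    if "z \<in> ball p r" for z
    by (rule integrable_continuous[OF slice[OF ci that]])
  have d: "((\<lambda>z. A (p + t *\<^sub>R (z - p)) (z - p) (e (p + t *\<^sub>R (z - p))))
      has_derivative radial_kernel A A' p e F z t) (at z within ball p r)"
    if z: "z \<in> ball p r" and t: "t \<in> cbox 0 1" for z t
  proof -
    have y: "p + t *\<^sub>R (z - p) \<in> ball p r" using z t by (intro radial_in_ball) auto
    have ry: "((\<lambda>z. p + t *\<^sub>R (z - p)) has_derivative (\<lambda>v. t *\<^sub>R v)) (at z)"
      by (auto intro!: derivative_eq_intros)
    note dA = has_derivative_compose[OF ry A[OF y]] and de = has_derivative_compose[OF ry e[OF y]]
    have rz: "((\<lambda>z. z - p) has_derivative (\<lambda>v. v)) (at z)"
      by (auto intro!: derivative_eq_intros)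
    have "((\<lambda>z. A (p + t *\<^sub>R (z - p)) (z - p) (e (p + t *\<^sub>R (z - p))))
      has_derivative radial_kernel A A' p e F z t) (at z)"
      by (rule has_derivative_eq_rhs, rule blinfun.FDERIV, rule blinfun.FDERIV, rule dA, rule rz, rule de)
        (auto simp: radial_kernel_apply Let_def blinfun.bilinear_simps algebra_simps)
    then show ?thesis by (rule has_derivative_at_withinI)
  qed
  show "((\<lambda>z. integral (cbox 0 1) (\<lambda>t. A (p + t *\<^sub>R (z - p)) (z - p) (e (p + t *\<^sub>R (z - p)))))
        has_derivative G z) (at z)" if z: "z \<in> ball p r" for z
    using leibniz_rule[OF d ii ck z] z unfolding G_def
    by (simp add: at_within_open_NO_MATCH)
qed


text \<open>On the segment from \<open>p\<close> to \<open>z\<close> a solution of de = A e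
  satisfies e(z) = E + integral of \<open>A y (z - p) (e y)\<close> over \<open>t\<close>. This
  equation is iterated for all \<open>z\<close> simultaneously. Starting from 0 makes the first
  iterate the constant \<open>E\<close>, so the first difference has norm \<open>norm E\<close>
  everywhere.\<close>

primrec picard :: "('a::euclidean_space \<Rightarrow> 'a \<Rightarrow>\<^sub>L 'b::euclidean_space \<Rightarrow>\<^sub>L 'b) \<Rightarrow> 'a \<Rightarrow> 'b \<Rightarrow> nat \<Rightarrow> 'a \<Rightarrow> 'b" where
  "picard A p E 0 = (\<lambda>z. 0)"
| "picard A p E (Suc n) = (\<lambda>z. E + integral (cbox 0 1)
     (\<lambda>t. A (p + t *\<^sub>R (z - p)) (z - p) (picard A p E n (p + t *\<^sub>R (z - p)))))"

primrec picard_deriv :: "('a::euclidean_space \<Rightarrow> 'a \<Rightarrow>\<^sub>L 'b::euclidean_space \<Rightarrow>\<^sub>L 'b) \<Rightarrow>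
    ('a \<Rightarrow> 'a \<Rightarrow>\<^sub>L 'a \<Rightarrow>\<^sub>L 'b \<Rightarrow>\<^sub>L 'b) \<Rightarrow> 'a \<Rightarrow> 'b \<Rightarrow> nat \<Rightarrow> 'a \<Rightarrow> 'a \<Rightarrow>\<^sub>L 'b" where
  "picard_deriv A A' p E 0 = (\<lambda>z. 0)"
| "picard_deriv A A' p E (Suc n) = (\<lambda>z. integral (cbox 0 1)
     (radial_kernel A A' p (picard A p E n) (picard_deriv A A' p E n) z))"

text \<open>The hypothesis \<open>integrability\<close> is the symmetry in \<open>u\<close> and
  \<open>v\<close> of the second derivative that a solution would have. Only the ray equation is
  solved by iteration; integrability then shows that the limit satisfies the equation in all
  directions. The radius precedes \<open>E\<close>, so that one ball serves a whole basis of initial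
  values.\<close>

lemma total_differential_system:
  fixes A :: "'a::euclidean_space \<Rightarrow> 'a \<Rightarrow>\<^sub>L 'b::euclidean_space \<Rightarrow>\<^sub>L 'b"
    and A' :: "'a \<Rightarrow> 'a \<Rightarrow>\<^sub>L 'a \<Rightarrow>\<^sub>L 'b \<Rightarrow>\<^sub>L 'b"
  assumes S: "open S" "p \<in> S"
    and A: "\<And>z. z \<in> S \<Longrightarrow> (A has_derivative A' z) (at z)" and A': "continuous_on S A'"
    and integrability: "\<And>z u v w. z \<in> S \<Longrightarrow> A' z u v w + A z v (A z u w) = A' z v u w + A z u (A z v w)"
  shows "\<exists>r>0. ball p r \<subseteq> S \<and>
    (\<forall>E. \<exists>e. e p = E \<and> (\<forall>z\<in>ball p r. (e has_derivative (\<lambda>v. A z v (e z))) (at z)))"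
proof -
  obtain r0 where r0: "r0 > 0" "cball p r0 \<subseteq> S"
    using S open_contains_cball by blast
  have "continuous_on (cball p r0) A"
    using A r0 has_derivative_continuous by (blast intro: continuous_at_imp_continuous_on)
  then have "bounded (A ` cball p r0)"
    by (intro compact_imp_bounded compact_continuous_image) auto
  then obtain K where K: "K > 0" "\<And>z. z \<in> cball p r0 \<Longrightarrow> norm (A z) \<le> K"
    by (auto simp: bounded_pos)
  \<comment> \<open>With \<open>K * r\<close> at most 1/4, every application of
    \<open>A y (z - p)\<close> contracts by the factor 1/4 (this is \<open>K2\<close>).\<close>
  define r where "r = min r0 (1 / (4 * K))"
  have r: "r > 0" "r \<le> r0" "K * r \<le> 1 / 4"
    using r0 K(1) by (auto simp: r_def min_def field_simps)
  have BS: "ball p r \<subseteq> S" using r0 r by auto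
  have KB: "norm (A z) \<le> K" if "z \<in> ball p r" for z
    using K(2) that r by auto
  have K1: "norm (A z v w) \<le> K * norm v * norm w" if "z \<in> ball p r" for z v w
  proof -
    have "norm (A z v w) \<le> norm (A z v) * norm w" by (rule norm_blinfun)
    also have "\<dots> \<le> (norm (A z) * norm v) * norm w" by (intro mult_right_mono norm_blinfun) auto
    also have "\<dots> \<le> (K * norm v) * norm w" by (intro mult_right_mono KB that) auto
    finally show ?thesis .
  qed
  have K2: "norm (A y (z - p) w) \<le> norm w / 4" if "y \<in> ball p r" "z \<in> ball p r" for y z w
  proof -
    have "norm (A y (z - p) w) \<le> K * norm (z - p) * norm w" by (rule K1[OF that(1)])
    also have "\<dots> \<le> K * r * norm w"
      using that(2) K by (intro mult_right_mono mult_left_mono) (auto simp: dist_norm norm_minus_commute)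
    also have "\<dots> \<le> 1 / 4 * norm w" by (intro mult_right_mono r) auto
    finally show ?thesis by simp
  qed
  have "\<exists>e. e p = E \<and> (\<forall>z\<in>ball p r. (e has_derivative (\<lambda>v. A z v (e z))) (at z))" for E
  proof -
    define e F M where "e = picard A p E" and "F = picard_deriv A A' p E" and "M = norm E"
    define y where "y z t = p + t *\<^sub>R (z - p)" for z and t :: real
    have yB: "y z t \<in> ball p r" if "z \<in> ball p r" "t \<in> {0..1}" for z t
      unfolding y_def using that by (intro radial_in_ball) auto
    have A_B: "\<And>z. z \<in> ball p r \<Longrightarrow> (A has_derivative A' z) (at z)" and A'_B: "continuous_on (ball p r) A'"
      using BS A A' by (auto intro: continuous_on_subset)
    have D: "(\<forall>z\<in>ball p r. (e n has_derivative F n z) (at z)) \<and> continuous_on (ball p r) (F n)" for n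
    proof (induction n)
      case 0
      then show ?case by (auto simp: e_def F_def zero_blinfun.rep_eq)
    next
      case (Suc n)
      then have De: "\<And>z. z \<in> ball p r \<Longrightarrow> (e n has_derivative F n z) (at z)"
        and cF: "continuous_on (ball p r) (F n)" by auto
      have "(e (Suc n) has_derivative F (Suc n) z) (at z)" if "z \<in> ball p r" for z
        using has_derivative_add[OF has_derivative_const radial_step_derivative[OF A_B A'_B De cF that]]
        by (simp add: e_def F_def)
      then show ?case
        using radial_step_continuous[OF A_B A'_B De cF] by (simp add: e_def F_def)
    qed
    then have De: "\<And>n z. z \<in> ball p r \<Longrightarrow> (e n has_derivative F n z) (at z)"
      and cF: "\<And>n. continuous_on (ball p r) (F n)" by auto
    have ik: "((\<lambda>t. radial_kernel A A' p (e n) (F n) z t v) has_integral F (Suc n) z v) {0..1}"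
      if "z \<in> ball p r" for n z v
      using radial_step_apply[OF A_B A'_B De cF that] by (simp add: F_def e_def)
    have ide: "(\<lambda>t. A (y z t) (z - p) (e n (y z t))) integrable_on {0..1}" if "z \<in> ball p r" for n z
      using radial_step_integrable[OF A_B A'_B De cF that] by (simp add: y_def)
    \<comment> \<open>The integrand is the derivative of
      \<open>t *\<^sub>R A (y z t) v (e n (y z t))\<close>, which vanishes at \<open>t = 0\<close>
      and equals \<open>A z v (e n z)\<close> at \<open>t = 1\<close>.\<close>
    have ftc: "((\<lambda>t. A (y z t) v (e n (y z t)) + t *\<^sub>R A' (y z t) (z - p) v (e n (y z t))
        + t *\<^sub>R A (y z t) v (F n (y z t) (z - p))) has_integral A z v (e n z)) {0..1}"
      if z: "z \<in> ball p r" for n z v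
    proof -
      have "((\<lambda>t. t *\<^sub>R A (y z t) v (e n (y z t))) has_vector_derivative
          (A (y z t) v (e n (y z t)) + t *\<^sub>R A' (y z t) (z - p) v (e n (y z t))
        + t *\<^sub>R A (y z t) v (F n (y z t) (z - p)))) (at t within {0..1})" if t: "t \<in> {0..1}" for t
      proof -
        have ry: "(y z has_derivative (\<lambda>h. h *\<^sub>R (z - p))) (at t within {0..1})"
          unfolding y_def by (auto intro!: derivative_eq_intros)
        note dA = has_derivative_compose[OF ry A_B[OF yB[OF z t]]]
          and de = has_derivative_compose[OF ry De[OF yB[OF z t]]]
        show ?thesis unfolding has_vector_derivative_def
          by (rule has_derivative_eq_rhs, rule has_derivative_scaleR, rule has_derivative_ident,
              rule blinfun.FDERIV, rule blinfun.FDERIV, rule dA, rule has_derivative_const, rule de)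
            (auto simp: blinfun.bilinear_simps algebra_simps)
      qed
      from fundamental_theorem_of_calculus[OF _ this] show ?thesis by (simp add: y_def)
    qed
    \<comment> \<open>For \<open>v = z - p\<close> the two arguments of \<open>A'\<close> agree, so
      the kernel coincides with the integrand of \<open>ftc\<close> and no integrability is
      involved.\<close>
    have radial: "F (Suc n) z (z - p) = A z (z - p) (e n z)" if "z \<in> ball p r" for n z
      by (rule has_integral_unique[OF ik[OF that]])
        (use ftc[OF that, where n=n and v="z - p"] in \<open>simp add: radial_kernel_apply Let_def y_def add_ac\<close>)
    have bound: "norm i \<le> B" if "(f has_integral i) {0..1}" "\<And>t. t \<in> {0..1} \<Longrightarrow> norm (f t) \<le> B"
      for f :: "real \<Rightarrow> 'b" and i B
    proof -
      have "0 \<le> norm (f 0)" by simp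
      also have "\<dots> \<le> B" using that(2)[of 0] by simp
      finally have "0 \<le> B" .
      then show ?thesis using has_integral_bound[of B f i 0 1] that by auto
    qed
    have step: "norm (e (Suc n) z - e n z) \<le> M * (1/4) ^ n" if "z \<in> ball p r" for n z
      using that
    proof (induction n arbitrary: z)
      case 0
      then show ?case by (simp add: e_def M_def)
    next
      case (Suc n)
      have "((\<lambda>t. A (y z t) (z - p) (e (Suc n) (y z t)) - A (y z t) (z - p) (e n (y z t))) has_integral
          (e (Suc (Suc n)) z - e (Suc n) z)) {0..1}"
        using has_integral_diff[OF integrable_integral[OF ide[OF Suc.prems, of "Suc n"]]
            integrable_integral[OF ide[OF Suc.prems, of n]]]
        by (simp add: e_def y_def)
      then show ?case
      proof (rule bound)
        fix t :: real assume t: "t \<in> {0..1}"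
        have "norm (A (y z t) (z - p) (e (Suc n) (y z t) - e n (y z t)))
            \<le> norm (e (Suc n) (y z t) - e n (y z t)) / 4"
          using yB[OF Suc.prems t] Suc.prems by (rule K2)
        then show "norm (A (y z t) (z - p) (e (Suc n) (y z t)) - A (y z t) (z - p) (e n (y z t)))
            \<le> M * (1/4) ^ Suc n"
          using Suc.IH[OF yB[OF Suc.prems t]] by (simp add: blinfun.bilinear_simps)
      qed
    qed
    txt \<open>\<open>e (Suc n)\<close> solves the system exactly in the radial direction, with \<open>e n\<close> on the right-hand
      side. Subtracting the radial derivative of \<open>t A(y)(v) e n\<close> under the integral and using integrability
      bounds the defect in every other direction by the previous defect and \<open>e (Suc n) - e n\<close>.\<close>
    have defect: "norm (F (Suc n) z v - A z v (e n z)) \<le> 2 * K * M * (1/2) ^ n * norm v"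
      if "z \<in> ball p r" for n z v
      using that
    proof (induction n arbitrary: z)
      case 0
      have "F (Suc 0) z = 0"
        by (rule blinfun_eqI, rule has_integral_unique[OF ik[OF 0]])
          (simp add: radial_kernel_apply e_def F_def)
      then show ?case using K by (simp add: e_def M_def)
    next
      case (Suc m)
      note z = Suc.prems
      define x where "x = z - p"
      let ?y = "y z"
      \<comment> \<open>\<open>radial\<close> at the point \<open>?y t\<close> concerns the
        direction \<open>?y t - p = t *\<^sub>R x\<close>. Keeping the factor \<open>t\<close>
        avoids a division at \<open>t = 0\<close>.\<close>
      have tF: "t *\<^sub>R F (Suc m) (?y t) x = t *\<^sub>R A (?y t) x (e m (?y t))" if "t \<in> {0..1}" for t
        using radial[OF yB[OF z that], of m] unfolding y_def x_def by (simp add: blinfun.bilinear_simps)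
      have "((\<lambda>t. t *\<^sub>R (A (?y t) v (A (?y t) x (e (Suc m) (?y t) - e m (?y t)))
            - A (?y t) x (A (?y t) v (e (Suc m) (?y t) - e m (?y t)))
            + A (?y t) x (F (Suc m) (?y t) v - A (?y t) v (e m (?y t))))) has_integral
          (F (Suc (Suc m)) z v - A z v (e (Suc m) z))) {0..1}"
      proof (rule has_integral_eq[OF _ has_integral_diff[OF ik[OF z] ftc[OF z]]])
        fix t :: real assume t: "t \<in> {0..1}"
        have "t *\<^sub>R A (?y t) v (F (Suc m) (?y t) x) = A (?y t) v (t *\<^sub>R F (Suc m) (?y t) x)"
          by (simp add: blinfun.bilinear_simps)
        also have "\<dots> = t *\<^sub>R A (?y t) v (A (?y t) x (e m (?y t)))"
          unfolding tF[OF t] by (simp add: blinfun.bilinear_simps)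
        finally have 1: "t *\<^sub>R A (?y t) v (F (Suc m) (?y t) x) = t *\<^sub>R A (?y t) v (A (?y t) x (e m (?y t)))" .
        \<comment> \<open>The kernel differentiates \<open>A\<close> along \<open>v\<close> and
          \<open>ftc\<close> along \<open>x\<close>; integrability trades one for the other at the
          price of a commutator, whose terms combine with the preceding identity.\<close>
        have 2: "A' (?y t) v x w = A' (?y t) x v w + A (?y t) v (A (?y t) x w) - A (?y t) x (A (?y t) v w)" for w
          using integrability[of "?y t" v x w] yB[OF z t] BS by (auto simp: algebra_simps)
        have rk: "radial_kernel A A' p (e (Suc m)) (F (Suc m)) z t v =
            t *\<^sub>R A' (?y t) v x (e (Suc m) (?y t)) + A (?y t) v (e (Suc m) (?y t))
            + t *\<^sub>R A (?y t) x (F (Suc m) (?y t) v)"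
          by (simp add: radial_kernel_apply Let_def y_def x_def)
        show "radial_kernel A A' p (e (Suc m)) (F (Suc m)) z t v -
            (A (?y t) v (e (Suc m) (?y t)) + t *\<^sub>R A' (?y t) (z - p) v (e (Suc m) (?y t)) +
             t *\<^sub>R A (?y t) v (F (Suc m) (?y t) (z - p))) =
          t *\<^sub>R (A (?y t) v (A (?y t) x (e (Suc m) (?y t) - e m (?y t)))
            - A (?y t) x (A (?y t) v (e (Suc m) (?y t) - e m (?y t)))
            + A (?y t) x (F (Suc m) (?y t) v - A (?y t) v (e m (?y t))))"
          unfolding rk x_def[symmetric] 1 2
          by (simp add: blinfun.bilinear_simps algebra_simps)
      qed
      then show ?case
      proof (rule bound)
        fix t :: real assume t: "t \<in> {0..1}"
        note yt = yB[OF z t]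
        define w where "w = e (Suc m) (?y t) - e m (?y t)"
        define s where "s = F (Suc m) (?y t) v - A (?y t) v (e m (?y t))"
        have w: "norm w \<le> M * (1/4) ^ m" unfolding w_def by (rule step[OF yt])
        have s: "norm s \<le> 2 * K * M * (1/2) ^ m * norm v" unfolding s_def by (rule Suc.IH[OF yt])
        have Kv: "0 \<le> K * norm v" using K by simp
        have 1: "norm (A (?y t) v (A (?y t) x w)) \<le> K * norm v * (M * (1/4) ^ m / 4)"
        proof -
          have "norm (A (?y t) v (A (?y t) x w)) \<le> K * norm v * norm (A (?y t) x w)" by (rule K1[OF yt])
          also have "\<dots> \<le> K * norm v * (norm w / 4)"
            unfolding x_def by (intro mult_left_mono K2 yt z Kv)
          also have "\<dots> \<le> K * norm v * (M * (1/4) ^ m / 4)"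
            using w by (intro mult_left_mono Kv) auto
          finally show ?thesis .
        qed
        have 2: "norm (A (?y t) x (A (?y t) v w)) \<le> K * norm v * (M * (1/4) ^ m) / 4"
        proof -
          have "norm (A (?y t) x (A (?y t) v w)) \<le> norm (A (?y t) v w) / 4"
            unfolding x_def by (intro K2 yt z)
          also have "\<dots> \<le> (K * norm v * norm w) / 4" by (intro divide_right_mono K1 yt) auto
          also have "\<dots> \<le> K * norm v * (M * (1/4) ^ m) / 4"
            using w by (intro divide_right_mono mult_left_mono Kv) auto
          finally show ?thesis .
        qed
        have 3: "norm (A (?y t) x s) \<le> 2 * K * M * (1/2) ^ m * norm v / 4"
          using K2[OF yt z, of s] s unfolding x_def by linarith
        have KMv: "0 \<le> K * M * norm v" using K by (simp add: M_def)
        have "(1/4::real) ^ m \<le> (1/2) ^ m" by (rule power_mono) auto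
        then have 4: "K * M * norm v * (1/4) ^ m \<le> K * M * norm v * (1/2) ^ m"
          by (rule mult_left_mono[OF _ KMv])
        let ?a = "A (?y t) v (A (?y t) x w)" and ?b = "A (?y t) x (A (?y t) v w)" and ?c = "A (?y t) x s"
        have "norm (t *\<^sub>R (?a - ?b + ?c)) \<le> norm (?a - ?b + ?c)"
          using t by (simp add: mult_left_le_one_le)
        also have "\<dots> \<le> norm ?a + norm ?b + norm ?c"
          by (smt (verit) norm_triangle_ineq norm_triangle_ineq4)
        \<comment> \<open>In units of \<open>K * M * (1/2) ^ m * norm v\<close> the three terms
          contribute at most 1/4, 1/4 and 1/2. Their sum 1 is exactly the claimed bound, which
          explains the constant 2 and the ratio 1/2.\<close>
        also have "\<dots> \<le> 2 * K * M * (1/2) ^ Suc m * norm v"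
          using 1 2 3 4 by (simp add: algebra_simps)
        finally show "norm (t *\<^sub>R (A (?y t) v (A (?y t) x (e (Suc m) (?y t) - e m (?y t)))
            - A (?y t) x (A (?y t) v (e (Suc m) (?y t) - e m (?y t)))
            + A (?y t) x (F (Suc m) (?y t) v - A (?y t) v (e m (?y t)))))
           \<le> 2 * K * M * (1/2) ^ Suc m * norm v"
          unfolding w_def s_def .
      qed
    qed
    define L where "L z = (\<Sum>n. e (Suc n) z - e n z)" for z
    have tele: "(\<Sum>i<n. e (Suc i) z - e i z) = e n z" for n z
      using sum_lessThan_telescope[of "\<lambda>i. e i z" n] by (simp add: e_def del: picard.simps(2))
    have "uniform_limit (ball p r) (\<lambda>n z. \<Sum>i<n. e (Suc i) z - e i z) L sequentially"
      unfolding L_def by (rule Weierstrass_m_test[OF step]) (auto intro!: summable_mult summable_geometric)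
    then have UL: "uniform_limit (ball p r) e L sequentially" unfolding tele .
    \<comment> \<open>The derivatives \<open>F (Suc n) z\<close> converge uniformly to
      \<open>A z v (L z)\<close>: \<open>defect\<close> compares them with
      \<open>A z v (e n z)\<close>, and \<open>e n\<close> tends to \<open>L\<close> uniformly. The
      shift to \<open>Suc n\<close> matches the index in \<open>defect\<close>; the limit
      \<open>g\<close> is identified with \<open>L\<close> afterwards.\<close>
    have "\<exists>g. \<forall>z\<in>ball p r. (\<lambda>n. e (Suc n) z) \<longlonglongrightarrow> g z \<and>
        (g has_derivative (\<lambda>v. A z v (L z))) (at z within ball p r)"
    proof (rule has_derivative_sequence)
      show "p \<in> ball p r" using r by simp
      show "(\<lambda>n. e (Suc n) p) \<longlonglongrightarrow> L p"
        using LIMSEQ_Suc[OF tendsto_uniform_limitI[OF UL, of p]] r by auto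
      show "(e (Suc n) has_derivative F (Suc n) z) (at z within ball p r)" if "z \<in> ball p r" for n z
        using De[OF that] by (rule has_derivative_at_withinI)
      fix \<epsilon> :: real assume \<epsilon>: "\<epsilon> > 0"
      have "(\<lambda>n. 2 * K * M * (1/2) ^ n) \<longlonglongrightarrow> 2 * K * M * 0"
        by (intro tendsto_intros LIMSEQ_realpow_zero) auto
      then have "\<forall>\<^sub>F n in sequentially. 2 * K * M * (1/2) ^ n < \<epsilon> / 2"
        using \<epsilon> by (intro order_tendstoD(2)) auto
      moreover have "\<forall>\<^sub>F n in sequentially. \<forall>z\<in>ball p r. dist (e n z) (L z) < \<epsilon> / (2 * K)"
        using UL \<epsilon> K by (intro uniform_limitD) auto
      ultimately show "\<forall>\<^sub>F n in sequentially. \<forall>z\<in>ball p r. \<forall>h.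
          norm (F (Suc n) z h - A z h (L z)) \<le> \<epsilon> * norm h"
      proof eventually_elim
        case (elim n)
        show ?case
        proof (intro ballI allI)
          fix z h assume z: "z \<in> ball p r"
          have "norm (F (Suc n) z h - A z h (L z))
              \<le> norm (F (Suc n) z h - A z h (e n z)) + norm (A z h (e n z - L z))"
            by (simp add: blinfun.bilinear_simps norm_diff_triangle_ineq)
              (smt (verit) norm_triangle_ineq diff_add_cancel add_diff_eq)
          also have "\<dots> \<le> 2 * K * M * (1/2) ^ n * norm h + K * norm h * norm (e n z - L z)"
            by (intro add_mono defect K1 z)
          also have "\<dots> \<le> \<epsilon> / 2 * norm h + K * norm h * (\<epsilon> / (2 * K))"
            using elim z K by (intro add_mono mult_right_mono mult_left_mono) (auto simp: dist_norm less_imp_le)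
          also have "\<dots> = \<epsilon> * norm h" using K by (simp add: field_simps)
          finally show "norm (F (Suc n) z h - A z h (L z)) \<le> \<epsilon> * norm h" .
        qed
      qed
    qed simp
    then obtain g where g: "\<And>z. z \<in> ball p r \<Longrightarrow> (\<lambda>n. e (Suc n) z) \<longlonglongrightarrow> g z"
      "\<And>z. z \<in> ball p r \<Longrightarrow> (g has_derivative (\<lambda>v. A z v (L z))) (at z)"
      by (metis at_within_open open_ball)
    have "g z = L z" if "z \<in> ball p r" for z
      using LIMSEQ_unique[OF g(1)[OF that] LIMSEQ_Suc[OF tendsto_uniform_limitI[OF UL that]]] .
    then have "\<forall>z\<in>ball p r. (g has_derivative (\<lambda>v. A z v (g z))) (at z)"
      using g(2) by simp
    moreover have "g p = E"
      using g(1)[of p] r by (simp add: e_def LIMSEQ_const_iff)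
    ultimately show ?thesis by blast
  qed
  then show ?thesis using r BS by blast
qed

section \<open>From complex differentiability to smoothness, by Cauchy's integral formula\<close>

section \<open>Holomorphic functions of several variables\<close>

lemma norm_vector_scalar_mult: "norm (c *s v) = cmod c * norm v" for v :: "complex^'n"
  by (simp add: norm_vec_def norm_mult L2_set_right_distrib)

lemma has_derivative_vec_lambda:
  fixes f :: "'a::real_normed_vector \<Rightarrow> complex^'n"
  assumes "\<And>k. ((\<lambda>x. f x $ k) has_derivative L k) (at x)"
  shows "(f has_derivative (\<lambda>v. \<chi> k. L k v)) (at x)"
proof -
  have b: "bounded_linear (axis k :: complex \<Rightarrow> complex^'n)" for k
    by (intro linear_conv_bounded_linear[THEN iffD1] linearI) (simp_all add: axis_def vec_eq_iff)
  have e: "u = (\<Sum>k\<in>UNIV. axis k (u $ k))" for u :: "complex^'n"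
    by (simp add: vec_eq_iff axis_def)
  have "((\<lambda>x. \<Sum>k\<in>UNIV. axis k (f x $ k)) has_derivative (\<lambda>v. \<Sum>k\<in>UNIV. axis k (L k v))) (at x)"
    by (intro has_derivative_sum bounded_linear.has_derivative[OF b] assms)
  moreover have "(\<lambda>v. \<Sum>k\<in>UNIV. axis k (L k v)) = (\<lambda>v. \<chi> k. L k v)"
    by (simp add: fun_eq_iff vec_eq_iff axis_def)
  ultimately show ?thesis by (simp flip: e)
qed

lemma has_derivative_vec_nth:
  "(f has_derivative L) F \<Longrightarrow> ((\<lambda>x. f x $ k) has_derivative (\<lambda>v. L v $ k)) F"
  by (rule bounded_linear.has_derivative[OF bounded_linear_vec_nth])

lemma complex_linear_expand:
  fixes L :: "complex^'m::finite \<Rightarrow> complex"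
  assumes "linear L" "\<And>a v. L (a *s v) = a * L v"
  shows "L v = (\<Sum>j\<in>UNIV. v $ j * L (axis j 1))"
proof -
  have "L v = L (\<Sum>j\<in>UNIV. v $ j *s axis j 1)" by (simp only: basis_expansion)
  also have "\<dots> = (\<Sum>j\<in>UNIV. v $ j * L (axis j 1))"
    unfolding linear_sum[OF assms(1)] assms(2) ..
  finally show ?thesis .
qed

lemma holo_fun_frechet:
  assumes "holo_fun S f" "x \<in> S"
  shows "(f has_derivative frechet_derivative f (at x)) (at x)"
    and "frechet_derivative f (at x) (a *s v) = a * frechet_derivative f (at x) v"
  using assms unfolding holo_fun_def by (metis frechet_derivative_at)+

text \<open>The complex linear derivatives of the components assemble into one complex matrix
  \<open>J\<close>. In this form the chain rule is a matrix product, and exhibiting \<open>J\<close>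
  is a proof of holomorphy.\<close>

lemma holo_vec_iff:
  "holo_vec S f \<longleftrightarrow> (\<forall>x\<in>S. \<exists>J. (f has_derivative (\<lambda>v. J *v v)) (at x))"
proof
  assume f: "holo_vec S f"
  show "\<forall>x\<in>S. \<exists>J. (f has_derivative (\<lambda>v. J *v v)) (at x)"
  proof
    fix x assume x: "x \<in> S"
    let ?L = "\<lambda>k. frechet_derivative (\<lambda>x. f x $ k) (at x)"
    note L = holo_fun_frechet[OF _ x, of "\<lambda>x. f x $ k" for k]
    have h: "holo_fun S (\<lambda>x. f x $ k)" for k using f by (simp add: holo_vec_def)
    have e: "?L k v = (\<Sum>j\<in>UNIV. v $ j * ?L k (axis j 1))" for k v
      by (rule complex_linear_expand) (use L[OF h] has_derivative_linear in blast)+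
    have "(\<chi> k. ?L k v) = (\<chi> k j. ?L k (axis j 1)) *v v" for v
    proof (rule vec_eq_iff[THEN iffD2], rule allI)
      fix k
      have "((\<chi> k j. ?L k (axis j 1)) *v v) $ k = (\<Sum>j\<in>UNIV. v $ j * ?L k (axis j 1))"
        by (simp add: matrix_vector_mult_def mult.commute)
      then show "(\<chi> k. ?L k v) $ k = ((\<chi> k j. ?L k (axis j 1)) *v v) $ k"
        using e[of k v] by (simp only: vec_lambda_beta)
    qed
    then have "(\<lambda>v. \<chi> k. ?L k v) = (\<lambda>v. (\<chi> k j. ?L k (axis j 1)) *v v)" by blast
    with has_derivative_vec_lambda[OF L(1)[OF h]]
    show "\<exists>J. (f has_derivative (\<lambda>v. J *v v)) (at x)" by metis
  qed
next
  assume f: "\<forall>x\<in>S. \<exists>J. (f has_derivative (\<lambda>v. J *v v)) (at x)"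
  show "holo_vec S f" unfolding holo_vec_def holo_fun_def
  proof (intro allI ballI)
    fix k x assume "x \<in> S"
    then obtain J where "(f has_derivative (\<lambda>v. J *v v)) (at x)" using f by blast
    from has_derivative_vec_nth[OF this]
    show "\<exists>L. ((\<lambda>x. f x $ k) has_derivative L) (at x) \<and> (\<forall>a v. L (a *s v) = a * L v)"
      by (intro exI conjI) (auto simp: vector_scalar_commute)
  qed
qed

lemma continuous_on_circle_shift:
  fixes h :: "complex^'m::finite \<Rightarrow> 'c::topological_space"
  assumes "continuous_on S h" "\<And>x t. x \<in> U \<Longrightarrow> x + (of_real \<rho> * cis t) *s v \<in> S"
  shows "continuous_on (U \<times> T) (\<lambda>(x, t). h (x + (of_real \<rho> * cis t) *s v))"
proof -
  have "continuous_on (U \<times> T) (\<lambda>p. fst p + (of_real \<rho> * cis (snd p)) *s v)"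
    unfolding vector_scalar_mult_def by (intro continuous_intros)
  then show ?thesis
    unfolding split_beta by (rule continuous_on_compose2[OF assms(1)]) (use assms(2) in auto)
qed

context
  fixes S :: "(complex^'m::finite) set" and f :: "complex^'m \<Rightarrow> complex"
  assumes S: "open S" and f: "holo_fun S f"
begin

lemma holo_fun_continuous_on: "continuous_on S f"
  using holo_fun_frechet(1)[OF f] has_derivative_continuous
  by (blast intro: continuous_at_imp_continuous_on)

text \<open>One-variable Cauchy formula for the derivative at 0 of \<zeta> \<mapsto> f(x + \<zeta>
  v) on a circle. The radius \<rho> is common to all \<open>x\<close> near \<open>x0\<close>, so the
  right-hand side may be differentiated in \<open>x\<close>.\<close>

lemma holo_fun_Cauchy:
  assumes x0: "x0 \<in> S"
  obtains r \<rho> k where "r > 0" "ball x0 r \<subseteq> S" "continuous_on UNIV k"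
    "\<And>x t. x \<in> ball x0 r \<Longrightarrow> x + (of_real \<rho> * cis t) *s v \<in> S"
    "\<And>x. x \<in> ball x0 r \<Longrightarrow> frechet_derivative f (at x) v
      = integral (cbox 0 (2 * pi)) (\<lambda>t. f (x + (of_real \<rho> * cis t) *s v) * k t)"
proof -
  obtain R where R: "R > 0" "cball x0 R \<subseteq> S" using S x0 open_contains_cball by blast
  \<comment> \<open>Both \<open>r\<close> and \<open>\<rho> * norm v\<close> are at most
    \<open>R / 2\<close>, so the circles stay in the ball of radius \<open>R\<close>; the 1 in the
    denominator covers \<open>v = 0\<close>.\<close>
  define \<rho> r where "\<rho> = R / (2 * (1 + norm v))" and "r = R / 2"
  have \<rho>: "\<rho> > 0" "\<rho> * norm v \<le> R / 2"
    using R(1) by (auto simp: \<rho>_def add_pos_nonneg field_simps)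
  have in_S: "x + \<zeta> *s v \<in> S" if x: "x \<in> ball x0 r" and \<zeta>: "cmod \<zeta> \<le> \<rho>" for x \<zeta>
  proof -
    have "dist x0 (x + \<zeta> *s v) \<le> dist x0 x + norm (\<zeta> *s v)"
      using dist_triangle[of x0 "x + \<zeta> *s v" x] by (simp add: dist_norm)
    also have "norm (\<zeta> *s v) \<le> R / 2"
      using \<zeta> \<rho> mult_right_mono[OF \<zeta>, of "norm v"] by (simp add: norm_vector_scalar_mult)
    finally show ?thesis using x R by (auto simp: r_def)
  qed
  \<comment> \<open>For \<zeta> = \<rho> cis t this is \<zeta>^(-2) d\<zeta>/dt divided by 2 pi i,
    the kernel of the first derivative.\<close>
  define k where "k t = 1 / (2 * of_real pi * of_real \<rho> * cis t)" for t
  have "frechet_derivative f (at x) v = integral (cbox 0 (2 * pi)) (\<lambda>t. f (x + (of_real \<rho> * cis t) *s v) * k t)"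
    if x: "x \<in> ball x0 r" for x
  proof -
    define g where "g \<zeta> = f (x + \<zeta> *s v)" for \<zeta>
    have g: "(g has_field_derivative frechet_derivative f (at (x + \<zeta> *s v)) v) (at \<zeta>)"
      if "cmod \<zeta> \<le> \<rho>" for \<zeta>
    proof -
      have l: "bounded_linear (\<lambda>\<zeta>. \<zeta> *s v)"
        by (intro linear_conv_bounded_linear[THEN iffD1] linearI) (simp_all add: vec_eq_iff algebra_simps)
      have "((\<lambda>\<zeta>. x + \<zeta> *s v) has_derivative (\<lambda>h. h *s v)) (at \<zeta>)"
        using has_derivative_add[OF has_derivative_const bounded_linear_imp_has_derivative[OF l]] by simp
      from has_derivative_compose[OF this holo_fun_frechet(1)[OF f in_S[OF x that]]]
      show ?thesis
        unfolding has_field_derivative_def g_def holo_fun_frechet(2)[OF f in_S[OF x that]]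
        by (rule has_derivative_eq_rhs) (simp add: fun_eq_iff mult.commute)
    qed
    have "continuous_on (cball 0 \<rho>) g"
      using DERIV_isCont[OF g] by (auto intro: continuous_at_imp_continuous_on)
    moreover have "g holomorphic_on ball 0 \<rho>"
      unfolding holomorphic_on_open[OF open_ball] by (auto intro!: exI g)
    ultimately have "((\<lambda>u. g u / (u - 0) ^ Suc 1) has_contour_integral
        (2 * pi * \<i>) / fact 1 * (deriv ^^ 1) g 0) (circlepath 0 \<rho>)"
      using \<rho> by (intro Cauchy_has_contour_integral_higher_derivative_circlepath) auto
    moreover have "deriv g 0 = frechet_derivative f (at x) v"
      using DERIV_imp_deriv[OF g[of 0]] \<rho> by simp
    ultimately have "((\<lambda>t. g (\<rho> * cis t) / (\<rho> * cis t) ^ 2 * \<rho> * \<i> * cis t) has_integral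
        (2 * pi * \<i>) * frechet_derivative f (at x) v) {0..2 * pi}"
      unfolding circlepath_def by (simp add: has_contour_integral_part_circlepath_iff numeral_2_eq_2)
    note I = has_integral_mult_right[OF this, of "1 / (2 * pi * \<i>)"]
    have "((\<lambda>t. f (x + (of_real \<rho> * cis t) *s v) * k t) has_integral
        1 / (2 * pi * \<i>) * ((2 * pi * \<i>) * frechet_derivative f (at x) v)) {0..2 * pi}"
      by (rule has_integral_eq[OF _ I])
        (use \<rho> in \<open>simp add: g_def k_def power2_eq_square\<close>)
    then show ?thesis by (simp add: integral_unique)
  qed
  moreover have "continuous_on UNIV k"
    using \<rho> unfolding k_def by (auto intro!: continuous_intros)
  moreover have "x + (of_real \<rho> * cis t) *s v \<in> S" if "x \<in> ball x0 r" for x t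
    using in_S[OF that, of "of_real \<rho> * cis t"] \<rho> by (simp add: norm_mult)
  moreover have "r > 0" "ball x0 r \<subseteq> S" using R by (auto simp: r_def)
  ultimately show thesis using that by blast
qed

text \<open>Continuity comes first: it is what differentiation under the integral sign needs below.\<close>

lemma holo_fun_directional_continuous_on:
  "continuous_on S (\<lambda>x. frechet_derivative f (at x) v)"
proof (rule continuous_at_imp_continuous_on, rule ballI)
  fix x0 assume "x0 \<in> S"
  then obtain r \<rho> k where r: "r > 0" "ball x0 r \<subseteq> S" and k: "continuous_on UNIV k"
    and s: "\<And>x t. x \<in> ball x0 r \<Longrightarrow> x + (of_real \<rho> * cis t) *s v \<in> S"
    and e: "\<And>x. x \<in> ball x0 r \<Longrightarrow> frechet_derivative f (at x) v
      = integral (cbox 0 (2 * pi)) (\<lambda>t. f (x + (of_real \<rho> * cis t) *s v) * k t)"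
    by (rule holo_fun_Cauchy[where v = v]) blast
  have "continuous_on (ball x0 r \<times> cbox 0 (2 * pi)) (\<lambda>(x, t). f (x + (of_real \<rho> * cis t) *s v) * k t)"
    unfolding split_beta
    by (intro continuous_intros continuous_on_compose2[OF k]
        continuous_on_circle_shift[OF holo_fun_continuous_on, of "ball x0 r", unfolded split_beta] s) auto
  from integral_continuous_on_param[OF this]
  have "continuous_on (ball x0 r) (\<lambda>x. frechet_derivative f (at x) v)"
    by (rule continuous_on_cong[THEN iffD2, rotated -1]) (simp_all add: e)
  then show "isCont (\<lambda>x. frechet_derivative f (at x) v) x0"
    using r by (simp add: continuous_on_eq_continuous_at)
qed

text \<open>The Cauchy formula is differentiated under the integral sign. The integrand involves the
  derivative of \<open>f\<close> at the shifted points, and its complex linearity passes through the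
  integral, so directional derivatives stay in the class and can be iterated.\<close>

lemma holo_fun_directional: "holo_fun S (\<lambda>x. frechet_derivative f (at x) v)"
  unfolding holo_fun_def
proof (rule ballI)
  fix x0 assume "x0 \<in> S"
  then obtain r \<rho> k where r: "r > 0" "ball x0 r \<subseteq> S" and k: "continuous_on UNIV k"
    and s: "\<And>x t. x \<in> ball x0 r \<Longrightarrow> x + (of_real \<rho> * cis t) *s v \<in> S"
    and e: "\<And>x. x \<in> ball x0 r \<Longrightarrow> frechet_derivative f (at x) v
      = integral (cbox 0 (2 * pi)) (\<lambda>t. f (x + (of_real \<rho> * cis t) *s v) * k t)"
    by (rule holo_fun_Cauchy[where v = v]) blast
  define sh where "sh x t = x + (of_real \<rho> * cis t) *s v" for x t
  define fx where "fx x t = Blinfun (\<lambda>u. frechet_derivative f (at (sh x t)) u * k t)" for x t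
  have fx: "fx x t u = frechet_derivative f (at (sh x t)) u * k t" if "x \<in> ball x0 r" for x t u
    using holo_fun_frechet(1)[OF f s[OF that]] has_derivative_bounded_linear unfolding fx_def sh_def
    by (subst bounded_linear_Blinfun_apply) (auto intro: bounded_linear_mult_const)
  have x0: "x0 \<in> ball x0 r" using r by simp
  have cf: "continuous_on (ball x0 r \<times> T) (\<lambda>(x, t). f (sh x t) * k t)" for T
    unfolding split_beta sh_def
    by (intro continuous_intros continuous_on_compose2[OF k]
        continuous_on_circle_shift[OF holo_fun_continuous_on, of "ball x0 r", unfolded split_beta] s) auto
  have cfx: "continuous_on (ball x0 r \<times> cbox 0 (2 * pi)) (\<lambda>(x, t). fx x t)"
    unfolding split_beta
  proof (rule continuous_on_blinfun_componentwise)
    fix u :: "complex^'m"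
    have "continuous_on (ball x0 r \<times> cbox 0 (2 * pi))
        (\<lambda>p. frechet_derivative f (at (sh (fst p) (snd p))) u * k (snd p))"
      unfolding sh_def
      by (intro continuous_intros continuous_on_compose2[OF k]
          continuous_on_circle_shift[OF holo_fun_directional_continuous_on, of "ball x0 r", unfolded split_beta] s) auto
    then show "continuous_on (ball x0 r \<times> cbox 0 (2 * pi)) (\<lambda>p. fx (fst p) (snd p) u)"
      by (rule continuous_on_cong[THEN iffD2, rotated -1]) (auto simp: fx)
  qed
  have slice: "continuous_on T (h x)" if "continuous_on (ball x0 r \<times> T) (\<lambda>(x, t). h x t)" "x \<in> ball x0 r"
    for h :: "complex^'m \<Rightarrow> real \<Rightarrow> 'c::topological_space" and x T
  proof -
    have c: "continuous_on T (Pair x)" by (intro continuous_intros)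
    have "Pair x ` T \<subseteq> ball x0 r \<times> T" using that(2) by auto
    from continuous_on_compose2[OF that(1) c this] show ?thesis by simp
  qed
  have "((\<lambda>x. integral (cbox 0 (2 * pi)) (\<lambda>t. f (sh x t) * k t))
      has_derivative integral (cbox 0 (2 * pi)) (fx x0)) (at x0 within ball x0 r)"
  proof (rule leibniz_rule[OF _ _ cfx x0 convex_ball])
    fix x t assume x: "x \<in> ball x0 r"
    have "((\<lambda>x. sh x t) has_derivative (\<lambda>u. u)) (at x)"
      unfolding sh_def by (auto intro!: derivative_eq_intros)
    from has_derivative_mult_left[OF has_derivative_compose[OF this holo_fun_frechet(1)[OF f]]]
    have "((\<lambda>x. f (sh x t) * k t) has_derivative (\<lambda>u. frechet_derivative f (at (sh x t)) u * k t)) (at x)"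
      using s[OF x] by (simp add: sh_def)
    also have "(\<lambda>u. frechet_derivative f (at (sh x t)) u * k t) = blinfun_apply (fx x t)"
      by (simp add: fun_eq_iff fx[OF x])
    finally have "((\<lambda>x. f (sh x t) * k t) has_derivative fx x t) (at x)" .
    then show "((\<lambda>x. f (sh x t) * k t) has_derivative fx x t) (at x within ball x0 r)"
      by (rule has_derivative_at_withinI)
  next
    fix x assume "x \<in> ball x0 r"
    from slice[OF cf this] show "(\<lambda>t. f (sh x t) * k t) integrable_on cbox 0 (2 * pi)"
      by (rule integrable_continuous)
  qed
  then have d: "((\<lambda>x. integral (cbox 0 (2 * pi)) (\<lambda>t. f (sh x t) * k t))
      has_derivative integral (cbox 0 (2 * pi)) (fx x0)) (at x0)"
    using x0 by (simp add: at_within_open_NO_MATCH)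
  have "((\<lambda>x. frechet_derivative f (at x) v) has_derivative integral (cbox 0 (2 * pi)) (fx x0)) (at x0)"
    by (rule has_derivative_transform_within_open[OF d open_ball x0]) (simp add: e sh_def)
  moreover have "integral (cbox 0 (2 * pi)) (fx x0) (a *s u) = a * integral (cbox 0 (2 * pi)) (fx x0) u" for a u
  proof -
    have i: "fx x0 integrable_on cbox 0 (2 * pi)"
      by (rule integrable_continuous[OF slice[OF cfx x0]])
    have I: "((\<lambda>t. fx x0 t w) has_integral integral (cbox 0 (2 * pi)) (fx x0) w) (cbox 0 (2 * pi))" for w
      using has_integral_linear[OF integrable_integral[OF i] blinfun.bounded_linear_left[of w]]
      unfolding o_def .
    have "fx x0 t (a *s u) = a * fx x0 t u" for t
      using holo_fun_frechet(2)[OF f s[OF x0]] by (simp add: fx[OF x0] sh_def)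
    then show ?thesis
      using has_integral_unique[OF I[of "a *s u"]] has_integral_mult_right[OF I[of u], of a] by simp
  qed
  ultimately show "\<exists>L. ((\<lambda>x. frechet_derivative f (at x) v) has_derivative L) (at x0) \<and>
      (\<forall>a v. L (a *s v) = a * L v)" by blast
qed

end

lemma holo_fun_Ck_on:
  assumes "open S" shows "holo_fun S f \<Longrightarrow> Ck_on n f S"
proof (induction n arbitrary: f)
  case 0
  then show ?case using holo_fun_continuous_on[OF assms] by simp
next
  case (Suc n)
  show ?case unfolding Ck_on.simps
    by (rule exI[of _ "\<lambda>x. frechet_derivative f (at x)"])
      (use holo_fun_frechet(1)[OF Suc.prems] Suc.IH[OF holo_fun_directional[OF assms Suc.prems]] in blast)
qed

lemma Ck_on_vec:
  fixes f :: "'a::real_normed_vector \<Rightarrow> complex^'n"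
  shows "(\<And>k. Ck_on n (\<lambda>x. f x $ k) S) \<Longrightarrow> Ck_on n f S"
proof (induction n arbitrary: f)
  case 0
  then show ?case using continuous_on_vec_lambda[of S "\<lambda>k x. f x $ k"] by simp
next
  case (Suc n)
  from Suc.prems obtain L where
    L: "\<And>k x. x \<in> S \<Longrightarrow> ((\<lambda>x. f x $ k) has_derivative L k x) (at x)" "\<And>k v. Ck_on n (\<lambda>x. L k x v) S"
    unfolding Ck_on.simps by metis
  show ?case unfolding Ck_on.simps
    by (rule exI[of _ "\<lambda>x v. \<chi> k. L k x v"]) (auto intro!: has_derivative_vec_lambda Suc.IH L)
qed

text \<open>Needed for the flat frame: the gluing condition in \<open>chern_connection\<close> may
  only be applied to smooth vector fields.\<close>

lemma holo_vec_smooth_on: "open S \<Longrightarrow> holo_vec S f \<Longrightarrow> smooth_on S f"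
  unfolding smooth_on_def holo_vec_def by (auto intro!: Ck_on_vec holo_fun_Ck_on)

text \<open>Applied to a coordinate change, this shows that the columns of \<open>jac\<close> are
  holomorphic, hence that a holomorphic field in one chart is holomorphic in all others.\<close>

lemma holo_vec_directional:
  assumes "open S" "holo_vec S f" "\<And>x. x \<in> S \<Longrightarrow> (f has_derivative L x) (at x)"
  shows "holo_vec S (\<lambda>x. L x v)"
proof -
  have "holo_fun S (\<lambda>x. L x v $ k)" for k
  proof -
    have h: "holo_fun S (\<lambda>x. frechet_derivative (\<lambda>x. f x $ k) (at x) v)"
      using assms by (intro holo_fun_directional) (auto simp: holo_vec_def)
    have "frechet_derivative (\<lambda>x. f x $ k) (at x) v = L x v $ k" if "x \<in> S" for x
      using frechet_derivative_at[OF has_derivative_vec_nth[OF assms(3)[OF that], of k]] by metis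
    then show ?thesis
      using h assms(1) unfolding holo_fun_def
      by (metis (no_types, lifting) has_derivative_transform_within_open)
  qed
  then show ?thesis by (simp add: holo_vec_def)
qed

section \<open>Wirtinger derivatives of functions that are only real differentiable, and Cramer's
  rule\<close>

section \<open>Wirtinger calculus\<close>

lemma wirt_eq:
  assumes "(f has_derivative L) (at x)"
  shows "wirt j f x = (L (axis j 1) - \<i> * L (axis j \<i>)) / 2"
    and "wirt_bar j f x = (L (axis j 1) + \<i> * L (axis j \<i>)) / 2"
  unfolding wirt_def wirt_bar_def frechet_derivative_at[OF assms, symmetric] by simp_all

text \<open>The splitting of df into its (1,0) and (0,1) parts: real directions are expanded in the
  vectors \<open>axis j 1\<close> and \<open>axis j \<i>\<close> and regrouped. Two uses follow from
  it: functions with no Wirtinger derivatives are constant, and holomorphic matrices have complex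
  linear derivatives.\<close>

lemma has_derivative_wirt:
  fixes f :: "complex^'m::finite \<Rightarrow> complex"
  assumes "(f has_derivative L) (at x)"
  shows "L v = (\<Sum>j\<in>UNIV. v $ j * wirt j f x + cnj (v $ j) * wirt_bar j f x)"
proof -
  have lin: "linear L" using assms by (rule has_derivative_linear)
  have v: "v = (\<Sum>j\<in>UNIV. Re (v $ j) *\<^sub>R axis j 1 + Im (v $ j) *\<^sub>R axis j \<i>)"
  proof (rule vec_eq_iff[THEN iffD2], rule allI)
    fix i
    have "(\<Sum>j\<in>UNIV. Re (v $ j) *\<^sub>R axis j 1 + Im (v $ j) *\<^sub>R axis j \<i>) $ i
        = (\<Sum>j\<in>UNIV. if j = i then v $ j else 0)"
      unfolding sum_component by (rule sum.cong) (auto simp: axis_def complex_eq_iff)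
    then show "v $ i = (\<Sum>j\<in>UNIV. Re (v $ j) *\<^sub>R axis j 1 + Im (v $ j) *\<^sub>R axis j \<i>) $ i"
      by simp
  qed
  have "L v = (\<Sum>j\<in>UNIV. of_real (Re (v $ j)) * L (axis j 1) + of_real (Im (v $ j)) * L (axis j \<i>))"
    by (subst v, unfold linear_sum[OF lin] linear_add[OF lin] linear_scale[OF lin])
      (simp add: scaleR_conv_of_real[where 'a = complex])
  also have "\<dots> = (\<Sum>j\<in>UNIV. v $ j * wirt j f x + cnj (v $ j) * wirt_bar j f x)"
  proof (rule sum.cong[OF refl])
    fix j
    obtain a b where ab: "v $ j = Complex a b" by (cases "v $ j")
    show "of_real (Re (v $ j)) * L (axis j 1) + of_real (Im (v $ j)) * L (axis j \<i>)
        = v $ j * wirt j f x + cnj (v $ j) * wirt_bar j f x"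
      unfolding wirt_eq[OF assms] ab by (simp add: Complex_eq field_simps)
  qed
  finally show ?thesis .
qed

lemma wirt_const [simp]: "wirt j (\<lambda>_. c) x = 0" "wirt_bar j (\<lambda>_. c) x = 0"
  by (simp_all add: wirt_eq[OF has_derivative_const])

lemma wirt_vec_const [simp]: "wirt_vec j (\<lambda>_. c) = (\<lambda>_. 0)" "wirt_bar_vec j (\<lambda>_. c) = (\<lambda>_. 0)"
  by (simp_all add: wirt_vec_def wirt_bar_vec_def vec_eq_iff fun_eq_iff)

lemma wirt_cong:
  assumes "f differentiable at x" "open S" "x \<in> S" "\<And>y. y \<in> S \<Longrightarrow> f y = g y"
  shows "wirt j f x = wirt j g x" "wirt_bar j f x = wirt_bar j g x"
  using frechet_derivative_transform_within_open[OF assms] by (simp_all add: wirt_def wirt_bar_def)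

lemma differentiable_cong_open:
  assumes "f differentiable at x" "open S" "x \<in> S" "\<And>y. y \<in> S \<Longrightarrow> f y = g y"
  shows "g differentiable at x"
  using assms has_derivative_transform_within_open unfolding differentiable_def by metis

context
  fixes f g :: "complex^'m::finite \<Rightarrow> complex" and x
  assumes f: "f differentiable at x" and g: "g differentiable at x"
begin

lemma wirt_add:
  "wirt j (\<lambda>x. f x + g x) x = wirt j f x + wirt j g x"
  "wirt_bar j (\<lambda>x. f x + g x) x = wirt_bar j f x + wirt_bar j g x"
  unfolding wirt_eq[OF has_derivative_add[OF f[unfolded frechet_derivative_works] g[unfolded frechet_derivative_works]]]
  by (simp_all add: wirt_def wirt_bar_def field_simps)

lemma wirt_mult:
  "wirt j (\<lambda>x. f x * g x) x = wirt j f x * g x + f x * wirt j g x"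
  "wirt_bar j (\<lambda>x. f x * g x) x = wirt_bar j f x * g x + f x * wirt_bar j g x"
  unfolding wirt_eq[OF has_derivative_mult[OF f[unfolded frechet_derivative_works] g[unfolded frechet_derivative_works]]]
  by (simp_all add: wirt_def wirt_bar_def field_simps)

end

lemma
  fixes f :: "complex^'m::finite \<Rightarrow> complex"
  assumes f: "f differentiable at x"
  shows wirt_cnj: "wirt j (\<lambda>x. cnj (f x)) x = cnj (wirt_bar j f x)"
    and differentiable_cnj: "(\<lambda>x. cnj (f x)) differentiable at x"
proof -
  note L = bounded_linear.has_derivative[OF bounded_linear_cnj f[unfolded frechet_derivative_works]]
  show "wirt j (\<lambda>x. cnj (f x)) x = cnj (wirt_bar j f x)"
    unfolding wirt_eq[OF L] by (simp add: wirt_bar_def)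
  show "(\<lambda>x. cnj (f x)) differentiable at x"
    using L unfolding differentiable_def by blast
qed

lemma wirt_sum:
  fixes f :: "'a \<Rightarrow> complex^'m::finite \<Rightarrow> complex"
  assumes "finite A" "\<And>k. k \<in> A \<Longrightarrow> f k differentiable at x"
  shows "wirt j (\<lambda>x. \<Sum>k\<in>A. f k x) x = (\<Sum>k\<in>A. wirt j (f k) x)"
    "wirt_bar j (\<lambda>x. \<Sum>k\<in>A. f k x) x = (\<Sum>k\<in>A. wirt_bar j (f k) x)"
  using assms by (induction A rule: finite_induct) (simp_all add: wirt_add differentiable_sum)

lemma wirt_zero_constant:
  fixes f :: "complex^'m::finite \<Rightarrow> complex"
  assumes f: "\<And>x. x \<in> ball p r \<Longrightarrow> f differentiable at x"
    and "\<And>x j. x \<in> ball p r \<Longrightarrow> wirt j f x = 0" "\<And>x j. x \<in> ball p r \<Longrightarrow> wirt_bar j f x = 0"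
    and z: "z \<in> ball p r"
  shows "f z = f p"
proof -
  have "(f has_derivative (\<lambda>h. 0)) (at x within ball p r)" if x: "x \<in> ball p r" for x
  proof -
    obtain L where L: "(f has_derivative L) (at x)" using f[OF x] by (auto simp: differentiable_def)
    have "L = (\<lambda>h. 0)" using has_derivative_wirt[OF L] assms(2,3)[OF x] by auto
    then show ?thesis using L has_derivative_at_withinI by blast
  qed
  from has_derivative_zero_constant[OF convex_ball this] obtain c where "\<And>x. x \<in> ball p r \<Longrightarrow> f x = c"
    by blast
  moreover have "p \<in> ball p r" using z by (metis centre_in_ball empty_iff ball_empty not_le)
  ultimately show ?thesis using z by simp
qed

lemma differentiable_vec_iff:
  fixes f :: "'a::real_normed_vector \<Rightarrow> complex^'n"
  shows "f differentiable at x \<longleftrightarrow> (\<forall>k. (\<lambda>x. f x $ k) differentiable at x)"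
proof
  assume "\<forall>k. (\<lambda>x. f x $ k) differentiable at x"
  then obtain L where "\<And>k. ((\<lambda>x. f x $ k) has_derivative L k) (at x)"
    unfolding differentiable_def by metis
  from has_derivative_vec_lambda[OF this] show "f differentiable at x"
    unfolding differentiable_def by blast
qed (auto simp: differentiable_def intro: has_derivative_vec_nth)

lemma differentiable_mat_nth:
  fixes M :: "'a::real_normed_vector \<Rightarrow> complex^'n^'l"
  shows "M differentiable at x \<Longrightarrow> (\<lambda>x. M x $ k $ l) differentiable at x"
  unfolding differentiable_def by (blast dest: has_derivative_vec_nth)

lemma differentiable_matrix_vector_mult:
  fixes M :: "complex^'m::finite \<Rightarrow> complex^'n^'l"
  assumes "\<And>k l. (\<lambda>x. M x $ k $ l) differentiable at x" "s differentiable at x"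
  shows "(\<lambda>x. M x *v s x) differentiable at x"
  using assms unfolding differentiable_vec_iff
  by (auto simp: matrix_vector_mult_def intro!: differentiable_sum differentiable_mult)

lemma wirt_vec_matrix_vector_mult:
  fixes M :: "complex^'m::finite \<Rightarrow> complex^'n^'l"
  assumes M: "\<And>k l. (\<lambda>x. M x $ k $ l) differentiable at x" and s: "s differentiable at x"
  shows "wirt_vec j (\<lambda>x. M x *v s x) x = wirt_vec j (\<lambda>y. M y *v s x) x + M x *v wirt_vec j s x"
    "wirt_bar_vec j (\<lambda>x. M x *v s x) x = wirt_bar_vec j (\<lambda>y. M y *v s x) x + M x *v wirt_bar_vec j s x"
  using M s unfolding differentiable_vec_iff
  by (simp_all add: wirt_vec_def wirt_bar_vec_def vec_eq_iff matrix_vector_mult_def wirt_sum wirt_mult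
      differentiable_mult sum.distrib)

lemma wirt_vec_add:
  fixes s t :: "complex^'m::finite \<Rightarrow> complex^'n"
  assumes "s differentiable at x" "t differentiable at x"
  shows "wirt_vec j (\<lambda>x. s x + t x) x = wirt_vec j s x + wirt_vec j t x"
    "wirt_bar_vec j (\<lambda>x. s x + t x) x = wirt_bar_vec j s x + wirt_bar_vec j t x"
  using assms unfolding differentiable_vec_iff
  by (simp_all add: wirt_vec_def wirt_bar_vec_def vec_eq_iff wirt_add)

lemma wirt_vec_cong:
  fixes s t :: "complex^'m::finite \<Rightarrow> complex^'n"
  assumes "s differentiable at x" "open S" "x \<in> S" "\<And>y. y \<in> S \<Longrightarrow> s y = t y"
  shows "wirt_vec j s x = wirt_vec j t x" "wirt_bar_vec j s x = wirt_bar_vec j t x"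
  using assms wirt_cong[of "\<lambda>y. s y $ k" x S "\<lambda>y. t y $ k" for k] unfolding differentiable_vec_iff
  by (simp_all add: wirt_vec_def wirt_bar_vec_def vec_eq_iff)

lemma holo_wirt_vec:
  fixes s :: "complex^'m::finite \<Rightarrow> complex^'n"
  assumes "(s has_derivative (\<lambda>v. J *v v)) (at x)"
  shows "wirt_vec j s x = J *v axis j 1" "wirt_bar_vec j s x = 0"
proof -
  have "axis j \<i> = \<i> *s axis j 1" by (simp add: vec_eq_iff axis_def)
  then have J: "J *v axis j \<i> = \<i> *s (J *v axis j 1)" by (simp add: vector_scalar_commute)
  show "wirt_vec j s x = J *v axis j 1" "wirt_bar_vec j s x = 0"
    unfolding wirt_vec_def wirt_bar_vec_def vec_eq_iff wirt_eq[OF has_derivative_vec_nth[OF assms]] J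
    by simp_all
qed

lemma differentiable_det:
  fixes M :: "'a::real_normed_vector \<Rightarrow> complex^'n^'n::finite"
  assumes "\<And>k l. (\<lambda>x. M x $ k $ l) differentiable at x"
  shows "(\<lambda>x. det (M x)) differentiable at x"
proof -
  have prod: "(\<lambda>x. \<Prod>i\<in>A. M x $ i $ q i) differentiable at x" if "finite A" for A q
    using that by (induction A rule: finite_induct) (simp_all add: assms differentiable_mult)
  then show ?thesis
    unfolding det_def by (intro differentiable_sum differentiable_mult differentiable_const prod) auto
qed

text \<open>No regularity of \<open>s\<close> is presupposed: near \<open>x\<close> it coincides
  with Cramer's quotient of determinants and inherits differentiability from the
  coefficients.\<close>

lemma differentiable_cramer:
  fixes M :: "'a::real_normed_vector \<Rightarrow> complex^'n^'n::finite"
  assumes M: "\<And>k l. (\<lambda>x. M x $ k $ l) differentiable at x" and b: "\<And>k. (\<lambda>x. b x $ k) differentiable at x"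
    and S: "open S" "x \<in> S" "\<And>y. y \<in> S \<Longrightarrow> det (M y) \<noteq> 0" "\<And>y. y \<in> S \<Longrightarrow> M y *v s y = b y"
  shows "s differentiable at x"
proof -
  let ?c = "\<lambda>y. \<chi> k. det (\<chi> i j. if j = k then b y $ i else M y $ i $ j) / det (M y)"
  have d: "(\<lambda>y. det (\<chi> i j. if j = k then b y $ i else M y $ i $ j)) differentiable at x" for k
  proof (rule differentiable_det)
    fix i j
    show "(\<lambda>y. (\<chi> i j. if j = k then b y $ i else M y $ i $ j) $ i $ j) differentiable at x"
      using M[of i j] b[of i] by (cases "j = k") simp_all
  qed
  have "?c differentiable at x"
    unfolding differentiable_vec_iff vec_lambda_beta
  proof
    fix k
    show "(\<lambda>y. det (\<chi> i j. if j = k then b y $ i else M y $ i $ j) / det (M y)) differentiable at x"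
      by (rule differentiable_divide[OF d differentiable_det[OF M] S(3)[OF S(2)]])
  qed
  then show ?thesis
  proof (rule differentiable_cong_open[OF _ S(1,2)])
    fix y assume y: "y \<in> S"
    show "?c y = s y" using cramer[OF S(3)[OF y], of "s y" "b y"] S(4)[OF y] by simp
  qed
qed

section \<open>In one chart: normality of the Higgs field and its vanishing\<close>

section \<open>Vanishing of the Higgs field\<close>

lemma smooth_on_const: "smooth_on S (\<lambda>_. c)"
proof -
  have "Ck_on n (\<lambda>_. c :: 'b::real_normed_vector) S" for n :: nat and c and S :: "'a::real_normed_vector set"
  proof (induction n arbitrary: c)
    case (Suc n)
    then show ?case by (auto intro!: exI[of _ "\<lambda>_ _. 0"])
  qed simp
  then show ?thesis by (simp add: smooth_on_def)
qed

lemma smooth_on_derivative: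
  assumes "smooth_on S f"
  obtains f' where "\<And>x. x \<in> S \<Longrightarrow> (f has_derivative f' x) (at x)" "\<And>v. continuous_on S (\<lambda>x. f' x v)"
proof -
  have "Ck_on (Suc 0) f S" using assms by (simp add: smooth_on_def del: Ck_on.simps)
  then show thesis using that by auto
qed

lemma smooth_on_differentiable: "smooth_on S f \<Longrightarrow> x \<in> S \<Longrightarrow> f differentiable at x"
  by (metis smooth_on_derivative differentiable_def)

text \<open>The data in one chart, free of the manifold. The endomorphism \<U> no longer occurs: its
  equation, combined with D'(\<U>) = 0, has become \<open>commutator\<close>.\<close>

locale higgs_chart =
  fixes S :: "(complex^'m::finite) set" and g :: "complex^'m \<Rightarrow> complex^'m \<Rightarrow> complex^'m \<Rightarrow> complex"
    and \<theta> \<Phi> :: "'m \<Rightarrow> complex^'m \<Rightarrow> complex^'m^'m" and Q :: "complex^'m \<Rightarrow> complex^'m^'m"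
  assumes open_S: "open S" and herm: "z \<in> S \<Longrightarrow> herm_inner (g z)"
    and smooth_g: "smooth_on S (\<lambda>z. g z u v)"
    and smooth_\<theta>: "smooth_on S (\<theta> i)" and smooth_Q: "smooth_on S Q"
    and compat: "\<lbrakk>open W; W \<subseteq> S; smooth_on W s; smooth_on W t; z \<in> W\<rbrakk> \<Longrightarrow>
      wirt i (\<lambda>x. g x (s x) (t x)) z = g z (Dprime \<theta> i s z) (t z) + g z (s z) (wirt_bar_vec i t z)"
    and holomorphic_D: "vanishes_on S (comm (Dprime \<theta> i) (wirt_bar_vec j))"
    and holo_\<Phi>: "holo_mat S (\<Phi> i)"
    and flat: "flat_on S (\<lambda>i s z. Dprime \<theta> i s z + \<Phi> i z *v s z)
      (\<lambda>i s z. wirt_bar_vec i s z + herm_adj (g z) (\<Phi> i z) *v s z)"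
    and commutator: "z \<in> S \<Longrightarrow> \<Phi> i z ** Q z - Q z ** \<Phi> i z = \<Phi> i z"
    and Q_self_adjoint: "z \<in> S \<Longrightarrow> herm_adj (g z) (Q z) = Q z"
begin

text \<open>Operator identities are stated for all smooth sections on open subsets. Constant
  sections on all of \<open>S\<close> already reveal the matrix identities at each point, because
  derivatives of the section drop out.\<close>

lemma vanishes_const:
  "vanishes_on S P \<Longrightarrow> z \<in> S \<Longrightarrow> P (\<lambda>_. u) z = 0"
  unfolding vanishes_on_def using open_S smooth_on_const by blast

lemma differentiable_\<theta>: "z \<in> S \<Longrightarrow> (\<lambda>x. \<theta> i x $ k $ l) differentiable at z"
  by (intro differentiable_mat_nth smooth_on_differentiable[OF smooth_\<theta>])

lemma differentiable_Q: "z \<in> S \<Longrightarrow> (\<lambda>x. Q x $ k $ l) differentiable at z"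
  by (intro differentiable_mat_nth smooth_on_differentiable[OF smooth_Q])

lemma differentiable_\<Phi>: "z \<in> S \<Longrightarrow> (\<lambda>x. \<Phi> i x $ k $ l) differentiable at z"
  using holo_\<Phi>[of i] unfolding holo_mat_def holo_fun_def differentiable_def by blast

lemma differentiable_g: "z \<in> S \<Longrightarrow> (\<lambda>x. g x u v) differentiable at z"
  by (rule smooth_on_differentiable[OF smooth_g])

text \<open>On a constant section the commutator of D' with \<partial>bar reduces to the
  \<partial>bar derivative of \<open>\<theta> i x *v u\<close> up to sign: holomorphy of D' means
  holomorphic connection matrices in the coordinate frame.\<close>

lemma wirt_bar_\<theta>: "z \<in> S \<Longrightarrow> wirt_bar_vec j (\<lambda>x. \<theta> i x *v u) z = 0"
  using vanishes_const[OF holomorphic_D, of z i j u]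
  by (simp add: comm_def Dprime_def)

lemma wirt_bar_\<Phi>: 
  assumes z: "z \<in> S" shows "wirt_bar_vec j (\<lambda>x. \<Phi> i x *v u) z = 0"
proof -
  have "holo_vec S (\<lambda>x. \<Phi> i x *v u)"
  proof -
    have "(\<lambda>x. (\<Phi> i x *v u) $ k) = (\<lambda>x. \<Sum>l\<in>UNIV. \<Phi> i x $ k $ l * u $ l)" for k
      by (simp add: matrix_vector_mult_def)
    moreover have "holo_fun S (\<lambda>x. \<Sum>l\<in>UNIV. \<Phi> i x $ k $ l * u $ l)" for k
      unfolding holo_fun_def
    proof
      fix x assume x: "x \<in> S"
      have "\<forall>l. \<exists>L. ((\<lambda>x. \<Phi> i x $ k $ l) has_derivative L) (at x) \<and> (\<forall>a v. L (a *s v) = a * L v)"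
        using holo_\<Phi>[of i] x unfolding holo_mat_def holo_fun_def by blast
      then obtain L where L: "\<And>l. ((\<lambda>x. \<Phi> i x $ k $ l) has_derivative L l) (at x)"
        "\<And>l a v. L l (a *s v) = a * L l v" by metis
      have "((\<lambda>x. \<Sum>l\<in>UNIV. \<Phi> i x $ k $ l * u $ l) has_derivative (\<lambda>v. \<Sum>l\<in>UNIV. L l v * u $ l)) (at x)"
        by (intro has_derivative_sum has_derivative_mult_left L)
      then show "\<exists>L. ((\<lambda>x. \<Sum>l\<in>UNIV. \<Phi> i x $ k $ l * u $ l) has_derivative L) (at x) \<and>
          (\<forall>a v. L (a *s v) = a * L v)"
        by (rule_tac x="\<lambda>v. \<Sum>l\<in>UNIV. L l v * u $ l" in exI) (simp add: L sum_distrib_left mult.assoc)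
    qed
    ultimately show ?thesis by (simp add: holo_vec_def)
  qed
  then show ?thesis using z holo_wirt_vec(2) unfolding holo_vec_iff by metis
qed

lemma wirt_g: "z \<in> S \<Longrightarrow> wirt i (\<lambda>x. g x u v) z = g z (\<theta> i z *v u) v"
  using compat[OF open_S order_refl smooth_on_const[of S u] smooth_on_const[of S v]]
  by (simp add: Dprime_def herm_zero_right[OF herm])

text \<open>\<open>compat\<close> is postulated for smooth sections, whereas sections built from
  \<Phi>\<dagger> are only known to be differentiable. Expanding in the Gram matrix and using
  \<open>compat\<close> just for constant basis sections extends the Leibniz rule to sections
  differentiable at the point \<open>z\<close>.\<close>

lemma g_section:
  assumes z: "z \<in> S" and s: "s differentiable at z" and t: "t differentiable at z"
  shows differentiable_g_section: "(\<lambda>x. g x (s x) (t x)) differentiable at z"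
    and wirt_g_section: "wirt i (\<lambda>x. g x (s x) (t x)) z
      = g z (Dprime \<theta> i s z) (t z) + g z (s z) (wirt_bar_vec i t z)"
proof -
  let ?a = "\<lambda>k. axis k (1::complex)"
  let ?f = "\<lambda>x. \<Sum>k\<in>UNIV. \<Sum>l\<in>UNIV. s x $ k * cnj (t x $ l) * g x (?a k) (?a l)"
  have sk: "(\<lambda>x. s x $ k) differentiable at z" and tk: "(\<lambda>x. t x $ k) differentiable at z" for k
    using s t unfolding differentiable_vec_iff by auto
  note ct = differentiable_cnj[OF tk]
  note st = differentiable_mult[OF sk ct]
  note stg = differentiable_mult[OF st differentiable_g[OF z]]
  have inner: "(\<lambda>x. \<Sum>l\<in>UNIV. s x $ k * cnj (t x $ l) * g x (?a k) (?a l)) differentiable at z" for k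
    by (rule differentiable_sum) (simp_all add: stg)
  have f: "?f differentiable at z" by (rule differentiable_sum) (simp_all add: inner)
  have eq: "?f x = g x (s x) (t x)" if "x \<in> S" for x
    by (rule herm_expand[OF herm[OF that], symmetric])
  show "(\<lambda>x. g x (s x) (t x)) differentiable at z"
    by (rule differentiable_cong_open[OF f open_S z eq])
  have w: "wirt i (\<lambda>x. s x $ k * cnj (t x $ l) * g x (?a k) (?a l)) z =
      wirt i (\<lambda>x. s x $ k) z * cnj (t z $ l) * g z (?a k) (?a l)
      + s z $ k * cnj (wirt_bar i (\<lambda>x. t x $ l) z) * g z (?a k) (?a l)
      + s z $ k * cnj (t z $ l) * g z (\<theta> i z *v ?a k) (?a l)" for k l
    unfolding wirt_mult(1)[OF st differentiable_g[OF z]] wirt_mult(1)[OF sk ct] wirt_cnj[OF tk] wirt_g[OF z]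
    by (simp add: algebra_simps)
  have "wirt i (\<lambda>x. g x (s x) (t x)) z = wirt i ?f z"
    by (rule wirt_cong(1)[OF f open_S z eq, symmetric])
  also have "\<dots> = (\<Sum>k\<in>UNIV. \<Sum>l\<in>UNIV. wirt i (\<lambda>x. s x $ k * cnj (t x $ l) * g x (?a k) (?a l)) z)"
    by (simp add: wirt_sum inner stg)
  also have "\<dots> = g z (wirt_vec i s z) (t z) + g z (s z) (wirt_bar_vec i t z)
      + (\<Sum>k\<in>UNIV. \<Sum>l\<in>UNIV. s z $ k * cnj (t z $ l) * g z (\<theta> i z *v ?a k) (?a l))"
    unfolding w sum.distrib herm_expand[OF herm[OF z], of "wirt_vec i s z" "t z"]
      herm_expand[OF herm[OF z], of "s z" "wirt_bar_vec i t z"]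
    by (simp add: wirt_vec_def wirt_bar_vec_def)
  also have "(\<Sum>k\<in>UNIV. \<Sum>l\<in>UNIV. s z $ k * cnj (t z $ l) * g z (\<theta> i z *v ?a k) (?a l)) = g z (\<theta> i z *v s z) (t z)"
  proof -
    have "\<theta> i z *v s z = \<theta> i z *v (\<Sum>k\<in>UNIV. s z $ k *s ?a k)" by (simp only: basis_expansion)
    also have "\<dots> = (\<Sum>k\<in>UNIV. s z $ k *s (\<theta> i z *v ?a k))"
      by (simp add: vec.linear_sum[OF matrix_vector_mul_linear_gen] vector_scalar_commute del: basis_expansion)
    finally have 1: "\<theta> i z *v s z = (\<Sum>k\<in>UNIV. s z $ k *s (\<theta> i z *v ?a k))" .
    have "t z = (\<Sum>l\<in>UNIV. t z $ l *s ?a l)" by (simp only: basis_expansion)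
    then have "g z (\<theta> i z *v s z) (t z)
        = g z (\<Sum>k\<in>UNIV. s z $ k *s (\<theta> i z *v ?a k)) (\<Sum>l\<in>UNIV. t z $ l *s ?a l)"
      unfolding 1 by metis
    then show ?thesis
      unfolding herm_sum_left[OF herm[OF z]] herm_scale_left[OF herm[OF z]] herm_sum_right[OF herm[OF z]]
        herm_scale_right[OF herm[OF z]] by (subst sum.swap) (simp add: sum_distrib_left mult_ac)
  qed
  finally show "wirt i (\<lambda>x. g x (s x) (t x)) z
      = g z (Dprime \<theta> i s z) (t z) + g z (s z) (wirt_bar_vec i t z)"
    by (simp add: Dprime_def herm_add_left[OF herm[OF z]])
qed

text \<open>The adjoint is only given by a definite description, so its regularity is read off from
  Cramer's rule for the Gram matrix.\<close>

lemma differentiable_adjoint_section: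
  assumes z: "z \<in> S"
  shows "(\<lambda>x. herm_adj (g x) (\<Phi> j x) *v u) differentiable at z"
proof -
  let ?G = "\<lambda>x. \<chi> l k. g x (axis k 1) (axis l 1)"
  \<comment> \<open>Pairing the adjoint section with a basis vector moves \<Phi> to the other slot,
    so the right-hand side of the linear system contains no adjoint.\<close>
  let ?b = "\<lambda>x. \<chi> l. g x u (\<Phi> j x *v axis l 1)"
  show ?thesis
  proof (rule differentiable_cramer[of ?G z ?b S, OF _ _ open_S z])
    show "(\<lambda>x. ?G x $ k $ l) differentiable at z" for k l
      by (simp add: differentiable_g[OF z])
    show "(\<lambda>x. ?b x $ k) differentiable at z" for k
      using differentiable_g_section[OF z differentiable_const
          differentiable_matrix_vector_mult[OF differentiable_\<Phi>[OF z] differentiable_const], of u j "axis k 1"]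
      by simp
    fix y assume y: "y \<in> S"
    have G: "(?G y *v v) $ l = g y v (axis l 1)" for v l
    proof -
      have "g y v (axis l 1) = g y (\<Sum>k\<in>UNIV. v $ k *s axis k 1) (axis l 1)" by (simp only: basis_expansion)
      then show ?thesis
        unfolding herm_sum_left[OF herm[OF y]] herm_scale_left[OF herm[OF y]]
        by (simp add: matrix_vector_mult_def mult.commute)
    qed
    have "v = 0" if "?G y *v v = 0" for v
    proof -
      have 0: "g y v (axis l 1) = 0" for l using G[of v l] that by simp
      have "g y v v = g y v (\<Sum>k\<in>UNIV. v $ k *s axis k 1)" by (simp only: basis_expansion)
      also have "\<dots> = 0"
        unfolding herm_sum_right[OF herm[OF y]] herm_scale_right[OF herm[OF y]] 0 by simp
      finally show ?thesis by (simp add: herm_eq_0[OF herm[OF y]])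
    qed
    then show "det (?G y) \<noteq> 0"
      unfolding invertible_det_nz[symmetric] invertible_left_inverse matrix_left_invertible_ker by blast
    show "?G y *v (herm_adj (g y) (\<Phi> j y) *v u) = ?b y"
    proof (rule vec_eq_iff[THEN iffD2], rule allI)
      fix l
      have "g y (herm_adj (g y) (\<Phi> j y) *v u) (axis l 1) = cnj (g y (axis l 1) (herm_adj (g y) (\<Phi> j y) *v u))"
        by (rule herm_sym[OF herm[OF y]])
      also have "\<dots> = g y u (\<Phi> j y *v axis l 1)"
        unfolding herm_adj[OF herm[OF y], symmetric] by (rule herm_sym[OF herm[OF y], symmetric])
      finally show "(?G y *v (herm_adj (g y) (\<Phi> j y) *v u)) $ l = ?b y $ l"
        unfolding G by simp
    qed
  qed
qed

lemma adjoint_swap: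
  "z \<in> S \<Longrightarrow> g z (herm_adj (g z) P *v u) v = g z u (P *v v)"
  using herm_adj[OF herm, of z P v u] herm_sym[OF herm] by metis

text \<open>This is the adjoint of \<partial>bar \<Phi> = 0: on constant sections D' commutes with
  \<Phi>\<dagger>. Differentiating \<open>g x u (\<Phi> j x *v t)\<close> produces no derivative of
  \<Phi>, since only \<partial>bar falls on the conjugate linear slot.\<close>

lemma Dprime_adjoint_section:
  assumes z: "z \<in> S"
  shows "Dprime \<theta> i (\<lambda>x. herm_adj (g x) (\<Phi> j x) *v u) z = herm_adj (g z) (\<Phi> j z) *v (\<theta> i z *v u)"
proof (rule herm_ext[OF herm[OF z]])
  fix t
  let ?s = "\<lambda>x. herm_adj (g x) (\<Phi> j x) *v u"
  have dt: "(\<lambda>x. \<Phi> j x *v t) differentiable at z"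
    by (rule differentiable_matrix_vector_mult[OF differentiable_\<Phi>[OF z] differentiable_const])
  note ds = differentiable_adjoint_section[OF z]
  have "g z (Dprime \<theta> i ?s z) t = wirt i (\<lambda>x. g x (?s x) t) z"
    using wirt_g_section[OF z ds differentiable_const, of i j u t] by (simp add: herm_zero_right[OF herm[OF z]])
  also have "\<dots> = wirt i (\<lambda>x. g x u (\<Phi> j x *v t)) z"
    by (rule wirt_cong(1)[OF differentiable_g_section[OF z ds differentiable_const] open_S z adjoint_swap])
  also have "\<dots> = g z (Dprime \<theta> i (\<lambda>_. u) z) (\<Phi> j z *v t) + g z u (wirt_bar_vec i (\<lambda>x. \<Phi> j x *v t) z)"
    by (rule wirt_g_section[OF z differentiable_const dt])
  also have "\<dots> = g z (\<theta> i z *v u) (\<Phi> j z *v t)"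
    unfolding wirt_bar_\<Phi>[OF z] by (simp add: Dprime_def herm_zero_right[OF herm[OF z]])
  also have "\<dots> = g z (herm_adj (g z) (\<Phi> j z) *v (\<theta> i z *v u)) t"
    by (rule adjoint_swap[OF z, symmetric])
  finally show "g z (Dprime \<theta> i ?s z) t = g z (herm_adj (g z) (\<Phi> j z) *v (\<theta> i z *v u)) t" .
qed

text \<open>In the mixed part of flatness, applied to a constant section, the \<partial>bar
  derivatives of \<theta> and \<Phi> vanish, and the D' derivative of \<Phi>\<dagger> cancels
  against the term with \<theta>. Only the pointwise commutator is left.\<close>

lemma higgs_normal:
  assumes z: "z \<in> S"
  shows "\<Phi> i z ** herm_adj (g z) (\<Phi> j z) = herm_adj (g z) (\<Phi> j z) ** \<Phi> i z"
proof -
  let ?\<Psi> = "\<lambda>x. herm_adj (g x) (\<Phi> j x)"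
  have "\<Phi> i z *v (?\<Psi> z *v u) = ?\<Psi> z *v (\<Phi> i z *v u)" for u
  proof -
    have "vanishes_on S (comm (\<lambda>s z. Dprime \<theta> i s z + \<Phi> i z *v s z) (\<lambda>s z. wirt_bar_vec j s z + ?\<Psi> z *v s z))"
      using flat unfolding flat_on_def by blast
    from vanishes_const[OF this z, of u]
    have "Dprime \<theta> i (\<lambda>x. ?\<Psi> x *v u) z + \<Phi> i z *v (?\<Psi> z *v u) =
      wirt_bar_vec j (\<lambda>x. \<theta> i x *v u + \<Phi> i x *v u) z + ?\<Psi> z *v (\<theta> i z *v u + \<Phi> i z *v u)"
      by (simp add: comm_def Dprime_def)
    moreover have "wirt_bar_vec j (\<lambda>x. \<theta> i x *v u + \<Phi> i x *v u) z = 0"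
      using wirt_vec_add(2)[OF differentiable_matrix_vector_mult[OF differentiable_\<theta>[OF z] differentiable_const]
          differentiable_matrix_vector_mult[OF differentiable_\<Phi>[OF z] differentiable_const]]
      by (simp add: wirt_bar_\<theta>[OF z] wirt_bar_\<Phi>[OF z])
    ultimately show ?thesis
      by (simp add: Dprime_adjoint_section[OF z] matrix_vector_right_distrib)
  qed
  then show ?thesis by (simp add: matrix_eq matrix_vector_mul_assoc[symmetric])
qed

lemma higgs_zero: "z \<in> S \<Longrightarrow> \<Phi> i z = 0"
  by (rule normal_commutator_eq_0[OF herm higgs_normal commutator])

end

section \<open>In one chart: solving D'e = 0 with an eigenbasis as initial value\<close>

section \<open>Flat eigenframes in a chart\<close>

text \<open>One summand of the coefficient of the system for flat sections, the form dz_i tensored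
  with \<open>- M\<close>, as a real bounded linear map. It is linear in \<open>M\<close>, so
  derivatives and continuity of the connection matrices carry over to the coefficient.\<close>

definition conn_op :: "'m::finite \<Rightarrow> complex^'m^'m \<Rightarrow> (complex^'m) \<Rightarrow>\<^sub>L (complex^'m) \<Rightarrow>\<^sub>L (complex^'m)" where
  "conn_op i M = Blinfun (\<lambda>v. Blinfun (\<lambda>u. - (v $ i *s (M *v u))))"

lemma conn_op_apply:
  fixes i :: "'m::finite"
  shows "conn_op i M v u = - (v $ i *s (M *v u))"
proof -
  have "linear (\<lambda>u. - (v $ i *s (M *v u)))" for v :: "complex^'m"
    by (rule linearI)
      (simp_all add: vec_eq_iff matrix_vector_mult_def scaleR_conv_of_real[where 'a = complex]
        sum_distrib_left sum.distrib algebra_simps)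
  then have 1: "blinfun_apply (Blinfun (\<lambda>u. - (v $ i *s (M *v u)))) = (\<lambda>u. - (v $ i *s (M *v u)))" for v
    by (simp add: bounded_linear_Blinfun_apply linear_conv_bounded_linear)
  have "linear (\<lambda>v. Blinfun (\<lambda>u. - (v $ i *s (M *v u))))"
    by (rule linearI; rule blinfun_eqI)
      (simp_all only: 1 blinfun.add_left blinfun.scaleR_left,
        simp_all add: vec_eq_iff scaleR_conv_of_real[where 'a = complex] algebra_simps)
  then show ?thesis
    unfolding conn_op_def by (simp add: bounded_linear_Blinfun_apply linear_conv_bounded_linear 1)
qed

lemma bounded_linear_conn_op: "bounded_linear (conn_op i)"
proof -
  have "linear (conn_op i)"
    by (rule linearI; rule blinfun_eqI; rule blinfun_eqI)
      (simp_all add: conn_op_apply blinfun.add_left blinfun.scaleR_left vec_eq_iff matrix_vector_mult_def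
        sum.distrib scaleR_conv_of_real[where 'a = complex] sum_distrib_left algebra_simps)
  then show ?thesis by (simp add: linear_conv_bounded_linear)
qed

context higgs_chart
begin

text \<open>With \<Phi> = 0 the (2,0) part of the flatness of the full connection is the curvature
  of D' alone. This is the half of the integrability condition that does not come from holomorphy of
  D'.\<close>

lemma curvature_zero:
  assumes z: "z \<in> S"
  shows "wirt_vec i (\<lambda>x. \<theta> j x *v u) z + \<theta> i z *v (\<theta> j z *v u)
    = wirt_vec j (\<lambda>x. \<theta> i x *v u) z + \<theta> j z *v (\<theta> i z *v u)"
proof -
  \<comment> \<open>\<Phi> stands under a derivative here, so its vanishing on the whole open set is
    used and not merely at \<open>z\<close>.\<close>
  have w: "wirt_vec i (\<lambda>x. \<theta> j x *v u + \<Phi> j x *v u) z = wirt_vec i (\<lambda>x. \<theta> j x *v u) z" for i j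
    by (rule wirt_vec_cong(1)[OF _ open_S z, symmetric])
      (simp_all add: differentiable_matrix_vector_mult differentiable_\<theta>[OF z] higgs_zero)
  have "vanishes_on S (comm (\<lambda>s z. Dprime \<theta> i s z + \<Phi> i z *v s z) (\<lambda>s z. Dprime \<theta> j s z + \<Phi> j z *v s z))"
    using flat unfolding flat_on_def by blast
  from vanishes_const[OF this z, of u] show ?thesis
    by (simp add: comm_def Dprime_def w higgs_zero[OF z])
qed

text \<open>The commutator is tested on the constant section with value \<open>s z\<close>; the
  product rule then covers any \<open>s\<close> differentiable at \<open>z\<close>.\<close>

lemma Dprime_parallel_section:
  assumes Q: "vanishes_on S (comm (Dprime \<theta> i) (act Q))" and z: "z \<in> S" and s: "s differentiable at z"
  shows "Dprime \<theta> i (\<lambda>x. Q x *v s x) z = Q z *v Dprime \<theta> i s z"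
proof -
  have "wirt_vec i (\<lambda>x. Q x *v u) z + \<theta> i z *v (Q z *v u) = Q z *v (\<theta> i z *v u)" for u
    using vanishes_const[OF Q z, of u] by (simp add: comm_def Dprime_def act_def)
  from this[of "s z"] show ?thesis
    unfolding Dprime_def wirt_vec_matrix_vector_mult(1)[OF differentiable_Q[OF z] s]
    by (simp add: matrix_vector_right_distrib algebra_simps)
qed

text \<open>A D'-flat first slot and a \<partial>bar-closed second slot kill the holomorphic
  derivatives. The pair \<open>s'\<close>, \<open>t'\<close> presents the conjugate function in the
  same form, which kills the antiholomorphic ones. Two pairs are needed because
  \<open>Q x *v s k x\<close> is known to be D'-flat but not to be \<partial>bar-closed: it must
  stay in the first slot, and self-adjointness writes the conjugate with \<open>Q\<close> again in
  the first slot.\<close>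

lemma parallel_pairing_constant:
  assumes B: "ball p r \<subseteq> S"
    and d: "\<And>z. z \<in> ball p r \<Longrightarrow> s differentiable at z \<and> t differentiable at z
      \<and> s' differentiable at z \<and> t' differentiable at z"
    and D: "\<And>z i. z \<in> ball p r \<Longrightarrow> Dprime \<theta> i s z = 0 \<and> wirt_bar_vec i t z = 0
      \<and> Dprime \<theta> i s' z = 0 \<and> wirt_bar_vec i t' z = 0"
    and sym: "\<And>z. z \<in> ball p r \<Longrightarrow> g z (s' z) (t' z) = cnj (g z (s z) (t z))"
    and z: "z \<in> ball p r"
  shows "g z (s z) (t z) = g p (s p) (t p)"
proof (rule wirt_zero_constant[of p r "\<lambda>z. g z (s z) (t z)", OF _ _ _ z])
  fix x assume x: "x \<in> ball p r"
  then have xS: "x \<in> S" using B by auto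
  show df: "(\<lambda>z. g z (s z) (t z)) differentiable at x"
    using d[OF x] by (intro differentiable_g_section xS) auto
  show "wirt j (\<lambda>z. g z (s z) (t z)) x = 0" for j
    using wirt_g_section[OF xS, of s t j] d[OF x] D[OF x]
    by (simp add: herm_zero_left[OF herm[OF xS]] herm_zero_right[OF herm[OF xS]])
  fix j
  have "cnj (wirt_bar j (\<lambda>z. g z (s z) (t z)) x) = wirt j (\<lambda>z. cnj (g z (s z) (t z))) x"
    by (rule wirt_cnj[OF df, symmetric])
  also have "\<dots> = wirt j (\<lambda>z. g z (s' z) (t' z)) x"
    by (rule wirt_cong(1)[OF differentiable_cnj[OF df] open_ball x]) (simp add: sym)
  also have "\<dots> = 0"
    using wirt_g_section[OF xS, of s' t' j] d[OF x] D[OF x]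
    by (simp add: herm_zero_left[OF herm[OF xS]] herm_zero_right[OF herm[OF xS]])
  finally show "wirt_bar j (\<lambda>z. g z (s z) (t z)) x = 0" by simp
qed

text \<open>The equations D'e = 0 and \<partial>bar e = 0 form one total differential system with
  coefficient \<open>A\<close>. Its integrability splits into \<open>wirt_bar_\<theta>\<close> and
  \<open>curvature_zero\<close>. One radius serves all initial values.\<close>

lemma flat_sections:
  assumes p: "p \<in> S"
  obtains r where "r > 0" "ball p r \<subseteq> S"
    "\<And>E. \<exists>e. e p = E \<and> holo_vec (ball p r) e \<and> (\<forall>z\<in>ball p r. \<forall>i. Dprime \<theta> i e z = 0)"
proof -
  have "\<forall>i. \<exists>f'. (\<forall>x\<in>S. (\<theta> i has_derivative f' x) (at x)) \<and> (\<forall>v. continuous_on S (\<lambda>x. f' x v))"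
    using smooth_on_derivative[OF smooth_\<theta>] by metis
  then obtain \<theta>' where \<theta>': "\<And>i x. x \<in> S \<Longrightarrow> (\<theta> i has_derivative \<theta>' i x) (at x)"
    "\<And>i v. continuous_on S (\<lambda>x. \<theta>' i x v)" by metis
  define A where "A z = (\<Sum>i\<in>UNIV. conn_op i (\<theta> i z))" for z
  define A' where "A' z = Blinfun (\<lambda>w. \<Sum>i\<in>UNIV. conn_op i (\<theta>' i z w))" for z
  have A: "A z v u = - (\<Sum>i\<in>UNIV. v $ i *s (\<theta> i z *v u))" for z v u
    by (simp add: A_def blinfun.sum_left conn_op_apply sum_negf)
  have dA: "(A has_derivative (\<lambda>w. \<Sum>i\<in>UNIV. conn_op i (\<theta>' i z w))) (at z)" if "z \<in> S" for z
    unfolding A_def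
    by (intro has_derivative_sum bounded_linear.has_derivative[OF bounded_linear_conn_op] \<theta>' that)
  have A'_eq: "blinfun_apply (A' z) = (\<lambda>w. \<Sum>i\<in>UNIV. conn_op i (\<theta>' i z w))" if "z \<in> S" for z
    unfolding A'_def by (rule bounded_linear_Blinfun_apply[OF has_derivative_bounded_linear[OF dA[OF that]]])
  have cA': "continuous_on S A'"
  proof (rule continuous_on_blinfun_componentwise)
    fix w :: "complex^'m"
    have "continuous_on S (\<lambda>z. \<Sum>i\<in>UNIV. conn_op i (\<theta>' i z w))"
      by (intro continuous_on_sum bounded_linear.continuous_on[OF bounded_linear_conn_op] \<theta>')
    then show "continuous_on S (\<lambda>z. A' z w)"
      by (rule continuous_on_cong[THEN iffD2, rotated -1]) (simp_all add: A'_eq)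
  qed
  \<comment> \<open>Because \<partial>bar \<theta> = 0, the real derivative of the connection matrix
    contains only the holomorphic coordinates of the direction \<open>w\<close>.\<close>
  have \<theta>'_wirt: "\<theta>' i z w *v u = (\<Sum>j\<in>UNIV. w $ j *s wirt_vec j (\<lambda>x. \<theta> i x *v u) z)" if z: "z \<in> S" for i z w u
  proof (rule vec_eq_iff[THEN iffD2], rule allI)
    fix k
    have "((\<lambda>x. (\<theta> i x *v u) $ k) has_derivative (\<lambda>w. (\<theta>' i z w *v u) $ k)) (at z)"
      unfolding matrix_vector_mult_def vec_lambda_beta
      by (intro has_derivative_sum has_derivative_mult_left has_derivative_vec_nth \<theta>' z)
    from has_derivative_wirt[OF this, of w]
    show "(\<theta>' i z w *v u) $ k = (\<Sum>j\<in>UNIV. w $ j *s wirt_vec j (\<lambda>x. \<theta> i x *v u) z) $ k"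
      using wirt_bar_\<theta>[OF z, of _ i u] by (simp add: wirt_vec_def wirt_bar_vec_def vec_eq_iff)
  qed
  have integrability: "A' z a b w + A z b (A z a w) = A' z b a w + A z a (A z b w)" if z: "z \<in> S" for z a b w
  proof -
    have side: "A' z a b w + A z b (A z a w) = (\<Sum>i\<in>UNIV. \<Sum>j\<in>UNIV.
        (a $ j * b $ i) *s (\<theta> i z *v (\<theta> j z *v w) - wirt_vec j (\<lambda>x. \<theta> i x *v w) z))" for a b
    proof -
      have "A' z a b w = - (\<Sum>i\<in>UNIV. \<Sum>j\<in>UNIV. (a $ j * b $ i) *s wirt_vec j (\<lambda>x. \<theta> i x *v w) z)"
        by (simp add: A'_eq[OF z] blinfun.sum_left conn_op_apply sum_negf \<theta>'_wirt[OF z] vec_eq_iff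
            sum_distrib_left mult_ac)
      moreover have "A z b (A z a w) = (\<Sum>i\<in>UNIV. \<Sum>j\<in>UNIV. (a $ j * b $ i) *s (\<theta> i z *v (\<theta> j z *v w)))"
      proof -
        have "\<theta> i z *v (\<Sum>j\<in>UNIV. a $ j *s (\<theta> j z *v w)) = (\<Sum>j\<in>UNIV. a $ j *s (\<theta> i z *v (\<theta> j z *v w)))" for i
          by (simp add: vec.linear_sum[OF matrix_vector_mul_linear_gen] vector_scalar_commute)
        moreover have "\<theta> i z *v (- x) = - (\<theta> i z *v x)" for i x
          by (simp add: vec_eq_iff matrix_vector_mult_def sum_negf)
        ultimately show ?thesis
          unfolding A by (simp add: vec_eq_iff sum_negf sum_distrib_left mult_ac)
      qed
      ultimately show ?thesis
        by (simp add: vec_eq_iff sum_subtractf right_diff_distrib)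
    qed
    have sw: "\<theta> i z *v (\<theta> j z *v w) - wirt_vec j (\<lambda>x. \<theta> i x *v w) z
        = \<theta> j z *v (\<theta> i z *v w) - wirt_vec i (\<lambda>x. \<theta> j x *v w) z" for i j
      using curvature_zero[OF z, of i j w] by (simp add: algebra_simps)
    show ?thesis
      unfolding side by (subst sum.swap, intro sum.cong refl, subst sw, simp only: mult.commute)
  qed
  have AD: "(A has_derivative A' z) (at z)" if "z \<in> S" for z
    using dA[OF that] by (simp add: A'_eq[OF that])
  obtain r where r: "r > 0" "ball p r \<subseteq> S"
    and sol: "\<forall>E. \<exists>e. e p = E \<and> (\<forall>z\<in>ball p r. (e has_derivative (\<lambda>v. A z v (e z))) (at z))"
    using total_differential_system[OF open_S p AD cA' integrability] by blast
  have "\<exists>e. e p = E \<and> holo_vec (ball p r) e \<and> (\<forall>z\<in>ball p r. \<forall>i. Dprime \<theta> i e z = 0)" for E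
  proof -
    obtain e where e: "e p = E" "\<And>z. z \<in> ball p r \<Longrightarrow> (e has_derivative (\<lambda>v. A z v (e z))) (at z)"
      using sol by metis
    \<comment> \<open>The complex Jacobian of the solution, with columns
      \<open>- (\<theta> i z *v e z)\<close>. Its existence gives holomorphy, and reading off its
      columns gives D'e = 0.\<close>
    define J :: "complex^'m \<Rightarrow> complex^'m^'m" where "J z = (\<chi> k i. - (\<theta> i z *v e z) $ k)" for z
    have J: "A z v (e z) = J z *v v" for z v
      by (simp add: A J_def vec_eq_iff matrix_vector_mult_def[of "_ :: complex^'m^'m" v] mult.commute sum_negf)
    have eJ: "(e has_derivative (\<lambda>v. J z *v v)) (at z)" if "z \<in> ball p r" for z
      using e(2)[OF that] by (simp add: J)
    then have "holo_vec (ball p r) e" unfolding holo_vec_iff by blast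
    moreover have "Dprime \<theta> i e z = 0" if "z \<in> ball p r" for z i
      unfolding Dprime_def holo_wirt_vec(1)[OF eJ[OF that]]
      by (simp add: J_def mult_axis column_def vec_eq_iff)
    ultimately show ?thesis using e(1) by blast
  qed
  then show thesis by (rule that[OF r])
qed

lemma flat_eigenframe:
  assumes p: "p \<in> S" and Q: "\<And>i. vanishes_on S (comm (Dprime \<theta> i) (act Q))"
  obtains r and s :: "'m \<Rightarrow> complex^'m \<Rightarrow> complex^'m" and l where "r > 0" "ball p r \<subseteq> S" "\<And>k. holo_vec (ball p r) (s k)"
    "\<And>k z i. z \<in> ball p r \<Longrightarrow> Dprime \<theta> i (s k) z = 0"
    "\<And>k m z. z \<in> ball p r \<Longrightarrow> g z (s k z) (s m z) = (if k = m then 1 else 0)"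
    "\<And>k z. z \<in> ball p r \<Longrightarrow> Q z *v s k z = l k *s s k z"
proof -
  have Qsym: "g z (Q z *v u) v = g z u (Q z *v v)" if "z \<in> S" for z u v
    using herm_adj[OF herm[OF that], of "Q z" u v] Q_self_adjoint[OF that] by simp
  obtain E F :: "complex^'m^'m" and l where EF: "E ** F = mat 1" "F ** E = mat 1"
    and gF: "\<And>u v. g p u v = (\<Sum>k\<in>UNIV. (F *v u) $ k * cnj ((F *v v) $ k))"
    and QE: "Q p ** E = E ** diag_mat l"
    using herm_spectral[OF herm[OF p] Qsym[OF p]] by metis
  obtain r where r: "r > 0" "ball p r \<subseteq> S"
    and ex: "\<And>E. \<exists>e. e p = E \<and> holo_vec (ball p r) e \<and> (\<forall>z\<in>ball p r. \<forall>i. Dprime \<theta> i e z = 0)"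
    using flat_sections[OF p] by metis
  obtain s where s0: "\<And>k. s k p = E *v axis k 1" and hs: "\<And>k. holo_vec (ball p r) (s k)"
    and Ds: "\<And>k z i. z \<in> ball p r \<Longrightarrow> Dprime \<theta> i (s k) z = 0"
    using ex[of "E *v axis k 1" for k] by metis
  have ds: "s k differentiable at z" "wirt_bar_vec i (s k) z = 0" if "z \<in> ball p r" for k z i
    using hs[of k] that holo_wirt_vec(2) unfolding holo_vec_iff differentiable_def by metis+
  have dQs: "(\<lambda>x. Q x *v s k x) differentiable at z" "Dprime \<theta> i (\<lambda>x. Q x *v s k x) z = 0"
    if z: "z \<in> ball p r" for k z i
  proof -
    have zS: "z \<in> S" using z r by auto
    show "(\<lambda>x. Q x *v s k x) differentiable at z"
      by (rule differentiable_matrix_vector_mult[OF differentiable_Q[OF zS] ds(1)[OF z]])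
    show "Dprime \<theta> i (\<lambda>x. Q x *v s k x) z = 0"
      using Dprime_parallel_section[OF Q zS ds(1)[OF z]] Ds[OF z] by simp
  qed
  have FE: "F *v (E *v x) = x" for x by (simp add: matrix_vector_mul_assoc EF)
  have g0: "g p (s k p) (s m p) = (if k = m then 1 else 0)" for k m
  proof -
    have "(\<Sum>i\<in>UNIV. axis k 1 $ i * cnj (axis m 1 $ i))
        = (\<Sum>i\<in>UNIV. if i = k then (if k = m then 1 else 0 :: complex) else 0)"
      by (rule sum.cong) (auto simp: axis_def)
    then show ?thesis unfolding s0 gF FE by simp
  qed
  have Q0: "Q p *v s k p = l k *s s k p" for k
  proof -
    have "Q p *v s k p = E *v (diag_mat l *v axis k 1)"
      unfolding s0 by (simp add: matrix_vector_mul_assoc QE)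
    also have "diag_mat l *v axis k 1 = l k *s axis k 1"
      unfolding mult_axis by (simp add: diag_mat_def column_def vec_eq_iff axis_def)
    finally show ?thesis by (simp add: vector_scalar_commute s0)
  qed
  have pB: "p \<in> ball p r" using r by simp
  have gs: "g z (s k z) (s m z) = (if k = m then 1 else 0)" if z: "z \<in> ball p r" for k m z
  proof -
    have "g z (s k z) (s m z) = g p (s k p) (s m p)"
    proof (rule parallel_pairing_constant[OF r(2) _ _ _ z, of "s k" "s m" "s m" "s k"])
      fix z assume z: "z \<in> ball p r"
      show "g z (s m z) (s k z) = cnj (g z (s k z) (s m z))"
        using z r by (intro herm_sym[OF herm]) auto
    qed (use ds Ds in auto)
    then show ?thesis by (simp add: g0)
  qed
  have gQ: "g z (Q z *v s k z) (s m z) = l k * (if k = m then 1 else 0)" if z: "z \<in> ball p r" for k m z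
  proof -
    have "g z (Q z *v s k z) (s m z) = g p (Q p *v s k p) (s m p)"
    proof (rule parallel_pairing_constant[OF r(2) _ _ _ z,
          of "\<lambda>x. Q x *v s k x" "s m" "\<lambda>x. Q x *v s m x" "s k"])
      fix z assume "z \<in> ball p r"
      then have zS: "z \<in> S" using r by auto
      show "g z (Q z *v s m z) (s k z) = cnj (g z (Q z *v s k z) (s m z))"
        unfolding Qsym[OF zS, of "s m z"] by (rule herm_sym[OF herm[OF zS]])
    qed (use ds Ds dQs in auto)
    also have "\<dots> = l k * (if k = m then 1 else 0)"
      unfolding Q0 herm_scale_left[OF herm[OF p]] g0 ..
    finally show ?thesis .
  qed
  have Qs: "Q z *v s k z = l k *s s k z" if z: "z \<in> ball p r" for k z
  proof -
    have zS: "z \<in> S" using z r by auto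
    note h = herm[OF zS]
    \<comment> \<open>The defect is orthogonal to every member of the frame. The frame at
      \<open>z\<close> is still orthonormal, hence a basis, so the defect vanishes.\<close>
    let ?x = "Q z *v s k z - l k *s s k z"
    note ON = herm_orthonormal_matrix[OF h, of "\<lambda>k. s k z", OF gs[OF z]]
    have "g z ?x (s m z) = 0" for m
      by (simp add: herm_diff_left[OF h] herm_scale_left[OF h] gQ[OF z] gs[OF z])
    then have F0: "(\<chi> k i. g z (axis i 1) (s k z)) *v ?x = 0"
      by (simp add: vec_eq_iff ON(4))
    have "?x = 0"
      using arg_cong[OF F0, of "\<lambda>y. (\<chi> i k. s k z $ i) *v y"] ON(1) by (simp add: matrix_vector_mul_assoc)
    then show ?thesis by simp
  qed
  show thesis by (rule that[OF r hs Ds gs Qs])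
qed

end

section \<open>From one chart to the atlas: Jacobians, the global frame, the structure
  connection\<close>

section \<open>Passage between charts\<close>

lemma holo_fun_mult:
  assumes "holo_fun S f" "holo_fun S g"
  shows "holo_fun S (\<lambda>x. f x * g x)"
  unfolding holo_fun_def
proof
  fix x assume x: "x \<in> S"
  note f = holo_fun_frechet[OF assms(1) x] and g = holo_fun_frechet[OF assms(2) x]
  show "\<exists>L. ((\<lambda>x. f x * g x) has_derivative L) (at x) \<and> (\<forall>a v. L (a *s v) = a * L v)"
    by (rule exI, rule conjI, rule has_derivative_mult[OF f(1) g(1)])
      (simp add: f(2) g(2) algebra_simps)
qed

lemma holo_fun_sum:
  assumes "\<And>i. i \<in> I \<Longrightarrow> holo_fun S (f i)"
  shows "holo_fun S (\<lambda>x. \<Sum>i\<in>I. f i x)"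
  unfolding holo_fun_def
proof
  fix x assume x: "x \<in> S"
  note f = holo_fun_frechet[OF assms x]
  show "\<exists>L. ((\<lambda>x. \<Sum>i\<in>I. f i x) has_derivative L) (at x) \<and> (\<forall>a v. L (a *s v) = a * L v)"
    by (rule exI, rule conjI, rule has_derivative_sum, rule f(1)) (simp_all add: f(2) sum_distrib_left)
qed

lemma holo_vec_subset: "holo_vec S f \<Longrightarrow> T \<subseteq> S \<Longrightarrow> holo_vec T f"
  unfolding holo_vec_iff by blast

lemma holo_vec_compose:
  assumes "holo_vec S f" "holo_vec T g" "g ` T \<subseteq> S"
  shows "holo_vec T (\<lambda>x. f (g x))"
  unfolding holo_vec_iff
proof
  fix x assume x: "x \<in> T"
  obtain J where J: "(g has_derivative (\<lambda>v. J *v v)) (at x)"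
    using assms(2) x unfolding holo_vec_iff by blast
  obtain K where K: "(f has_derivative (\<lambda>v. K *v v)) (at (g x))"
    using assms(1,3) x unfolding holo_vec_iff by blast
  have "((\<lambda>x. f (g x)) has_derivative (\<lambda>v. (K ** J) *v v)) (at x)"
    using has_derivative_compose[OF J K] by (simp add: matrix_vector_mul_assoc)
  then show "\<exists>J. ((\<lambda>x. f (g x)) has_derivative (\<lambda>v. J *v v)) (at x)" by blast
qed

lemma hermitian_metric_parts:
  assumes "hermitian_metric \<A> h" "c \<in> \<A>"
  shows "z \<in> chart_img c UNIV \<Longrightarrow> herm_inner (h c z)" "smooth_on (chart_img c UNIV) (\<lambda>z. h c z u v)"
    "d \<in> \<A> \<Longrightarrow> z \<in> chart_img c (fst d) \<Longrightarrow>
      h d (transition c d z) (jac c d z *v u) (jac c d z *v v) = h c z u v"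
  using assms unfolding hermitian_metric_def by simp_all

lemma chern_connection_parts:
  assumes "chern_connection M \<A> h \<theta>"
  shows "c \<in> \<A> \<Longrightarrow> smooth_on (chart_img c UNIV) (\<theta> c i)"
    "open V \<Longrightarrow> V \<subseteq> M \<Longrightarrow> smooth_vector_field \<A> V X \<Longrightarrow>
      vector_valued_form \<A> V (\<lambda>c i. Dprime (\<theta> c) i (X c))"
    "\<lbrakk>c \<in> \<A>; open W; W \<subseteq> chart_img c UNIV; smooth_on W s; smooth_on W t; z \<in> W\<rbrakk> \<Longrightarrow>
      wirt i (\<lambda>x. h c x (s x) (t x)) z = h c z (Dprime (\<theta> c) i s z) (t z) + h c z (s z) (wirt_bar_vec i t z)"
  using assms unfolding chern_connection_def by simp_all

lemma integrable_higgs_parts: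
  assumes "integrable_harmonic_higgs_bundle M \<A> h \<theta> \<Phi> U Q"
  shows "hermitian_metric \<A> h" "chern_connection M \<A> h \<theta>" "higgs_field \<A> \<Phi>" "smooth_endo \<A> Q"
    "c \<in> \<A> \<Longrightarrow> flat_on (chart_img c UNIV) (\<lambda>i s z. Dprime (\<theta> c) i s z + \<Phi> c i z *v s z)
      (\<lambda>i s z. wirt_bar_vec i s z + herm_adj (h c z) (\<Phi> c i z) *v s z)"
    "c \<in> \<A> \<Longrightarrow> z \<in> chart_img c UNIV \<Longrightarrow> herm_adj (h c z) (Q c z) = Q c z"
    "c \<in> \<A> \<Longrightarrow> vanishes_on (chart_img c UNIV) (\<lambda>s z. comm (Dprime (\<theta> c) i) (act (U c)) s z
      - (\<Phi> c i z ** Q c z - Q c z ** \<Phi> c i z) *v s z + \<Phi> c i z *v s z)"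
    "c \<in> \<A> \<Longrightarrow> vanishes_on (chart_img c UNIV) (\<lambda>s z. comm (Dprime (\<theta> c) i) (act (Q c)) s z
      + (\<Phi> c i z ** herm_adj (h c z) (U c z) - herm_adj (h c z) (U c z) ** \<Phi> c i z) *v s z)"
  using assms unfolding integrable_harmonic_higgs_bundle_def harmonic_higgs_bundle_def by simp_all

context
  fixes M :: "'p::{t2_space, second_countable_topology} set" and \<A> :: "('p, 'm::finite) chart set"
  assumes M: "complex_manifold M \<A>"
begin

lemma chart_homeomorphism:
  assumes "c \<in> \<A>"
  shows "open (fst c)" "open (snd c ` fst c)"
    "homeomorphism (fst c) (snd c ` fst c) (snd c) (inv_into (fst c) (snd c))"
  using M assms unfolding complex_manifold_def is_chart_def by blast+

lemma open_chart_img: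
  assumes "c \<in> \<A>" "open V"
  shows "open (chart_img c V)"
proof -
  note c = chart_homeomorphism[OF assms(1)]
  have "openin (top_of_set (fst c)) (fst c \<inter> V)" using assms(2) by (rule openin_open_Int)
  from homeomorphism_imp_open_map[OF c(3) this]
  show ?thesis unfolding chart_img_def using c(2) openin_open_trans by blast
qed

lemma transition_apply:
  assumes "c \<in> \<A>" "q \<in> fst c"
  shows "transition c d (snd c q) = snd d q"
  using homeomorphism_apply1[OF chart_homeomorphism(3)[OF assms(1)] assms(2)]
  by (simp add: transition_def)

text \<open>\<open>jacobian\<close> records only the images of the vectors \<open>axis j 1\<close>.
  Complex linearity of the derivative ensures that the complex matrix still determines it.\<close>

lemma transition_has_derivative:
  assumes "c \<in> \<A>" "d \<in> \<A>" "z \<in> chart_img c (fst d)"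
  shows "(transition c d has_derivative (\<lambda>v. jac c d z *v v)) (at z)"
proof -
  have "holo_vec (chart_img c (fst d)) (transition c d)"
    using M assms unfolding complex_manifold_def by blast
  then obtain J where J: "(transition c d has_derivative (\<lambda>v. J *v v)) (at z)"
    using assms(3) unfolding holo_vec_iff by blast
  then have "jac c d z = matrix (\<lambda>v. J *v v)"
    unfolding jac_def jacobian_def using frechet_derivative_at[OF J] by simp
  also have "\<dots> = J" by (simp add: matrix_def mult_axis column_def)
  finally show ?thesis using J by simp
qed

text \<open>The chain rule, applied on the image of the triple overlap: only there does the
  composite of two coordinate changes agree with the third.\<close>

lemma jac_cocycle:
  assumes A: "c \<in> \<A>" "d \<in> \<A>" "e \<in> \<A>" and q: "q \<in> fst c" "q \<in> fst d" "q \<in> fst e"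
  shows "jac c e (snd c q) = jac d e (snd d q) ** jac c d (snd c q)"
proof -
  let ?T = "chart_img c (fst d \<inter> fst e)"
  have T: "open ?T" by (intro open_chart_img open_Int chart_homeomorphism(1) A)
  have z: "snd c q \<in> ?T" "snd c q \<in> chart_img c (fst d)" "snd c q \<in> chart_img c (fst e)"
    "snd d q \<in> chart_img d (fst e)"
    using q by (auto simp: chart_img_def)
  have "(transition d e has_derivative (\<lambda>v. jac d e (snd d q) *v v)) (at (transition c d (snd c q)))"
    using transition_has_derivative[OF A(2,3) z(4)] by (simp add: transition_apply[OF A(1) q(1)])
  from has_derivative_compose[OF transition_has_derivative[OF A(1,2) z(2)] this]
  have "((\<lambda>y. transition d e (transition c d y)) has_derivative
      (\<lambda>v. jac d e (snd d q) *v (jac c d (snd c q) *v v))) (at (snd c q))" .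
  then have "(transition c e has_derivative (\<lambda>v. jac d e (snd d q) *v (jac c d (snd c q) *v v))) (at (snd c q))"
    by (rule has_derivative_transform_within_open[OF _ T z(1)])
      (auto simp: chart_img_def transition_apply[OF A(1)] transition_apply[OF A(2)])
  from has_derivative_unique[OF transition_has_derivative[OF A(1,3) z(3)] this]
  show ?thesis by (simp add: matrix_eq matrix_vector_mul_assoc[symmetric] fun_eq_iff)
qed

lemma jac_refl:
  assumes "c \<in> \<A>" "q \<in> fst c"
  shows "jac c c (snd c q) = mat 1"
proof -
  have z: "snd c q \<in> chart_img c (fst c)" using assms by (auto simp: chart_img_def)
  have "((\<lambda>y. y) has_derivative (\<lambda>v. v)) (at (snd c q))" by (rule has_derivative_ident)
  then have "(transition c c has_derivative (\<lambda>v. v)) (at (snd c q))"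
    by (rule has_derivative_transform_within_open[OF _ open_chart_img[OF assms(1) chart_homeomorphism(1)[OF assms(1)]] z])
      (auto simp: chart_img_def transition_apply[OF assms(1)])
  from has_derivative_unique[OF transition_has_derivative[OF assms(1,1) z] this]
  show ?thesis by (simp add: matrix_eq fun_eq_iff)
qed

lemma jac_inverse:
  assumes "c \<in> \<A>" "d \<in> \<A>" "q \<in> fst c" "q \<in> fst d"
  shows "jac c d (snd c q) ** jac d c (snd d q) = mat 1"
  using jac_cocycle[of d c d q] jac_refl[of d q] assms by simp

lemma integrable_higgs_chart:
  assumes H: "integrable_harmonic_higgs_bundle M \<A> h \<theta> \<Phi> U Q"
    and U: "Dprime_parallel \<A> \<theta> U" and D: "Dprime_holomorphic \<A> \<theta>" and c: "c \<in> \<A>"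
  shows "higgs_chart (chart_img c UNIV) (h c) (\<theta> c) (\<Phi> c) (Q c)"
proof
  let ?S = "chart_img c UNIV"
  note H' = integrable_higgs_parts[OF H]
  show S: "open ?S" by (rule open_chart_img[OF c open_UNIV])
  show "herm_inner (h c z)" if "z \<in> ?S" for z by (rule hermitian_metric_parts(1)[OF H'(1) c that])
  show "smooth_on ?S (\<lambda>z. h c z u v)" for u v by (rule hermitian_metric_parts(2)[OF H'(1) c])
  show "smooth_on ?S (\<theta> c i)" for i by (rule chern_connection_parts(1)[OF H'(2) c])
  show "smooth_on ?S (Q c)" using H'(4) c unfolding smooth_endo_def by simp
  show "wirt i (\<lambda>x. h c x (s x) (t x)) z = h c z (Dprime (\<theta> c) i s z) (t z) + h c z (s z) (wirt_bar_vec i t z)"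
    if "open W" "W \<subseteq> ?S" "smooth_on W s" "smooth_on W t" "z \<in> W" for W s t z i
    by (rule chern_connection_parts(3)[OF H'(2) c that])
  show "vanishes_on ?S (comm (Dprime (\<theta> c) i) (wirt_bar_vec j))" for i j
    using D c unfolding Dprime_holomorphic_def by simp
  show "holo_mat ?S (\<Phi> c i)" for i using H'(3) c unfolding higgs_field_def by simp
  show "flat_on ?S (\<lambda>i s z. Dprime (\<theta> c) i s z + \<Phi> c i z *v s z)
      (\<lambda>i s z. wirt_bar_vec i s z + herm_adj (h c z) (\<Phi> c i z) *v s z)" by (rule H'(5)[OF c])
  show "herm_adj (h c z) (Q c z) = Q c z" if "z \<in> ?S" for z by (rule H'(6)[OF c that])
  fix z i assume z: "z \<in> ?S"
  have "(\<Phi> c i z ** Q c z - Q c z ** \<Phi> c i z) *v u = \<Phi> c i z *v u" for u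
  proof -
    have "vanishes_on ?S (comm (Dprime (\<theta> c) i) (act (U c)))"
      using U c unfolding Dprime_parallel_def by simp
    with H'(7)[OF c, of i] z S have "comm (Dprime (\<theta> c) i) (act (U c)) (\<lambda>_. u) z = 0"
      "comm (Dprime (\<theta> c) i) (act (U c)) (\<lambda>_. u) z
        - (\<Phi> c i z ** Q c z - Q c z ** \<Phi> c i z) *v u + \<Phi> c i z *v u = 0"
      using smooth_on_const[of ?S u] unfolding vanishes_on_def by blast+
    then show ?thesis by simp
  qed
  then show "\<Phi> c i z ** Q c z - Q c z ** \<Phi> c i z = \<Phi> c i z"
    unfolding matrix_eq by blast
qed

lemma integrable_higgs_zero:
  assumes "integrable_harmonic_higgs_bundle M \<A> h \<theta> \<Phi> U Q"
    "Dprime_parallel \<A> \<theta> U" "Dprime_holomorphic \<A> \<theta>" "c \<in> \<A>" "z \<in> chart_img c UNIV"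
  shows "\<Phi> c i z = 0"
  by (rule higgs_chart.higgs_zero[OF integrable_higgs_chart[OF assms(1-4)] assms(5)])

text \<open>The frame is constructed in one chart \<open>c\<close> around \<open>p\<close> and
  pushed to every other chart by the Jacobian. Each property is then transported by its own
  transformation law: cocycle for the vector fields, invariance of \<open>h\<close> for the basis
  property, gluing of D' for flatness, conjugation by the Jacobian for \<open>Q\<close>.\<close>

lemma local_eigenframe:
  assumes H: "integrable_harmonic_higgs_bundle M \<A> h \<theta> \<Phi> U Q"
    and U: "Dprime_parallel \<A> \<theta> U" and D: "Dprime_holomorphic \<A> \<theta>" and p: "p \<in> M"
  shows "\<exists>V e l. open V \<and> p \<in> V \<and> V \<subseteq> M \<and> holo_frame \<A> V e \<and> Dprime_flat_frame \<A> \<theta> V e \<and>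
    endo_matrix_in_frame \<A> V e Q (diag_mat l)"
proof -
  obtain c where c: "c \<in> \<A>" "p \<in> fst c" using M p unfolding complex_manifold_def by blast
  have cM: "fst c \<subseteq> M" using M c unfolding complex_manifold_def by blast
  let ?S = "chart_img c UNIV"
  note hc = integrable_higgs_chart[OF H U D]
  interpret higgs_chart ?S "h c" "\<theta> c" "\<Phi> c" "Q c" by (rule hc[OF c(1)])
  \<comment> \<open>The equation for D'(\<Q>) has the commutator of \<Phi> with \<U>\<dagger> as its
    only other term, which disappears with \<Phi>.\<close>
  have parQ: "vanishes_on ?S (comm (Dprime (\<theta> c) i) (act (Q c)))" for i
  proof -
    show ?thesis
      using integrable_higgs_parts(8)[OF H c(1), of i]
      unfolding vanishes_on_def by (auto simp: higgs_zero subset_iff)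
  qed
  define z0 where "z0 = snd c p"
  have z0: "z0 \<in> ?S" using c by (auto simp: z0_def chart_img_def)
  obtain r and s :: "'m \<Rightarrow> complex^'m \<Rightarrow> complex^'m" and l where r: "r > 0" "ball z0 r \<subseteq> ?S"
    and hs: "\<And>k. holo_vec (ball z0 r) (s k)"
    and Ds: "\<And>k z i. z \<in> ball z0 r \<Longrightarrow> Dprime (\<theta> c) i (s k) z = 0"
    and gs: "\<And>k m z. z \<in> ball z0 r \<Longrightarrow> h c z (s k z) (s m z) = (if k = m then 1 else 0)"
    and Qs: "\<And>k z. z \<in> ball z0 r \<Longrightarrow> Q c z *v s k z = l k *s s k z"
    using flat_eigenframe[OF z0 parQ] by blast
  define V where "V = fst c \<inter> snd c -` ball z0 r"
  have V: "open V" "p \<in> V" "V \<subseteq> fst c"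
    using continuous_open_preimage[OF homeomorphism_cont1[OF chart_homeomorphism(3)[OF c(1)]]
        chart_homeomorphism(1)[OF c(1)] open_ball[of z0 r]] c r
    by (auto simp: V_def z0_def)
  have VB: "snd c q \<in> ball z0 r" if "q \<in> V" for q using that by (simp add: V_def)
  \<comment> \<open>The Jacobian belongs to the change from \<open>c\<close> to \<open>d\<close>, so
    it is evaluated at the \<open>c\<close>-coordinates of the point, recovered from
    \<open>w\<close> by the transition from \<open>d\<close> to \<open>c\<close>.\<close>
  define e where "e k d w = jac c d (transition d c w) *v s k (transition d c w)" for k d w
  have e: "e k d (snd d q) = jac c d (snd c q) *v s k (snd c q)" if "d \<in> \<A>" "q \<in> fst d" for k d q
    by (simp add: e_def transition_apply[OF that])
  have e_c: "e k c (snd c q) = s k (snd c q)" if "q \<in> V" for k q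
    using V that by (simp add: e[OF c(1)] jac_refl[OF c(1)] subset_iff)
  have oV: "open (chart_img d V)" if "d \<in> \<A>" for d by (rule open_chart_img[OF that V(1)])
  have vf: "vector_field \<A> V (e k)" for k
    unfolding vector_field_def
  proof (intro ballI)
    fix d d' z assume d: "d \<in> \<A>" "d' \<in> \<A>" and "z \<in> chart_img d (fst d' \<inter> V)"
    then obtain q where q: "z = snd d q" "q \<in> fst d" "q \<in> fst d'" "q \<in> V" by (auto simp: chart_img_def)
    have "q \<in> fst c" using q V by blast
    then show "e k d' (transition d d' z) = jac d d' z *v e k d z"
      using jac_cocycle[OF c(1) d] q by (simp add: transition_apply[OF d(1)] e d matrix_vector_mul_assoc)
  qed
  have holo_e: "holo_vec (chart_img d V) (e k d)" if d: "d \<in> \<A>" for d k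
  proof -
    let ?T = "chart_img c (fst d \<inter> V)"
    have oT: "open (chart_img c (fst d))" by (rule open_chart_img[OF c(1) chart_homeomorphism(1)[OF d]])
    have "holo_vec (chart_img c (fst d)) (transition c d)"
      using M c(1) d unfolding complex_manifold_def by blast
    from holo_vec_directional[OF oT this transition_has_derivative[OF c(1) d]]
    have j: "holo_vec ?T (\<lambda>y. jac c d y *v axis i 1)" for i
      by (rule holo_vec_subset) (auto simp: chart_img_def)
    have "holo_vec ?T (s i)" for i
      using hs by (rule holo_vec_subset) (auto simp: chart_img_def V_def)
    then have s: "holo_fun ?T (\<lambda>y. s k y $ i)" for k i by (simp add: holo_vec_def)
    have "holo_fun ?T (\<lambda>y. jac c d y $ k $ i)" for k i
      using j[of i] unfolding mult_axis by (simp add: holo_vec_def column_def)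
    then have "holo_vec ?T (\<lambda>y. jac c d y *v s k y)"
      unfolding holo_vec_def matrix_vector_mult_def vec_lambda_beta
      by (intro allI holo_fun_sum holo_fun_mult s)
    moreover have "holo_vec (chart_img d V) (transition d c)"
    proof (rule holo_vec_subset)
      show "holo_vec (chart_img d (fst c)) (transition d c)"
        using M c(1) d unfolding complex_manifold_def by blast
    qed (use V(3) in \<open>auto simp: chart_img_def\<close>)
    moreover have "transition d c ` chart_img d V \<subseteq> ?T"
      using V(3) by (auto simp: chart_img_def transition_apply[OF d])
    ultimately show ?thesis unfolding e_def by (rule holo_vec_compose)
  qed
  \<comment> \<open>Orthonormality survives the change of chart by invariance of \<open>h\<close>;
    it yields bijectivity of \<open>frame_comb\<close> in every chart through
    \<open>herm_orthonormal_matrix\<close>.\<close>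
  have ON: "h d (snd d q) (e k d (snd d q)) (e m d (snd d q)) = (if k = m then 1 else 0)"
    if d: "d \<in> \<A>" and q: "q \<in> fst d" "q \<in> V" for d q k m
  proof -
    have qc: "q \<in> fst c" using q V by blast
    have "snd c q \<in> chart_img c (fst d)" using q qc by (auto simp: chart_img_def)
    then have "h d (transition c d (snd c q)) (jac c d (snd c q) *v u) (jac c d (snd c q) *v v)
        = h c (snd c q) u v" for u v
      by (rule hermitian_metric_parts(3)[OF integrable_higgs_parts(1)[OF H] c(1) d])
    then show ?thesis
      by (simp add: transition_apply[OF c(1) qc] e[OF d q(1)] gs[OF VB[OF q(2)]])
  qed
  have frame: "holo_frame \<A> V e"
    unfolding holo_frame_def holo_vector_field_def
  proof (intro conjI allI ballI vf holo_e)
    fix d z assume d: "d \<in> \<A>" and "z \<in> chart_img d V"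
    then obtain q where q: "z = snd d q" "q \<in> fst d" "q \<in> V" by (auto simp: chart_img_def)
    have "snd d q \<in> chart_img d UNIV" using q by (auto simp: chart_img_def)
    note hd = higgs_chart.herm[OF hc[OF d] this]
    note O = herm_orthonormal_matrix[OF hd, of "\<lambda>k. e k d (snd d q)", OF ON[OF d q(2,3)]]
    let ?E = "(\<chi> i k. e k d (snd d q) $ i) :: complex^'m^'m"
    let ?F = "(\<chi> k i. h d (snd d q) (axis i 1) (e k d (snd d q))) :: complex^'m^'m"
    have "frame_comb e d z = (\<lambda>f. ?E *v f)"
      unfolding frame_comb_def q(1) O(5) ..
    moreover have "bij (\<lambda>f. ?E *v f)"
      by (rule o_bij[of "\<lambda>f. ?F *v f"]) (simp_all add: fun_eq_iff matrix_vector_mul_assoc O(1,2))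
    ultimately show "bij (frame_comb e d z)" by simp
  qed
  have flat_c: "Dprime (\<theta> c) i (e k c) (snd c q) = 0" if q: "q \<in> V" for i k q
  proof -
    have z: "snd c q \<in> chart_img c V" using q V by (auto simp: chart_img_def)
    have "s k differentiable at (snd c q)"
      using hs[of k] VB[OF q] unfolding holo_vec_iff differentiable_def by blast
    then have "wirt_vec i (s k) (snd c q) = wirt_vec i (e k c) (snd c q)"
      by (rule wirt_vec_cong(1)[OF _ oV[OF c(1)] z]) (auto simp: chart_img_def e_c)
    then show ?thesis using Ds[OF VB[OF q], of i k] e_c[OF q, of k] by (simp add: Dprime_def)
  qed
  have flat: "Dprime_flat_frame \<A> \<theta> V e"
    unfolding Dprime_flat_frame_def
  proof (intro allI ballI)
    fix k d z i assume d: "d \<in> \<A>" and "z \<in> chart_img d V"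
    then obtain q where q: "z = snd d q" "q \<in> fst d" "q \<in> V" by (auto simp: chart_img_def)
    have qc: "q \<in> fst c" using q V by blast
    \<comment> \<open>Smoothness of holomorphic fields opens the gluing condition for D', which
      relates the already known vanishing in \<open>c\<close> to the components in
      \<open>d\<close>.\<close>
    have "smooth_vector_field \<A> V (e k)"
      unfolding smooth_vector_field_def using vf holo_vec_smooth_on[OF oV holo_e] by blast
    then have "vector_valued_form \<A> V (\<lambda>c i. Dprime (\<theta> c) i (e k c))"
      using V(1,3) cM by (intro chern_connection_parts(2)[OF integrable_higgs_parts(2)[OF H]]) auto
    moreover have "snd c q \<in> chart_img c (fst d \<inter> V)" using q qc by (auto simp: chart_img_def)
    ultimately have "jac c d (snd c q) *v Dprime (\<theta> c) j (e k c) (snd c q)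
        = (\<Sum>m\<in>UNIV. jac c d (snd c q) $ m $ j *s Dprime (\<theta> d) m (e k d) (transition c d (snd c q)))" for j
      using c(1) d unfolding vector_valued_form_def by blast
    then have 0: "(\<Sum>m\<in>UNIV. jac c d (snd c q) $ m $ j *s Dprime (\<theta> d) m (e k d) (snd d q)) = 0" for j
      by (simp add: flat_c[OF q(3)] transition_apply[OF c(1) qc])
    let ?J = "jac c d (snd c q)" and ?K = "jac d c (snd d q)"
    let ?X = "\<lambda>m. Dprime (\<theta> d) m (e k d) (snd d q)"
    have "?X i $ a = 0" for a
    proof -
      \<comment> \<open>The form index transforms by the transpose of \<open>?J\<close>, so
        \<open>0\<close> only says that this transpose annihilates the family \<open>?X\<close>;
        contracting with the inverse Jacobian \<open>?K\<close> isolates each member.\<close>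
      have "?X i $ a = (\<Sum>m\<in>UNIV. (?J ** ?K) $ m $ i * ?X m $ a)"
        unfolding jac_inverse[OF c(1) d qc q(2)] by (simp add: mat_def if_distrib[of "\<lambda>x. x * _"] cong: if_cong)
      also have "\<dots> = (\<Sum>j\<in>UNIV. ?K $ j $ i * (\<Sum>m\<in>UNIV. ?J $ m $ j *s ?X m) $ a)"
        unfolding matrix_matrix_mult_def by (simp add: sum_distrib_left sum_distrib_right mult_ac)
          (subst sum.swap, simp add: mult_ac)
      also have "\<dots> = 0" unfolding 0 by simp
      finally show ?thesis .
    qed
    then show "Dprime (\<theta> d) i (e k d) z = 0" by (simp add: q(1) vec_eq_iff)
  qed
  have "endo_matrix_in_frame \<A> V e Q (diag_mat l)"
    unfolding endo_matrix_in_frame_def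
  proof (intro ballI allI)
    fix d z m assume d: "d \<in> \<A>" and "z \<in> chart_img d V"
    then obtain q where q: "z = snd d q" "q \<in> fst d" "q \<in> V" by (auto simp: chart_img_def)
    have qc: "q \<in> fst c" using q V by blast
    have "snd c q \<in> chart_img c (fst d)" using q qc by (auto simp: chart_img_def)
    then have "jac c d (snd c q) ** Q c (snd c q) = Q d (transition c d (snd c q)) ** jac c d (snd c q)"
      using integrable_higgs_parts(4)[OF H] c(1) d unfolding smooth_endo_def by simp
    then have "Q d (snd d q) *v e m d (snd d q) = jac c d (snd c q) *v (Q c (snd c q) *v s m (snd c q))"
      by (simp add: transition_apply[OF c(1) qc] e[OF d q(2)] matrix_vector_mul_assoc)
    also have "\<dots> = l m *s e m d (snd d q)"
      by (simp add: Qs[OF VB[OF q(3)]] vector_scalar_commute e[OF d q(2)])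
    also have "\<dots> = (\<Sum>k\<in>UNIV. if k = m then l m *s e m d (snd d q) else 0)" by simp
    also have "\<dots> = (\<Sum>k\<in>UNIV. diag_mat l $ k $ m *s e k d (snd d q))"
      by (rule sum.cong) (auto simp: diag_mat_def)
    finally show "Q d z *v e m d z = (\<Sum>k\<in>UNIV. diag_mat l $ k $ m *s e k d z)" by (simp add: q(1))
  qed
  with V cM frame flat show ?thesis by blast
qed

text \<open>With \<Phi> and \<U> zero, the difference of the structure connection and D' is the
  zeroth-order term \<open>- Q + w/2\<close> times d\<zeta>/\<zeta>. The derivative part
  \<open>pb_Dprime\<close> is literally the same on both sides, so the claim is the pointwise
  identity \<open>fB\<close> between \<open>Q\<close> and its matrix in the frame.\<close>

lemma structure_connection_eigenframe:
  assumes H: "integrable_harmonic_higgs_bundle M \<A> h \<theta> \<Phi> U Q"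
    and \<Phi>: "\<And>c z i. c \<in> \<A> \<Longrightarrow> z \<in> chart_img c UNIV \<Longrightarrow> \<Phi> c i z = 0"
    and U: "\<And>c z. c \<in> \<A> \<Longrightarrow> z \<in> chart_img c UNIV \<Longrightarrow> U c z = 0"
    and e: "endo_matrix_in_frame \<A> V e Q (diag_mat l)"
  shows "structure_connection_in_frame \<A> V w h \<theta> \<Phi> U Q e (- diag_mat l + mat (of_int w / 2))"
  unfolding structure_connection_in_frame_def Let_def
proof (intro ballI allI impI)
  fix c W x and f :: "'m pb_lsection" assume c: "c \<in> \<A>" and x: "x \<in> W"
    and W: "open W \<and> W \<subseteq> (UNIV - {0}) \<times> chart_img c V \<and> smooth_on W f"
  obtain \<zeta> z where xz: "x = (\<zeta>, z)" by (cases x)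
  have zV: "z \<in> chart_img c V" and z: "z \<in> chart_img c UNIV"
    using W x xz by (auto simp: chart_img_def)
  have "herm_inner (h c z)"
    by (rule hermitian_metric_parts(1)[OF integrable_higgs_parts(1)[OF H] c z])
  \<comment> \<open>The adjoint is a definite description, so \<U>\<dagger> = 0 is obtained from its
    characterization for the inner product \<open>h c z\<close>.\<close>
  note U0 = U[OF c z] \<Phi>[OF c z] herm_adj_0[OF this]
  let ?B = "- diag_mat l + mat (of_int w / 2) :: complex^'m^'m"
  have Qe: "Q c z *v e k c z = l k *s e k c z" for k
  proof -
    have "Q c z *v e k c z = (\<Sum>m\<in>UNIV. diag_mat l $ m $ k *s e m c z)"
      using e c zV unfolding endo_matrix_in_frame_def by blast
    also have "\<dots> = (\<Sum>m\<in>UNIV. if m = k then l k *s e k c z else 0)"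
      by (rule sum.cong) (auto simp: diag_mat_def)
    finally show ?thesis by simp
  qed
  have B: "(?B *v y) $ k = - (l k * y $ k) + of_int w / 2 * y $ k" for y k
  proof -
    have "(?B *v y) $ k = (\<Sum>m\<in>UNIV. if m = k then - (l k * y $ k) + of_int w / 2 * y $ k else 0)"
      unfolding matrix_vector_mult_def vec_lambda_beta
      by (rule sum.cong) (auto simp: diag_mat_def mat_def algebra_simps)
    then show ?thesis by simp
  qed
  have fB: "frame_comb e c z (?B *v y) = - (Q c z *v frame_comb e c z y) + (of_int w / 2) *s frame_comb e c z y" for y
  proof -
    have "Q c z *v frame_comb e c z y = (\<Sum>k\<in>UNIV. y $ k *s (l k *s e k c z))"
      by (simp add: frame_comb_def vec.linear_sum[OF matrix_vector_mul_linear_gen] vector_scalar_commute Qe)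
    then show ?thesis
      unfolding frame_comb_def B
      by (simp add: vec_eq_iff sum_distrib_left sum_negf[symmetric] sum.distrib[symmetric] algebra_simps)
  qed
  show "case x of (\<zeta>, z) \<Rightarrow>
      structure_connection w h \<theta> \<Phi> U Q c (\<lambda>(\<zeta>, z). frame_comb e c z (f (\<zeta>, z))) \<zeta> z =
      (fst (pb_Dprime (\<theta> c) (\<lambda>(\<zeta>, z). frame_comb e c z (f (\<zeta>, z))) \<zeta> z) +
         (1 / \<zeta>) *s frame_comb e c z (?B *v f (\<zeta>, z)),
       snd (pb_Dprime (\<theta> c) (\<lambda>(\<zeta>, z). frame_comb e c z (f (\<zeta>, z))) \<zeta> z))"
    unfolding xz prod.case structure_connection_def Let_def U0 fB by (simp add: vec_eq_iff algebra_simps)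
qed

end

theorem theorem2:
  fixes M :: "'p::{t2_space, second_countable_topology} set"
    and \<A> :: "('p, 'm::finite) chart set"
    and h :: "('p, 'm) metric"
    and \<theta> \<Phi> :: "('p, 'm) endo_form"
    and U Q :: "('p, 'm) chart \<Rightarrow> complex^'m \<Rightarrow> complex^'m^'m"
    and w :: int
  assumes "complex_manifold M \<A>"
    and "integrable_harmonic_higgs_bundle M \<A> h \<theta> \<Phi> U Q"
    and "Dprime_parallel \<A> \<theta> U"
    and "Dprime_holomorphic \<A> \<theta>"
  shows "(\<forall>V X Y. open V \<and> V \<subseteq> M \<and> holo_vector_field \<A> V X \<and> holo_vector_field \<A> V Y \<longrightarrow>
            (\<forall>c\<in>\<A>. \<forall>z\<in>chart_img c V. higgs_product \<Phi> X Y c z = 0)) \<and>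
         ((\<forall>c\<in>\<A>. \<forall>z\<in>chart_img c UNIV. U c z = 0) \<longrightarrow>
            (\<forall>p\<in>M. \<exists>V e l. open V \<and> p \<in> V \<and> V \<subseteq> M \<and>
               holo_frame \<A> V e \<and> Dprime_flat_frame \<A> \<theta> V e \<and>
               endo_matrix_in_frame \<A> V e Q (diag_mat l) \<and>
               structure_connection_in_frame \<A> V w h \<theta> \<Phi> U Q e
                 (- diag_mat l + mat (of_int w / 2))))"
proof (intro conjI allI impI ballI)
  note zero = integrable_higgs_zero[OF assms]
  fix V X Y c z assume "c \<in> \<A>" "z \<in> chart_img c V"
  then have "\<Phi> c i z = 0" for i by (intro zero) (auto simp: chart_img_def)
  then show "higgs_product \<Phi> X Y c z = 0" by (simp add: higgs_product_def)
next
  note zero = integrable_higgs_zero[OF assms]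
  fix p assume U: "\<forall>c\<in>\<A>. \<forall>z\<in>chart_img c UNIV. U c z = 0" and p: "p \<in> M"
  obtain V e l where V: "open V" "p \<in> V" "V \<subseteq> M" "holo_frame \<A> V e" "Dprime_flat_frame \<A> \<theta> V e"
    "endo_matrix_in_frame \<A> V e Q (diag_mat l)"
    using local_eigenframe[OF assms p] by blast
  moreover have "structure_connection_in_frame \<A> V w h \<theta> \<Phi> U Q e (- diag_mat l + mat (of_int w / 2))"
    using structure_connection_eigenframe[OF assms(1,2) zero _ V(6)] U by blast
  ultimately show "\<exists>V e l. open V \<and> p \<in> V \<and> V \<subseteq> M \<and>
               holo_frame \<A> V e \<and> Dprime_flat_frame \<A> \<theta> V e \<and>
               endo_matrix_in_frame \<A> V e Q (diag_mat l) \<and>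
               structure_connection_in_frame \<A> V w h \<theta> \<Phi> U Q e
                 (- diag_mat l + mat (of_int w / 2))" by blast
qed

end
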